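(* Let $\mu$ be a finite positive Borel measure on $\mathbb{D}$, let $0<p\leq 1<q<\infty$ and $-1<\beta\leq\alpha<\infty$. Put $t=\frac{\beta+2}{\alpha+2}$ and let $q'$ be defined by $\frac1q+\frac1{q'}=1$. Then $T_{\mu,\beta}:L_a^p(\omega_\alpha)\to L_a^q(\omega_\beta)$ is bounded if and only if $\mu$ is a $\big(\frac1p+\frac{t}{q'}\big)$-Carleson measure for $L_a^1(\omega_\alpha)$.
   Context: $\mathbb{D}$ is the open unit disk in $\mathbb{C}$ and $dA$ is the normalized area measure on $\mathbb{D}$. For $-1<\alpha<\infty$, $\omega_\alpha(z)=(1+\alpha)(1-|z|^2)^\alpha$. For $0<p<\infty$, the weighted Bergman space $L_a^p(\omega_\alpha)$ consists of the analytic functions $f$ on $\mathbb{D}$ with $\|f\|_{L^p(\omega_\alpha)}:=\big(\int_{\mathbb{D}}|f(z)|^p\omega_\alpha(z)\,dA(z)\big)^{1/p}<\infty$. For a finite positive Borel measure $\mu$ on $\mathbb{D}$ and $\beta>-1$, the Toeplitz operator is $T_{\mu,\beta}(f)(z)=\int_{\mathbb{D}}\frac{f(w)}{(1-z\bar w)^{2+\beta}}\,d\mu(w)$, $z\in\mathbb{D}$. The operator $T_{\mu,\beta}:L_a^p(\omega_\alpha)\to L_a^q(\omega_\beta)$ is called bounded if there is a constant $C$ such that $\|T_{\mu,\beta}(f)\|_{L^q(\omega_\beta)}\leq C\|f\|_{L^p(\omega_\alpha)}$ for all polynomials $f$. For $0<s,p<\infty$ (here $s$ denotes the exponent), a finite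 positive Borel measure $\mu$ on $\mathbb{D}$ is an $s$-Carleson measure for $L_a^p(\omega_\alpha)$ if there is a constant $C>0$ with $\big(\int_{\mathbb{D}}|f|^s\,d\mu\big)^{1/s}\leq C\|f\|_{L^p(\omega_\alpha)}$ for all $f\in L_a^p(\omega_\alpha)$. *)

theory Defs
  imports "HOL-Analysis.Analysis" "HOL-Computational_Algebra.Polynomial"
begin

abbreviation unit_disk :: "complex set" where
  "unit_disk \<equiv> ball 0 1"

definition area_measure :: "complex measure" where
  "area_measure = scale_measure (ennreal (1 / pi)) (restrict_space lborel unit_disk)"

lemma emeasure_area_measure_unit_disk: "emeasure area_measure unit_disk = 1"
proof -
  have "emeasure lborel unit_disk = ennreal pi"
    using emeasure_ball[of 1 "0::complex"] by (simp add: unit_ball_vol_2)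
  then show ?thesis
    by (simp add: area_measure_def emeasure_restrict_space ennreal_mult[symmetric])
qed

definition bergman_weight :: "real \<Rightarrow> complex \<Rightarrow> real" where
  "bergman_weight \<alpha> z = (1 + \<alpha>) * (1 - (cmod z)\<^sup>2) powr \<alpha>"

text \<open>The library has no real powers on \<^typ>\<open>ennreal\<close>; this one is meant for \<open>a > 0\<close>.\<close>

definition ennreal_powr :: "ennreal \<Rightarrow> real \<Rightarrow> ennreal" where
  "ennreal_powr x a = (if x = top then top else ennreal (enn2real x powr a))"

text \<open>The value is \<^term>\<open>top\<close> exactly when the integral diverges, so the estimates below
  are not affected by the convention that a divergent Bochner integral is 0.\<close>

definition bergman_norm :: "real \<Rightarrow> real \<Rightarrow> (complex \<Rightarrow> complex) \<Rightarrow> ennreal" where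
  "bergman_norm p \<alpha> f =
     ennreal_powr (\<integral>\<^sup>+ z. ennreal (cmod (f z) powr p * bergman_weight \<alpha> z) \<partial>area_measure) (1 / p)"

definition bergman_space :: "real \<Rightarrow> real \<Rightarrow> (complex \<Rightarrow> complex) set" where
  "bergman_space p \<alpha> = {f. f holomorphic_on unit_disk \<and> bergman_norm p \<alpha> f < top}"

text \<open>For \<open>z, w\<close> in the disk, \<open>Re (1 - z * cnj w) > 0\<close>, so the principal branch chosen by
  \<^const>\<open>powr\<close> is the holomorphic one. For finite \<open>\<mu>\<close> and bounded measurable \<open>f\<close>, in particular
  for polynomials, the integrand is \<open>\<mu>\<close>-integrable for every \<open>z\<close> in the disk.\<close>

definition toeplitz :: "complex measure \<Rightarrow> real \<Rightarrow> (complex \<Rightarrow> complex) \<Rightarrow> complex \<Rightarrow> complex" where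
  "toeplitz \<mu> \<beta> f z = (\<integral>w. f w / (1 - z * cnj w) powr complex_of_real (2 + \<beta>) \<partial>\<mu>)"

definition toeplitz_bounded ::
    "complex measure \<Rightarrow> real \<Rightarrow> real \<Rightarrow> real \<Rightarrow> real \<Rightarrow> bool" where
  "toeplitz_bounded \<mu> p \<alpha> q \<beta> \<longleftrightarrow>
     (\<exists>C::real. C \<ge> 0 \<and> (\<forall>P::complex poly.
        bergman_norm q \<beta> (toeplitz \<mu> \<beta> (poly P)) \<le> ennreal C * bergman_norm p \<alpha> (poly P)))"

definition carleson_measure :: "real \<Rightarrow> real \<Rightarrow> real \<Rightarrow> complex measure \<Rightarrow> bool" where
  "carleson_measure s p \<alpha> \<mu> \<longleftrightarrow>
     (\<exists>C::real. C > 0 \<and> (\<forall>f\<in>bergman_space p \<alpha>.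
        ennreal_powr (\<integral>\<^sup>+ w. ennreal (cmod (f w) powr s) \<partial>\<mu>) (1 / s)
          \<le> ennreal C * bergman_norm p \<alpha> f))"

end

theory Submission
  imports Defs "HOL-Complex_Analysis.Complex_Analysis"
begin

text \<open>Both sides are equivalent to a bound \<open>\<mu> (D a) \<le> C (1 - \<bar>a\<bar>) powr \<sigma>\<close> with
  \<open>\<sigma> = (2 + \<alpha>) / p + (2 + \<beta>) / q'\<close>, where \<open>D a\<close> is the disk with centre \<open>a\<close> and radius
  \<open>(1 - \<bar>a\<bar>) / 2\<close>. Under this bound the sub-mean value property of \<open>\<bar>h\<bar> powr p\<close> for holomorphic \<open>h\<close>
  allows to replace \<open>d\<mu>\<close> by \<open>(1 - \<bar>w\<bar>) powr (\<sigma> - 2) dA\<close>. For the Carleson embedding this is enough,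
  since \<open>\<bar>f\<bar> powr s\<close> is \<open>\<bar>f\<bar>\<close> times a factor controlled by the pointwise bound on \<open>\<bar>f\<bar>\<close>. For the Toeplitz
  operator, the pointwise bound \<open>\<bar>f w\<bar> powr p (1 - \<bar>w\<bar>) powr (2 + \<alpha>) \<le> C \<parallel>f\<parallel> powr p\<close> leads to
  \<open>\<bar>T f z\<bar> \<le> C \<parallel>f\<parallel> powr (1 - p) \<integral> \<bar>f w\<bar> powr p (1 - \<bar>w\<bar>) powr (\<alpha> + (2 + \<beta>) / q') \<bar>1 - z cnj w\<bar> powr (-2 - \<beta>) dA\<close>,
  and Jensen's inequality for the measure \<open>\<bar>f\<bar> powr p (1 - \<bar>w\<bar>) powr \<alpha> dA\<close> together with the Forelli--Rudin
  estimate gives the bound in \<open>L powr q\<close>.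

  Conversely, the Carleson condition is tested on powers of the kernel. For the Toeplitz operator no duality is
  needed: integrating \<open>T f\<close> against \<open>cnj (z - a) ^ k\<close> over \<open>D a\<close> turns the kernel into its \<open>k\<close>-th derivative,
  and for \<open>f w = w ^ k (1 - cnj a w) powr (-2 - \<beta> - k)\<close> the result is a positive multiple of
  \<open>\<integral> \<bar>f\<bar>\<^sup>2 d\<mu>\<close>. Taking \<open>k\<close> large makes the norm of \<open>f\<close> accessible to the Forelli--Rudin estimate, and
  \<open>f\<close> is a uniform limit of polynomials on the disk.\<close>

subsection \<open>Area integrals of holomorphic functions\<close>

text \<open>The two sides meet because the Carleson exponent s = 1/p + t/q' satisfies s (2 +
  \<alpha>) = \<sigma>. The obstacle lies in the converse for the Toeplitz operator. As p \<le> 1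
  and \<beta> \<le> \<alpha>, the number (2 + \<beta>) p never exceeds 2 + \<alpha>, so the kernel
  with its natural exponent 2 + \<beta> is outside the range of the Forelli--Rudin estimate. Taking
  the k-th derivative raises the exponent to 2 + \<beta> + k. The price is a factor w^k that is
  small near 0, so centres with |a| < 1/2 are settled by the total mass of \<mu>. The operator is
  controlled on polynomials only, and T f is used merely as a measurable function; the test is
  therefore local, on a disk that stays away from the unit circle, where Fubini's theorem applies to
  bounded integrands. Only powers of 1 - |a| matter, never the constants. Area integrals are
  accordingly estimated by rotations, annuli and Cartesian slices rather than computed, and the
  weights (1 - |z|^2)^\<alpha> and (1 - |z|)^\<alpha> are exchanged freely.\<close>

lemma measurable_Complex [measurable (raw)]:
  assumes [measurable]: "f \<in> borel_measurable M" "g \<in> borel_measurable M"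
  shows "(\<lambda>x. Complex (f x) (g x)) \<in> borel_measurable M"
  unfolding Complex_eq by measurable

text \<open>The basis consists of 1 and i, so both measures give a box the product of its side
  lengths, and boxes determine Lebesgue measure. This makes Tonelli's theorem available in the
  coordinates \<open>Re\<close> and \<open>Im\<close>.\<close>

lemma lborel_complex:
  "(lborel :: complex measure) = distr (lborel \<Otimes>\<^sub>M lborel) borel (\<lambda>(x, y). Complex x y)"
proof (rule lborel_eqI)
  fix l u :: complex
  assume le: "\<And>b. b \<in> Basis \<Longrightarrow> l \<bullet> b \<le> u \<bullet> b"
  then have le': "Re l \<le> Re u" "Im l \<le> Im u"
    using le[of 1] le[of \<i>] by (auto simp: Basis_complex_def inner_complex_def)
  have "(\<lambda>(x, y). Complex x y) -` box l u \<inter> space (lborel \<Otimes>\<^sub>M lborel)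
      = box (Re l) (Re u) \<times> box (Im l) (Im u)"
    by (auto simp: space_pair_measure box_def Basis_complex_def inner_complex_def)
  then have "emeasure (distr (lborel \<Otimes>\<^sub>M lborel) borel (\<lambda>(x, y). Complex x y)) (box l u)
      = emeasure (lborel \<Otimes>\<^sub>M lborel) (box (Re l) (Re u) \<times> box (Im l) (Im u))"
    by (subst emeasure_distr) auto
  also have "\<dots> = emeasure lborel (box (Re l) (Re u)) * emeasure lborel (box (Im l) (Im u))"
    by (rule lborel.emeasure_pair_measure_Times) auto
  also have "\<dots> = ennreal (Re u - Re l) * ennreal (Im u - Im l)"
    using le' by (simp add: emeasure_lborel_box_eq)
  also have "\<dots> = ennreal ((Re u - Re l) * (Im u - Im l))"
    using le' by (simp add: ennreal_mult)
  also have "\<dots> = ennreal (\<Prod>b\<in>Basis. (u - l) \<bullet> b)"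
    by (simp add: Basis_complex_def inner_complex_def)
  finally show "emeasure (distr (lborel \<Otimes>\<^sub>M lborel) borel (\<lambda>(x, y). Complex x y)) (box l u)
      = ennreal (\<Prod>b\<in>Basis. (u - l) \<bullet> b)" .
qed simp

lemma nn_integral_complex:
  assumes [measurable]: "f \<in> borel_measurable borel"
  shows "(\<integral>\<^sup>+z. f z \<partial>lborel) = (\<integral>\<^sup>+x. \<integral>\<^sup>+y. f (Complex x y) \<partial>lborel \<partial>lborel)"
    and "(\<integral>\<^sup>+z. f z \<partial>lborel) = (\<integral>\<^sup>+y. \<integral>\<^sup>+x. f (Complex x y) \<partial>lborel \<partial>lborel)"
proof -
  have "(\<integral>\<^sup>+z. f z \<partial>lborel) = (\<integral>\<^sup>+z. f (Complex (fst z) (snd z)) \<partial>(lborel \<Otimes>\<^sub>M lborel))"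
    by (subst lborel_complex, subst nn_integral_distr) (auto simp: case_prod_beta)
  moreover have "\<dots> = (\<integral>\<^sup>+x. \<integral>\<^sup>+y. f (Complex x y) \<partial>lborel \<partial>lborel)"
    by (subst lborel.nn_integral_fst[symmetric]) (auto intro!: nn_integral_cong)
  moreover have "\<dots> = (\<integral>\<^sup>+y. \<integral>\<^sup>+x. f (Complex x y) \<partial>lborel \<partial>lborel)"
    by (rule lborel_pair.Fubini') measurable
  ultimately show "(\<integral>\<^sup>+z. f z \<partial>lborel) = (\<integral>\<^sup>+x. \<integral>\<^sup>+y. f (Complex x y) \<partial>lborel \<partial>lborel)"
    and "(\<integral>\<^sup>+z. f z \<partial>lborel) = (\<integral>\<^sup>+y. \<integral>\<^sup>+x. f (Complex x y) \<partial>lborel \<partial>lborel)"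
    by simp_all
qed

lemma nn_integral_real_shift:
  fixes f :: "real \<Rightarrow> ennreal"
  assumes "f \<in> borel_measurable borel"
  shows "(\<integral>\<^sup>+x. f (x + c) \<partial>lborel) = (\<integral>\<^sup>+x. f x \<partial>lborel)"
  using nn_integral_real_affine[OF assms, of 1 c] by (simp add: add.commute)

text \<open>On each line parallel to the shear the map is a translation, under which one-dimensional
  Lebesgue measure is invariant.\<close>

lemma nn_integral_complex_shear:
  assumes [measurable]: "f \<in> borel_measurable borel"
  shows "(\<integral>\<^sup>+z. f (Complex (Re z + t * Im z) (Im z)) \<partial>lborel) = (\<integral>\<^sup>+z. f z \<partial>lborel)"
    and "(\<integral>\<^sup>+z. f (Complex (Re z) (Im z + t * Re z)) \<partial>lborel) = (\<integral>\<^sup>+z. f z \<partial>lborel)"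
proof -
  show "(\<integral>\<^sup>+z. f (Complex (Re z + t * Im z) (Im z)) \<partial>lborel) = (\<integral>\<^sup>+z. f z \<partial>lborel)"
    by (simp add: nn_integral_complex(2) nn_integral_real_shift[of "\<lambda>x. f (Complex x _)"])
  show "(\<integral>\<^sup>+z. f (Complex (Re z) (Im z + t * Re z)) \<partial>lborel) = (\<integral>\<^sup>+z. f z \<partial>lborel)"
    by (simp add: nn_integral_complex(1) nn_integral_real_shift[of "\<lambda>y. f (Complex _ y)"])
qed

text \<open>A plane rotation (other than by \<open>\<pi>\<close>) is a product of three shears.\<close>

lemma nn_integral_rotate:
  assumes [measurable]: "f \<in> borel_measurable borel" and u: "cmod u = 1" "u \<noteq> -1"
  shows "(\<integral>\<^sup>+z. f (u * z) \<partial>lborel) = (\<integral>\<^sup>+z. f z \<partial>lborel)"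
proof -
  \<comment> \<open>For \<open>u = cis \<theta>\<close> this is the tangent of \<theta>/2. The
    rotation is the horizontal shear by -t, then the vertical one by \<open>Im u\<close>, then the
    horizontal one by -t again; \<open>t1\<close> and \<open>t2\<close> are the half-angle
    identities behind this.\<close>
  define t where "t = Im u / (1 + Re u)"
  have u2: "Re u * Re u + Im u * Im u = 1"
    using u by (simp add: cmod_def power2_eq_square)
  have c: "1 + Re u \<noteq> 0"
  proof
    assume h: "1 + Re u = 0"
    then have r: "Re u = -1" by simp
    with u2 have "Im u = 0" by simp
    with r have "u = -1" by (simp add: complex_eq_iff)
    with u show False by simp
  qed
  have t1: "t * (1 + Re u) = Im u"
    using c by (simp add: t_def)
  have t2: "1 - t * Im u = Re u"
  proof -
    have "(1 - t * Im u) * (1 + Re u) = (1 + Re u) - (t * (1 + Re u)) * Im u"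
      by (simp add: algebra_simps)
    also have "\<dots> = Re u * (1 + Re u)"
      unfolding t1 using u2 by (simp add: algebra_simps)
    finally show ?thesis using c by simp
  qed
  define f1 where "f1 z = f (Complex (Re z + (-t) * Im z) (Im z))" for z
  define f2 where "f2 z = f1 (Complex (Re z) (Im z + Im u * Re z))" for z
  have m1[measurable]: "f1 \<in> borel_measurable borel"
    unfolding f1_def by measurable
  have m2[measurable]: "f2 \<in> borel_measurable borel"
    unfolding f2_def by measurable
  have "f2 (Complex (Re z + (-t) * Im z) (Im z)) = f (u * z)" for z
  proof -
    have "Im z + Im u * (Re z - t * Im z) = Im u * Re z + (1 - t * Im u) * Im z"
      by (simp add: algebra_simps)
    then have im: "Im z + Im u * (Re z - t * Im z) = Im (u * z)"
      unfolding t2 by simp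
    have "Re z - t * Im z - t * Im (u * z)
        = (1 - t * Im u) * Re z - (t * (1 + Re u)) * Im z"
      by (simp add: algebra_simps)
    then have re: "Re z - t * Im z - t * Im (u * z) = Re (u * z)"
      unfolding t1 t2 by simp
    have "Complex (Re z - t * Im z - t * Im (u * z)) (Im (u * z)) = u * z"
      unfolding re by (rule complex_surj)
    then show ?thesis
      unfolding f2_def f1_def using im by simp
  qed
  then have "(\<integral>\<^sup>+z. f (u * z) \<partial>lborel)
      = (\<integral>\<^sup>+z. f2 (Complex (Re z + (-t) * Im z) (Im z)) \<partial>lborel)"
    by simp
  also have "\<dots> = (\<integral>\<^sup>+z. f2 z \<partial>lborel)"
    by (rule nn_integral_complex_shear) measurable
  also have "\<dots> = (\<integral>\<^sup>+z. f1 z \<partial>lborel)"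
    unfolding f2_def by (rule nn_integral_complex_shear) measurable
  also have "\<dots> = (\<integral>\<^sup>+z. f z \<partial>lborel)"
    unfolding f1_def by (rule nn_integral_complex_shear) measurable
  finally show ?thesis .
qed

lemma lborel_distr_rotate:
  fixes u :: complex
  assumes "cmod u = 1" "u \<noteq> -1"
  shows "distr lborel borel ((*) u) = lborel"
proof (rule measure_eqI)
  fix A assume "A \<in> sets (distr lborel borel ((*) u))"
  then have [measurable]: "A \<in> sets borel" by simp
  have "emeasure (distr lborel borel ((*) u)) A
      = (\<integral>\<^sup>+z. indicator A z \<partial>distr lborel borel ((*) u))"
    by simp
  also have "\<dots> = (\<integral>\<^sup>+z. indicator A (u * z) \<partial>lborel)"
    by (rule nn_integral_distr) measurable
  also have "\<dots> = emeasure lborel A"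
    using nn_integral_rotate[OF _ assms, of "indicator A"] by simp
  finally show "emeasure (distr lborel borel ((*) u)) A = emeasure lborel A" .
qed simp

section \<open>Moments of disks and Taylor coefficients as area integrals\<close>

lemma set_integrable_ball:
  fixes f :: "'a::euclidean_space \<Rightarrow> 'b::{banach, second_countable_topology}"
  assumes "continuous_on (cball a r) f"
  shows "set_integrable lborel (ball a r) f"
proof (rule set_integrable_subset)
  show "set_integrable lborel (cball a r) f"
    unfolding set_integrable_def by (intro borel_integrable_compact assms) auto
qed auto

text \<open>A rotation by \<open>u\<close> preserves the disk and the measure but multiplies the
  integrand by \<open>u ^ n * cnj u ^ k\<close>. If this factor is not 1, the integral is a
  nontrivial multiple of itself.\<close>

lemma area_moment_0:
  fixes r :: real
  assumes "n \<noteq> k"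
  shows "(LINT z:ball 0 r|lborel. z ^ n * cnj z ^ k) = (0::complex)"
proof -
  \<comment> \<open>The angle is so small that (n - k) \<theta> is a nonzero number in [-1, 1],
    hence has nonzero sine; \<open>\<theta> \<le> 1\<close> also excludes
    \<open>u = -1\<close>.\<close>
  define \<theta> where "\<theta> = 1 / real (n + k)"
  define u where "u = cis \<theta>"
  have nk: "n + k > 0" using assms by auto
  have th: "0 < \<theta>" "\<theta> \<le> 1"
    using nk by (auto simp: \<theta>_def field_simps)
  have u1: "cmod u = 1" by (simp add: u_def)
  have "\<theta> < pi" using th pi_gt3 by linarith
  then have "sin \<theta> > 0" using th by (intro sin_gt_zero) auto
  then have u2: "u \<noteq> -1" by (auto simp: u_def complex_eq_iff)
  have uk: "u ^ n * cnj u ^ k = cis ((real n - real k) * \<theta>)"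
    unfolding u_def cis_cnj Complex.DeMoivre cis_mult by (simp add: algebra_simps)
  have "\<bar>(real n - real k) * \<theta>\<bar> \<le> 1"
    using nk by (simp add: \<theta>_def abs_mult divide_le_eq_1) linarith
  moreover have "(real n - real k) * \<theta> \<noteq> 0"
    using assms th by simp
  ultimately have "sin \<bar>(real n - real k) * \<theta>\<bar> > 0"
    using pi_gt3 by (intro sin_gt_zero) linarith+
  then have "sin ((real n - real k) * \<theta>) \<noteq> 0"
    by (metis abs_if less_irrefl neg_0_equal_iff_equal sin_minus)
  then have ne: "u ^ n * cnj u ^ k \<noteq> 1"
    unfolding uk by (auto simp: complex_eq_iff)
  let ?g = "\<lambda>z. indicator (ball 0 r) z *\<^sub>R (z ^ n * cnj z ^ k)"
  have [measurable]: "?g \<in> borel_measurable borel"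
    by (intro borel_measurable_scaleR borel_measurable_indicator borel_measurable_continuous_onI
        continuous_intros) auto
  have "integral\<^sup>L lborel ?g = integral\<^sup>L (distr lborel borel ((*) u)) ?g"
    by (simp add: lborel_distr_rotate[OF u1 u2])
  also have "\<dots> = (\<integral>z. ?g (u * z) \<partial>lborel)"
    by (rule integral_distr) measurable
  also have "\<dots> = (\<integral>z. (u ^ n * cnj u ^ k) * ?g z \<partial>lborel)"
    by (rule Bochner_Integration.integral_cong)
      (auto simp: indicator_def norm_mult u1 power_mult_distrib)
  also have "\<dots> = (u ^ n * cnj u ^ k) * integral\<^sup>L lborel ?g"
    by (rule integral_mult_right_zero)
  finally show ?thesis
    using ne by (simp add: set_lebesgue_integral_def)
qed

lemma area_moment_diag:
  "(LINT z:ball 0 r|lborel. z ^ k * cnj z ^ k) = complex_of_real (LINT z:ball 0 r|lborel. cmod z ^ (2 * k))"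
proof -
  have "z ^ k * cnj z ^ k = complex_of_real (cmod z ^ (2 * k))" for z
    by (metis complex_norm_square of_real_power power_mult power_mult_distrib)
  then show ?thesis
    by (simp add: set_lebesgue_integral_def scaleR_conv_of_real flip: integral_complex_of_real)
qed

text \<open>Only the order r^(2k+2) matters, so the exact value pi r^(2k+2) / (k+1) is replaced by
  the contribution of the annulus between r/2 and r, where the integrand is at least
  (r/2)^(2k).\<close>

lemma area_moment_diag_ge:
  assumes r: "r > 0"
  shows "(LINT z:ball (0::complex) r|lborel. cmod z ^ (2 * k)) \<ge> r ^ (2 * k + 2) / 4 ^ (k + 1)"
proof -
  let ?A = "ball (0::complex) r - ball 0 (r / 2)"
  have m: "measure lborel (ball (0::complex) s) = pi * s\<^sup>2" if "s \<ge> 0" for s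
    using content_ball[of s "0::complex"] that by (simp add: unit_ball_vol_2 power2_eq_square)
  have "measure lborel ?A = pi * r\<^sup>2 - pi * (r / 2)\<^sup>2"
    using r emeasure_lborel_ball_finite[of "0::complex" r]
    by (subst measure_Diff) (auto simp: m)
  then have mA: "measure lborel ?A = 3 / 4 * pi * r\<^sup>2"
    by (simp add: field_simps power2_eq_square)
  have int: "set_integrable lborel (ball (0::complex) r) (\<lambda>z. cmod z ^ (2 * k))"
    by (intro set_integrable_ball continuous_intros)
  have intA: "set_integrable lborel ?A (\<lambda>z. (r / 2) ^ (2 * k))"
    by (rule set_integrable_subset[OF set_integrable_ball[of 0 r]]) auto
  have "(r / 2) ^ (2 * k) = r ^ (2 * k) / 4 ^ k"
    by (simp add: power_divide power_mult)
  then have "r ^ (2 * k + 2) / 4 ^ (k + 1) = (r / 2) ^ (2 * k) * (r\<^sup>2 / 4)"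
    by (simp add: power_add power2_eq_square mult.commute mult.left_commute)
  also have "\<dots> \<le> (r / 2) ^ (2 * k) * (3 / 4 * pi * r\<^sup>2)"
    using r pi_gt3 by (intro mult_left_mono) (auto simp: power2_eq_square field_simps)
  also have "\<dots> = (LINT z:?A|lborel. (r / 2) ^ (2 * k))"
    by (simp add: set_lebesgue_integral_def mA)
  also have "\<dots> \<le> (LINT z:ball (0::complex) r|lborel. cmod z ^ (2 * k))"
    using int intA unfolding set_lebesgue_integral_def set_integrable_def
    by (intro integral_mono) (auto simp: indicator_def intro!: power_mono)
  finally show ?thesis .
qed

lemma holomorphic_on_ball_imp_continuous_on_cball:
  assumes "g holomorphic_on ball a R" "r < R"
  shows "continuous_on (cball a r) g"
  by (rule continuous_on_subset[OF holomorphic_on_imp_continuous_on[OF assms(1)]])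
    (use assms(2) in auto)

text \<open>Monomials are orthogonal on a disk, so of the Taylor expansion of \<open>g\<close> about
  \<open>a\<close> only the k-th term survives integration against \<open>cnj (z - a) ^ k\<close>.
  Later \<open>g\<close> is the kernel of the Toeplitz operator.\<close>

lemma area_taylor:
  assumes hol: "g holomorphic_on ball a R" and r: "0 < r" "r < R"
  shows "(LINT z:ball a r|lborel. cnj (z - a) ^ k * g z)
    = (deriv ^^ k) g a / fact k * complex_of_real (LINT z:ball (0::complex) r|lborel. cmod z ^ (2 * k))"
proof -
  define c where "c n = (deriv ^^ n) g a / fact n" for n
  define M where "M = complex_of_real (LINT z:ball (0::complex) r|lborel. cmod z ^ (2 * k))"
  have ser: "(\<lambda>n. c n * z ^ n) sums g (a + z)" if "cmod z < R" for z
    using holomorphic_power_series[OF hol, of "a + z"] that by (simp add: c_def dist_norm)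
  define F where "F N z = indicator (ball 0 r) z *\<^sub>R (\<Sum>n<N. c n * (z ^ n * cnj z ^ k))" for N z
  define G where "G z = indicator (ball 0 r) z *\<^sub>R (cnj z ^ k * g (a + z))" for z
  have int: "integrable lborel (\<lambda>z::complex. indicator (ball 0 r) z *\<^sub>R (z ^ n * cnj z ^ k))" for n
    using set_integrable_ball[of 0 r "\<lambda>z. z ^ n * cnj z ^ k"]
    unfolding set_integrable_def by (simp add: continuous_intros)
  have F_alt: "F N z = (\<Sum>n<N. c n * (indicator (ball 0 r) z *\<^sub>R (z ^ n * cnj z ^ k)))" for N z
    by (simp add: F_def scaleR_sum_right)
  have intF: "integral\<^sup>L lborel (F N) = (if k < N then c k * M else 0)" for N
  proof -
    have "integral\<^sup>L lborel (F N)
        = (\<Sum>n<N. c n * (LINT z:ball 0 r|lborel. z ^ n * cnj z ^ k))"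
      unfolding F_alt set_lebesgue_integral_def
      by (simp only: Bochner_Integration.integral_sum[OF integrable_mult_right[OF int]]
          Bochner_Integration.integral_mult_right_zero)
    also have "\<dots> = (\<Sum>n<N. if n = k then c k * M else 0)"
      by (intro sum.cong refl) (auto simp: area_moment_0 area_moment_diag M_def)
    finally show ?thesis by simp
  qed
  \<comment> \<open>Convergence at a radius strictly above \<open>r\<close> makes the series
    absolutely convergent at \<open>r\<close>; the sum \<open>B\<close> of the moduli provides the
    majorant for dominated convergence.\<close>
  obtain \<rho> where \<rho>: "r < \<rho>" "\<rho> < R" using r dense by blast
  have "summable (\<lambda>n. c n * complex_of_real \<rho> ^ n)"
    using ser[of "complex_of_real \<rho>"] \<rho> r by (auto simp: sums_iff)
  then have sum: "summable (\<lambda>n. norm (c n * complex_of_real r ^ n))"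
    by (rule powser_insidea) (use \<rho> r in auto)
  then have sum': "summable (\<lambda>n. cmod (c n) * r ^ n)"
    using r by (simp add: norm_mult norm_power)
  define B where "B = (\<Sum>n. cmod (c n) * r ^ n)"
  have "(\<lambda>N. integral\<^sup>L lborel (F N)) \<longlonglongrightarrow> integral\<^sup>L lborel G"
  proof (rule integral_dominated_convergence)
    have "continuous_on (ball 0 r) (\<lambda>z. g (a + z))"
      by (rule continuous_on_compose2[OF holomorphic_on_imp_continuous_on[OF hol]])
        (use r in \<open>auto intro!: continuous_intros simp: dist_norm\<close>)
    then show "G \<in> borel_measurable lborel"
      unfolding G_def
      by (auto intro!: borel_measurable_continuous_on_indicator continuous_intros)
    show "F N \<in> borel_measurable lborel" for N
      unfolding F_def
      by (auto intro!: borel_measurable_continuous_on_indicator continuous_intros)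
    show "integrable lborel (\<lambda>z. indicator (ball (0::complex) r) z *\<^sub>R (B * r ^ k))"
      using set_integrable_ball[of "0::complex" r "\<lambda>z. B * r ^ k"]
      unfolding set_integrable_def by (auto intro!: continuous_intros)
    show "AE z in lborel. (\<lambda>N. F N z) \<longlonglongrightarrow> G z"
    proof (intro AE_I2)
      fix z
      show "(\<lambda>N. F N z) \<longlonglongrightarrow> G z"
      proof (cases "z \<in> ball 0 r")
        case True
        then have "(\<lambda>N. \<Sum>n<N. c n * z ^ n) \<longlonglongrightarrow> g (a + z)"
          using ser[of z] r by (simp add: sums_def)
        then have "(\<lambda>N. cnj z ^ k * (\<Sum>n<N. c n * z ^ n)) \<longlonglongrightarrow> cnj z ^ k * g (a + z)"
          by (intro tendsto_intros)
        then show ?thesis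
          using True by (simp add: F_def G_def sum_distrib_left mult_ac)
      qed (auto simp: F_def G_def)
    qed
    show "AE z in lborel. norm (F N z) \<le> indicator (ball 0 r) z *\<^sub>R (B * r ^ k)" for N
    proof (intro AE_I2)
      fix z
      show "norm (F N z) \<le> indicator (ball 0 r) z *\<^sub>R (B * r ^ k)"
      proof (cases "z \<in> ball 0 r")
        case True
        then have zr: "cmod z \<le> r" by simp
        have "norm (\<Sum>n<N. c n * (z ^ n * cnj z ^ k)) \<le> (\<Sum>n<N. cmod (c n) * (r ^ n * r ^ k))"
          by (rule order_trans[OF norm_sum], rule sum_mono)
            (use zr r in \<open>auto simp: norm_mult norm_power intro!: mult_mono mult_left_mono power_mono\<close>)
        also have "\<dots> = (\<Sum>n<N. cmod (c n) * r ^ n) * r ^ k"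
          by (simp add: sum_distrib_right mult.assoc)
        also have "\<dots> \<le> B * r ^ k"
          unfolding B_def using r by (intro mult_right_mono sum_le_suminf sum') auto
        finally show ?thesis using True by (simp add: F_def)
      qed (auto simp: F_def)
    qed
  qed
  moreover have "(\<lambda>N. integral\<^sup>L lborel (F N)) \<longlonglongrightarrow> c k * M"
    by (rule tendsto_eventually) (auto simp: intF eventually_sequentially intro!: exI[of _ "Suc k"])
  ultimately have G: "integral\<^sup>L lborel G = c k * M"
    by (rule LIMSEQ_unique)
  have "(LINT z:ball a r|lborel. cnj (z - a) ^ k * g z)
      = (\<integral>z. indicator (ball a r) z *\<^sub>R (cnj (z - a) ^ k * g z) \<partial>distr lborel borel ((+) a))"
    by (simp add: set_lebesgue_integral_def lborel_distr_plus)
  also have "\<dots> = (\<integral>z. indicator (ball a r) (a + z) *\<^sub>R (cnj (a + z - a) ^ k * g (a + z)) \<partial>lborel)"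
  proof (rule integral_distr)
    have "continuous_on (ball a r) g"
      by (rule continuous_on_subset[OF holomorphic_on_imp_continuous_on[OF hol]]) (use r in auto)
    then show "(\<lambda>z. indicator (ball a r) z *\<^sub>R (cnj (z - a) ^ k * g z)) \<in> borel_measurable borel"
      by (auto intro!: borel_measurable_continuous_on_indicator continuous_intros)
  qed auto
  also have "\<dots> = integral\<^sup>L lborel G"
    by (rule Bochner_Integration.integral_cong) (auto simp: G_def indicator_def dist_norm)
  finally show ?thesis
    by (simp add: G c_def M_def)
qed

section \<open>Mean value inequalities for holomorphic functions\<close>

lemma set_borel_measurable_holomorphic:
  assumes "g holomorphic_on S" "open S"
  shows "(\<lambda>z. indicator S z *\<^sub>R g z) \<in> borel_measurable borel"
  using assms by (auto intro!: borel_measurable_continuous_on_indicator holomorphic_on_imp_continuous_on)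

text \<open>This is \<open>area_taylor\<close> for k = 0, where the moment is the area of the
  disk.\<close>

lemma area_mean_value_le:
  assumes hol: "g holomorphic_on ball a R" and r: "0 < r" "r < R"
  shows "ennreal (cmod (g a) * (pi * r\<^sup>2)) \<le> (\<integral>\<^sup>+z\<in>ball a r. ennreal (cmod (g z)) \<partial>lborel)"
proof -
  have m: "(LINT z:ball (0::complex) r|lborel. 1) = pi * r\<^sup>2"
    using content_ball[of r "0::complex"] r
    by (simp add: set_lebesgue_integral_def unit_ball_vol_2 power2_eq_square)
  have int: "integrable lborel (\<lambda>z. indicator (ball a r) z *\<^sub>R g z)"
    using set_integrable_ball[OF holomorphic_on_ball_imp_continuous_on_cball[OF hol r(2)]]
    unfolding set_integrable_def .
  have "cmod (g a) * (pi * r\<^sup>2) = cmod (LINT z:ball a r|lborel. g z)"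
    using area_taylor[OF hol r, of 0] r by (simp add: m norm_mult norm_power)
  then have "ennreal (cmod (g a) * (pi * r\<^sup>2)) \<le> (\<integral>\<^sup>+z. norm (indicator (ball a r) z *\<^sub>R g z) \<partial>lborel)"
    using integral_norm_bound_ennreal[OF int] by (simp add: set_lebesgue_integral_def)
  also have "\<dots> = (\<integral>\<^sup>+z\<in>ball a r. ennreal (cmod (g z)) \<partial>lborel)"
    by (intro nn_integral_cong) (auto simp: indicator_def)
  finally show ?thesis .
qed

text \<open>The case \<open>p < 1\<close> does not follow from \<open>p = 1\<close> by Jensen. Instead, at a maximum point
  \<open>z0\<close> of \<open>\<bar>g z\<bar> powr p * (r - \<bar>z - a\<bar>)\<^sup>2\<close> the factor \<open>\<bar>g\<bar> powr (1 - p)\<close> is, near \<open>z0\<close>, at most a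
  constant times its value at \<open>z0\<close>, so that it can be cancelled in the mean value inequality.\<close>

lemma sub_mean_value_powr:
  assumes hol: "g holomorphic_on ball a R" and r: "0 < r" "r < R" and p: "0 < p" "p \<le> 1"
  shows "ennreal (cmod (g a) powr p * r\<^sup>2)
    \<le> ennreal (4 powr (1 / p) / pi) * (\<integral>\<^sup>+z\<in>ball a r. ennreal (cmod (g z) powr p) \<partial>lborel)"
proof -
  define I where "I = (\<integral>\<^sup>+z\<in>ball a r. ennreal (cmod (g z) powr p) \<partial>lborel)"
  \<comment> \<open>The weight vanishes on the bounding circle, so a positive maximum is attained
    inside the disk; at the centre \<open>h\<close> is the left-hand side of the claim.\<close>
  define h where "h z = cmod (g z) powr p * (r - cmod (z - a))\<^sup>2" for z
  have cont: "continuous_on (cball a r) g"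
    by (rule holomorphic_on_ball_imp_continuous_on_cball[OF hol r(2)])
  have "continuous_on (cball a r) h"
    unfolding h_def using p by (intro continuous_intros continuous_on_powr' cont) auto
  then obtain z0 where z0: "z0 \<in> cball a r" and max: "\<And>z. z \<in> cball a r \<Longrightarrow> h z \<le> h z0"
    using continuous_attains_sup[of "cball a r" h] r by auto
  have ha: "cmod (g a) powr p * r\<^sup>2 = h a" by (simp add: h_def)
  have ha0: "h a \<le> h z0" using r by (intro max) auto
  \<comment> \<open>With a positive maximum and a finite \<open>I\<close> the estimates can be moved
    to the reals, where the common factor is cancelled.\<close>
  consider "h z0 \<le> 0" | "I = top" | i where "h z0 > 0" "I = ennreal i" "i \<ge> 0"
    by (cases I; cases "h z0 \<le> 0") (auto simp: not_le)
  then have "ennreal (h a) \<le> ennreal (4 powr (1 / p) / pi) * I"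
  proof cases
    case 1
    then have "h a \<le> 0" using ha0 by simp
    then show ?thesis by (simp add: ennreal_neg)
  next
    case 2
    then show ?thesis by (simp add: ennreal_mult_top)
  next
    case (3 i)
    \<comment> \<open>The point \<open>z0\<close> has distance 2 \<rho> from the circle. On
      \<open>ball z0 \<rho>\<close> the weight is still at least \<rho>^2, so maximality of
      \<open>h z0\<close> gives |g|^p \<le> 4 |g z0|^p there; the power (1 - p)/p of this bound is
      the constant \<open>?K\<close>.\<close>
    define \<rho> where "\<rho> = (r - cmod (z0 - a)) / 2"
    have g0: "cmod (g z0) > 0" and "r - cmod (z0 - a) \<noteq> 0"
      using 3 by (auto simp: h_def)
    moreover have "cmod (z0 - a) \<le> r" using z0 by (simp add: dist_norm norm_minus_commute)
    ultimately have \<rho>: "\<rho> > 0" by (simp add: \<rho>_def)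
    have sub: "ball z0 (2 * \<rho>) \<subseteq> ball a r"
    proof
      fix z assume "z \<in> ball z0 (2 * \<rho>)"
      then show "z \<in> ball a r"
        using dist_triangle[of a z z0] by (simp add: \<rho>_def dist_norm norm_minus_commute)
    qed
    have sub1: "ball z0 \<rho> \<subseteq> ball a r"
      using sub subset_ball[of \<rho> "2 * \<rho>" z0] \<rho> by simp
    have sub2: "ball z0 (2 * \<rho>) \<subseteq> ball a R" "ball z0 \<rho> \<subseteq> ball a R"
      using sub sub1 subset_ball[of r R a] r by auto
    have hz0: "h z0 = 4 * \<rho>\<^sup>2 * cmod (g z0) powr p"
      by (simp add: h_def \<rho>_def power_divide)
    let ?K = "4 powr ((1 - p) / p) * cmod (g z0) powr (1 - p)"
    have le: "cmod (g z) \<le> ?K * cmod (g z) powr p" if z: "z \<in> ball z0 \<rho>" for z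
    proof -
      have "z \<in> ball z0 (2 * \<rho>)" using z \<rho> by simp
      then have zr: "z \<in> ball a r" using sub by blast
      have "cmod (z - a) \<le> cmod (z0 - a) + cmod (z - z0)"
        using norm_triangle_ineq[of "z0 - a" "z - z0"] by simp
      then have "\<rho> \<le> r - cmod (z - a)"
        using z by (simp add: \<rho>_def dist_norm norm_minus_commute)
      then have "cmod (g z) powr p * \<rho>\<^sup>2 \<le> h z"
        unfolding h_def using \<rho> by (intro mult_left_mono power_mono) auto
      also have "\<dots> \<le> 4 * \<rho>\<^sup>2 * cmod (g z0) powr p"
        using max[of z] zr by (simp add: hz0)
      finally have *: "cmod (g z) powr p \<le> 4 * cmod (g z0) powr p"
        using \<rho> by simp
      have "cmod (g z) powr (1 - p) = (cmod (g z) powr p) powr ((1 - p) / p)"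
        using p by (simp add: powr_powr)
      also have "\<dots> \<le> (4 * cmod (g z0) powr p) powr ((1 - p) / p)"
        using p by (intro powr_mono2 *) auto
      also have "\<dots> = ?K"
        using p by (simp add: powr_mult powr_powr)
      finally have "cmod (g z) powr (1 - p) * cmod (g z) powr p \<le> ?K * cmod (g z) powr p"
        by (rule mult_right_mono) simp
      then show ?thesis
        by (cases "g z = 0") (simp_all flip: powr_add)
    qed
    have [measurable]: "(\<lambda>z. ennreal (cmod (g z) powr p) * indicator (ball z0 \<rho>) z) \<in> borel_measurable lborel"
    proof -
      have "(\<lambda>z. indicator (ball z0 \<rho>) z *\<^sub>R g z) \<in> borel_measurable borel"
        by (rule set_borel_measurable_holomorphic[OF holomorphic_on_subset[OF hol sub2(2)]]) simp
      then have "(\<lambda>z. ennreal (cmod (indicator (ball z0 \<rho>) z *\<^sub>R g z) powr p)) \<in> borel_measurable borel"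
        by measurable
      moreover have "ennreal (cmod (indicator (ball z0 \<rho>) z *\<^sub>R g z) powr p)
          = ennreal (cmod (g z) powr p) * indicator (ball z0 \<rho>) z" for z
        by (auto simp: indicator_def)
      ultimately show ?thesis
        unfolding measurable_lborel2 by (simp only:)
    qed
    have "ennreal (cmod (g z0) * (pi * \<rho>\<^sup>2)) \<le> (\<integral>\<^sup>+z\<in>ball z0 \<rho>. ennreal (cmod (g z)) \<partial>lborel)"
      using \<rho> by (intro area_mean_value_le[OF holomorphic_on_subset[OF hol sub2(1)]]) auto
    also have "\<dots> \<le> (\<integral>\<^sup>+z. ennreal ?K * (ennreal (cmod (g z) powr p) * indicator (ball z0 \<rho>) z) \<partial>lborel)"
      by (intro nn_integral_mono) (auto simp: indicator_def le simp flip: ennreal_mult)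
    also have "\<dots> = ennreal ?K * (\<integral>\<^sup>+z\<in>ball z0 \<rho>. ennreal (cmod (g z) powr p) \<partial>lborel)"
      by (rule nn_integral_cmult) measurable
    also have "\<dots> \<le> ennreal ?K * I"
      unfolding I_def using sub1
      by (intro mult_left_mono nn_integral_mono) (auto simp: indicator_def subset_iff)
    also have "\<dots> = ennreal (?K * i)"
      using 3 by (simp add: ennreal_mult)
    finally have "cmod (g z0) * (pi * \<rho>\<^sup>2) \<le> ?K * i"
      using 3 by (subst (asm) ennreal_le_iff) auto
    moreover have "cmod (g z0) = cmod (g z0) powr (1 - p) * cmod (g z0) powr p"
      using g0 by (simp flip: powr_add)
    ultimately have "cmod (g z0) powr (1 - p) * (cmod (g z0) powr p * (pi * \<rho>\<^sup>2))
        \<le> cmod (g z0) powr (1 - p) * (4 powr ((1 - p) / p) * i)"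
      by (metis mult.assoc mult.commute)
    then have "cmod (g z0) powr p * (pi * \<rho>\<^sup>2) \<le> 4 powr ((1 - p) / p) * i"
      using g0 by simp
    then have "h z0 * pi \<le> 4 * 4 powr ((1 - p) / p) * i"
      by (simp add: hz0 algebra_simps)
    also have "(4::real) * 4 powr ((1 - p) / p) = 4 powr (1 / p)"
      using p powr_add[of 4 1 "(1 - p) / p"] by (simp add: field_simps)
    finally have "h z0 \<le> 4 powr (1 / p) / pi * i"
      by (simp add: field_simps)
    with ha0 have "h a \<le> 4 powr (1 / p) / pi * i" by simp
    then show ?thesis
      using 3 by (simp add: ennreal_leI flip: ennreal_mult)
  qed
  then show ?thesis
    by (simp add: ha I_def)
qed

subsection \<open>The Forelli--Rudin estimate\<close>

lemma nn_integral_powr_from_0: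
  fixes a c :: real
  assumes "a > -1" "c \<ge> 0"
  shows "(\<integral>\<^sup>+x\<in>{0<..c}. ennreal (x powr a) \<partial>lborel) = ennreal (c powr (a + 1) / (a + 1))"
proof -
  have "(\<integral>\<^sup>+x\<in>{0..c}. ennreal (x powr a) \<partial>lborel) = ennreal (c powr (a + 1) / (a + 1))"
    by (rule nn_integral_has_integral_lebesgue') (use has_integral_powr_from_0[OF assms] in auto)
  moreover have "(\<integral>\<^sup>+x\<in>{0<..c}. ennreal (x powr a) \<partial>lborel) = (\<integral>\<^sup>+x\<in>{0..c}. ennreal (x powr a) \<partial>lborel)"
    by (intro nn_integral_cong) (auto simp: indicator_def)
  ultimately show ?thesis by (simp only:)
qed

text \<open>The absolute value lets one constant serve both signs of the exponent, so that weights
  of either sign can be frozen on small disks.\<close>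

lemma powr_le_powr_abs:
  fixes x K a :: real
  assumes "1 / K \<le> x" "x \<le> K" "1 \<le> K"
  shows "x powr a \<le> K powr \<bar>a\<bar>"
proof (cases "a \<ge> 0")
  case True
  moreover have "0 \<le> x" using assms by (meson divide_nonneg_nonneg order_trans zero_le_one)
  ultimately show ?thesis using assms by (auto intro: powr_mono2)
next
  case False
  have "0 < 1 / K" using assms by simp
  then have "x powr a \<le> (1 / K) powr a"
    using assms False by (intro powr_mono2') auto
  also have "\<dots> = K powr \<bar>a\<bar>"
    using assms False by (simp add: powr_divide powr_minus_divide)
  finally show ?thesis .
qed

text \<open>The line at height \<open>y\<close> meets the circle at the abscissae X and -X, and 1 -
  x^2 - y^2 = (X - |x|) (X + |x|). The second factor lies between 1/4 and 2, so the weight behaves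
  like the power \<alpha> of X - |x|, a quantity between 0 and 4 h.\<close>

lemma disk_strip_slice:
  fixes \<alpha> h y :: real
  assumes \<alpha>: "\<alpha> > -1" and h: "h \<ge> 0"
  shows "(\<integral>\<^sup>+x. ennreal ((1 - (x\<^sup>2 + y\<^sup>2)) powr \<alpha>)
        * indicator {x. x\<^sup>2 + y\<^sup>2 < 1 \<and> 1 / 4 \<le> \<bar>x\<bar> \<and> 1 - (x\<^sup>2 + y\<^sup>2) \<le> h} x \<partial>lborel)
    \<le> ennreal (2 * 4 powr \<bar>\<alpha>\<bar> * (4 * h) powr (\<alpha> + 1) / (\<alpha> + 1))"
proof -
  \<comment> \<open>For |y| > 1 the root has no geometric meaning, but then the set of integration
    is empty.\<close>
  define X where "X = sqrt (1 - y\<^sup>2)"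
  define \<phi> where "\<phi> u = ennreal (u powr \<alpha>) * indicator {0<..4 * h} u" for u :: real
  have [measurable]: "\<phi> \<in> borel_measurable borel" unfolding \<phi>_def by measurable
  have le: "ennreal ((1 - (x\<^sup>2 + y\<^sup>2)) powr \<alpha>)
      * indicator {x. x\<^sup>2 + y\<^sup>2 < 1 \<and> 1 / 4 \<le> \<bar>x\<bar> \<and> 1 - (x\<^sup>2 + y\<^sup>2) \<le> h} x
      \<le> ennreal (4 powr \<bar>\<alpha>\<bar>) * (\<phi> (X + (-1) * x) + \<phi> (X + 1 * x))" for x
  proof (cases "x\<^sup>2 + y\<^sup>2 < 1 \<and> 1 / 4 \<le> \<bar>x\<bar> \<and> 1 - (x\<^sup>2 + y\<^sup>2) \<le> h")
    case True
    then have "0 \<le> 1 - y\<^sup>2" using zero_le_power2[of x] by linarith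
    then have X2: "X\<^sup>2 = 1 - y\<^sup>2" and X0: "X \<ge> 0" by (simp_all add: X_def)
    have "\<bar>x\<bar>\<^sup>2 < X\<^sup>2" unfolding X2 power2_abs using True by linarith
    then have xX: "\<bar>x\<bar> < X" using X0 by (rule power2_less_imp_less)
    have "X\<^sup>2 \<le> 1\<^sup>2" unfolding X2 by simp
    then have X1: "X \<le> 1" by (rule power2_le_imp_le) simp
    have fac: "1 - (x\<^sup>2 + y\<^sup>2) = (X - \<bar>x\<bar>) * (X + \<bar>x\<bar>)"
      using X2 by (simp add: algebra_simps power2_eq_square)
    have "(X - \<bar>x\<bar>) * (1 / 4) \<le> (X - \<bar>x\<bar>) * (X + \<bar>x\<bar>)"
      using True xX X0 by (intro mult_left_mono) auto
    then have u: "X - \<bar>x\<bar> \<le> 4 * h" using fac True by simp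
    have "(1 - (x\<^sup>2 + y\<^sup>2)) powr \<alpha> = (X - \<bar>x\<bar>) powr \<alpha> * (X + \<bar>x\<bar>) powr \<alpha>"
      unfolding fac using xX X0 by (simp add: powr_mult)
    also have "\<dots> \<le> (X - \<bar>x\<bar>) powr \<alpha> * 4 powr \<bar>\<alpha>\<bar>"
      using xX X1 True by (intro mult_left_mono powr_le_powr_abs) auto
    finally have "ennreal ((1 - (x\<^sup>2 + y\<^sup>2)) powr \<alpha>) \<le> ennreal (4 powr \<bar>\<alpha>\<bar> * (X - \<bar>x\<bar>) powr \<alpha>)"
      by (intro ennreal_leI) (simp only: mult.commute)
    also have "\<dots> = ennreal (4 powr \<bar>\<alpha>\<bar>) * \<phi> (X - \<bar>x\<bar>)"
      unfolding \<phi>_def using u xX by (subst ennreal_mult) (auto simp: indicator_def)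
    also have "\<phi> (X - \<bar>x\<bar>) \<le> \<phi> (X + (-1) * x) + \<phi> (X + 1 * x)"
      by (cases "x \<ge> 0") auto
    finally have "ennreal ((1 - (x\<^sup>2 + y\<^sup>2)) powr \<alpha>)
        \<le> ennreal (4 powr \<bar>\<alpha>\<bar>) * (\<phi> (X + (-1) * x) + \<phi> (X + 1 * x))"
      by (simp add: mult_left_mono)
    then show ?thesis using True by (simp only: mem_Collect_eq indicator_simps mult_1_right simp_thms)
  next
    case False
    then have "x \<notin> {x. x\<^sup>2 + y\<^sup>2 < 1 \<and> 1 / 4 \<le> \<bar>x\<bar> \<and> 1 - (x\<^sup>2 + y\<^sup>2) \<le> h}" by blast
    then show ?thesis by (simp only: indicator_simps not_False_eq_True mult_zero_right zero_le)
  qed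
  have sub: "(\<integral>\<^sup>+x. \<phi> (X + c * x) \<partial>lborel) = (\<integral>\<^sup>+x. \<phi> x \<partial>lborel)" if "\<bar>c\<bar> = 1" for c
    using nn_integral_real_affine[of \<phi> c X] that by (auto simp flip: one_ennreal_def)
  have "(\<integral>\<^sup>+x. ennreal ((1 - (x\<^sup>2 + y\<^sup>2)) powr \<alpha>)
        * indicator {x. x\<^sup>2 + y\<^sup>2 < 1 \<and> 1 / 4 \<le> \<bar>x\<bar> \<and> 1 - (x\<^sup>2 + y\<^sup>2) \<le> h} x \<partial>lborel)
      \<le> (\<integral>\<^sup>+x. ennreal (4 powr \<bar>\<alpha>\<bar>) * (\<phi> (X + (-1) * x) + \<phi> (X + 1 * x)) \<partial>lborel)"
    by (intro nn_integral_mono le)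
  also have "\<dots> = ennreal (4 powr \<bar>\<alpha>\<bar>) * ((\<integral>\<^sup>+x. \<phi> (X + (-1) * x) \<partial>lborel) + (\<integral>\<^sup>+x. \<phi> (X + 1 * x) \<partial>lborel))"
    by (subst nn_integral_cmult, measurable, subst nn_integral_add, measurable)
  also have "\<dots> = ennreal (4 powr \<bar>\<alpha>\<bar>) * (2 * (\<integral>\<^sup>+x. \<phi> x \<partial>lborel))"
    by (subst (1 2) sub) (auto simp: mult_2)
  also have "(\<integral>\<^sup>+x. \<phi> x \<partial>lborel) = ennreal ((4 * h) powr (\<alpha> + 1) / (\<alpha> + 1))"
    unfolding \<phi>_def using nn_integral_powr_from_0[of \<alpha> "4 * h"] \<alpha> h by simp
  also have "ennreal (4 powr \<bar>\<alpha>\<bar>) * (2 * ennreal ((4 * h) powr (\<alpha> + 1) / (\<alpha> + 1)))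
      = ennreal (2 * 4 powr \<bar>\<alpha>\<bar> * (4 * h) powr (\<alpha> + 1) / (\<alpha> + 1))"
  proof -
    have "2 * ennreal ((4 * h) powr (\<alpha> + 1) / (\<alpha> + 1)) = ennreal (2 * ((4 * h) powr (\<alpha> + 1) / (\<alpha> + 1)))"
      using \<alpha> by (subst ennreal_mult) auto
    then show ?thesis
      using \<alpha> by (simp add: mult_ac flip: ennreal_mult)
  qed
  finally show ?thesis .
qed

text \<open>Where |Re w| is at least 1/4, horizontal lines cross the circle transversally and one
  bound serves all slices; integrating it over an interval of length 2 \<rho> for
  \<open>Im w\<close> adds the factor \<rho>.\<close>

lemma disk_strip:
  fixes \<alpha> h y0 \<rho> :: real
  assumes \<alpha>: "\<alpha> > -1" and h: "h \<ge> 0" and \<rho>: "\<rho> \<ge> 0"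
  shows "(\<integral>\<^sup>+w. ennreal ((1 - (cmod w)\<^sup>2) powr \<alpha>)
        * indicator {w. cmod w < 1 \<and> 1 / 4 \<le> \<bar>Re w\<bar> \<and> 1 - (cmod w)\<^sup>2 \<le> h \<and> \<bar>Im w - y0\<bar> \<le> \<rho>} w \<partial>lborel)
    \<le> ennreal (4 * 4 powr \<bar>\<alpha>\<bar> * (4 * h) powr (\<alpha> + 1) / (\<alpha> + 1) * \<rho>)" (is "?L \<le> _")
proof -
  let ?K = "2 * 4 powr \<bar>\<alpha>\<bar> * (4 * h) powr (\<alpha> + 1) / (\<alpha> + 1)"
  let ?S = "\<lambda>y. {x. x\<^sup>2 + y\<^sup>2 < 1 \<and> 1 / 4 \<le> \<bar>x\<bar> \<and> 1 - (x\<^sup>2 + y\<^sup>2) \<le> h}"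
  have c2: "(cmod (Complex x y))\<^sup>2 = x\<^sup>2 + y\<^sup>2" for x y by (simp add: cmod_power2)
  have c1: "cmod (Complex x y) < 1 \<longleftrightarrow> x\<^sup>2 + y\<^sup>2 < 1" for x y
    by (simp add: cmod_def)
  have "?L = (\<integral>\<^sup>+y. \<integral>\<^sup>+x. ennreal ((1 - (cmod (Complex x y))\<^sup>2) powr \<alpha>)
        * indicator {w. cmod w < 1 \<and> 1 / 4 \<le> \<bar>Re w\<bar> \<and> 1 - (cmod w)\<^sup>2 \<le> h \<and> \<bar>Im w - y0\<bar> \<le> \<rho>} (Complex x y)
        \<partial>lborel \<partial>lborel)"
    by (rule nn_integral_complex) measurable
  also have "\<dots> = (\<integral>\<^sup>+y. \<integral>\<^sup>+x. indicator {y0 - \<rho>..y0 + \<rho>} y *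
        (ennreal ((1 - (x\<^sup>2 + y\<^sup>2)) powr \<alpha>) * indicator (?S y) x) \<partial>lborel \<partial>lborel)"
    by (intro nn_integral_cong) (auto simp: c1 c2 indicator_def abs_le_iff)
  also have "\<dots> = (\<integral>\<^sup>+y. indicator {y0 - \<rho>..y0 + \<rho>} y *
        (\<integral>\<^sup>+x. ennreal ((1 - (x\<^sup>2 + y\<^sup>2)) powr \<alpha>) * indicator (?S y) x \<partial>lborel) \<partial>lborel)"
    by (intro nn_integral_cong nn_integral_cmult) measurable
  also have "\<dots> \<le> (\<integral>\<^sup>+y. indicator {y0 - \<rho>..y0 + \<rho>} y * ennreal ?K \<partial>lborel)"
    by (intro nn_integral_mono mult_left_mono disk_strip_slice \<alpha> h) auto
  also have "\<dots> = ennreal ?K * ennreal (2 * \<rho>)"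
    using \<rho> by (subst nn_integral_multc) (auto simp: mult.commute)
  also have "\<dots> = ennreal (4 * 4 powr \<bar>\<alpha>\<bar> * (4 * h) powr (\<alpha> + 1) / (\<alpha> + 1) * \<rho>)"
    using \<alpha> \<rho> by (simp flip: ennreal_mult)
  finally show ?thesis .
qed

text \<open>If |Re w| and |Im w| are both below 1/4, then |w|^2 is below 3/4 and the weight is
  bounded. The remaining points lie in the region of \<open>disk_strip\<close> with h = \<rho> = 1
  or are brought there by a quarter turn.\<close>

lemma disk_weight_finite:
  fixes \<alpha> :: real
  assumes \<alpha>: "\<alpha> > -1"
  obtains C where "C > 0" "(\<integral>\<^sup>+w\<in>ball 0 1. ennreal ((1 - (cmod w)\<^sup>2) powr \<alpha>) \<partial>lborel) \<le> ennreal C"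
proof -
  define g where "g w = ennreal ((1 - (cmod w)\<^sup>2) powr \<alpha>)
        * indicator {w. cmod w < 1 \<and> 1 / 4 \<le> \<bar>Re w\<bar> \<and> 1 - (cmod w)\<^sup>2 \<le> 1 \<and> \<bar>Im w - 0\<bar> \<le> 1} w" for w
  have [measurable]: "g \<in> borel_measurable borel" unfolding g_def by measurable
  let ?C = "4 * 4 powr \<bar>\<alpha>\<bar> * (4 * 1) powr (\<alpha> + 1) / (\<alpha> + 1) * 1"
  have g: "(\<integral>\<^sup>+w. g w \<partial>lborel) \<le> ennreal ?C"
    unfolding g_def by (rule disk_strip) (use \<alpha> in auto)
  have gi: "(\<integral>\<^sup>+w. g (\<i> * w) \<partial>lborel) = (\<integral>\<^sup>+w. g w \<partial>lborel)"
    by (rule nn_integral_rotate) (auto simp: complex_eq_iff)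
  have le: "ennreal ((1 - (cmod w)\<^sup>2) powr \<alpha>) * indicator (ball 0 1) w
      \<le> ennreal (4 powr \<bar>\<alpha>\<bar>) * indicator (ball 0 1) w + (g w + g (\<i> * w))" for w
  proof (cases "cmod w < 1")
    case True
    consider "(cmod w)\<^sup>2 \<le> 3 / 4" | "1 / 4 \<le> \<bar>Re w\<bar>" | "1 / 4 \<le> \<bar>Im w\<bar>"
    proof -
      have False if "3 / 4 < (cmod w)\<^sup>2" "\<bar>Re w\<bar> < 1 / 4" "\<bar>Im w\<bar> < 1 / 4"
      proof -
        have "\<bar>Re w\<bar>\<^sup>2 \<le> (1 / 4)\<^sup>2" "\<bar>Im w\<bar>\<^sup>2 \<le> (1 / 4)\<^sup>2"
          by (rule power_mono; use that in simp)+
        then have "(cmod w)\<^sup>2 \<le> 2 * (1 / 4)\<^sup>2" unfolding cmod_power2 by simp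
        also have "\<dots> < 3 / 4" by (simp add: power2_eq_square)
        finally show False using that by simp
      qed
      then show ?thesis using that by fastforce
    qed
    then show ?thesis
    proof cases
      case 1
      then have "ennreal ((1 - (cmod w)\<^sup>2) powr \<alpha>) \<le> ennreal (4 powr \<bar>\<alpha>\<bar>)"
        using True by (intro ennreal_leI powr_le_powr_abs) (use zero_le_power2[of "cmod w"] in linarith)+
      then show ?thesis using True by (simp add: add_increasing2)
    next
      case 2
      then have "g w = ennreal ((1 - (cmod w)\<^sup>2) powr \<alpha>)"
        using True abs_Im_le_cmod[of w] by (simp add: g_def)
      then show ?thesis using True by (simp add: add_increasing add_increasing2)
    next
      case 3
      then have "g (\<i> * w) = ennreal ((1 - (cmod w)\<^sup>2) powr \<alpha>)"
        using True abs_Re_le_cmod[of w] by (simp add: g_def norm_mult)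
      then show ?thesis using True by (simp add: add_increasing)
    qed
  qed simp
  have "(\<integral>\<^sup>+w\<in>ball 0 1. ennreal ((1 - (cmod w)\<^sup>2) powr \<alpha>) \<partial>lborel)
      \<le> (\<integral>\<^sup>+w. ennreal (4 powr \<bar>\<alpha>\<bar>) * indicator (ball 0 1) w + (g w + g (\<i> * w)) \<partial>lborel)"
    by (intro nn_integral_mono le)
  also have "\<dots> = ennreal (4 powr \<bar>\<alpha>\<bar>) * emeasure lborel (ball (0::complex) 1)
      + ((\<integral>\<^sup>+w. g w \<partial>lborel) + (\<integral>\<^sup>+w. g w \<partial>lborel))"
  proof -
    have [measurable]: "(\<lambda>w. g (\<i> * w)) \<in> borel_measurable borel"
      by (rule measurable_compose[OF _ \<open>g \<in> borel_measurable borel\<close>]) simp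
    have "(\<integral>\<^sup>+w. g w + g (\<i> * w) \<partial>lborel) = (\<integral>\<^sup>+w. g w \<partial>lborel) + (\<integral>\<^sup>+w. g w \<partial>lborel)"
      by (subst gi[symmetric], rule nn_integral_add) simp_all
    moreover have "(\<integral>\<^sup>+w. ennreal (4 powr \<bar>\<alpha>\<bar>) * indicator (ball (0::complex) 1) w \<partial>lborel)
        = ennreal (4 powr \<bar>\<alpha>\<bar>) * emeasure lborel (ball (0::complex) 1)"
      by (rule nn_integral_cmult_indicator) simp
    moreover have "(\<integral>\<^sup>+w. ennreal (4 powr \<bar>\<alpha>\<bar>) * indicator (ball 0 1) w + (g w + g (\<i> * w)) \<partial>lborel)
        = (\<integral>\<^sup>+w. ennreal (4 powr \<bar>\<alpha>\<bar>) * indicator (ball (0::complex) 1) w \<partial>lborel)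
          + (\<integral>\<^sup>+w. g w + g (\<i> * w) \<partial>lborel)"
    proof (rule nn_integral_add)
      show "(\<lambda>w. ennreal (4 powr \<bar>\<alpha>\<bar>) * indicator (ball (0::complex) 1) w) \<in> borel_measurable lborel"
        by (intro borel_measurable_times_ennreal borel_measurable_const borel_measurable_indicator) simp
      show "(\<lambda>w. g w + g (\<i> * w)) \<in> borel_measurable lborel"
        unfolding measurable_lborel2
        by (rule borel_measurable_add[OF \<open>g \<in> borel_measurable borel\<close>
              \<open>(\<lambda>w. g (\<i> * w)) \<in> borel_measurable borel\<close>])
    qed
    ultimately show ?thesis by (simp only:)
  qed
  also have "\<dots> \<le> ennreal (4 powr \<bar>\<alpha>\<bar>) * ennreal pi + (ennreal ?C + ennreal ?C)"
    using g by (intro add_mono mult_left_mono)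
      (auto simp: emeasure_ball unit_ball_vol_2)
  also have "\<dots> = ennreal (4 powr \<bar>\<alpha>\<bar> * pi + (?C + ?C))"
    using \<alpha> by (simp flip: ennreal_mult ennreal_plus)
  finally show ?thesis
    by (intro that[of "4 powr \<bar>\<alpha>\<bar> * pi + (?C + ?C)"]) (use \<alpha> in \<open>auto intro!: add_pos_nonneg\<close>)
qed

text \<open>A point within \<open>R\<close> of \<eta> has 1 - |w| \<le> R and an imaginary part
  within \<open>R\<close> of that of \<eta>. The cap thus lies in the region of
  \<open>disk_strip\<close> with h = 2 R and \<rho> = R, and the powers \<alpha> + 1 and 1 of
  \<open>R\<close> add up. The bound \<open>R \<le> 1 / 4\<close> keeps |Re w| at least 1/4.\<close>

lemma disk_cap_right:
  fixes \<alpha> R :: real and \<eta> :: complex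
  assumes \<alpha>: "\<alpha> > -1" and R: "0 < R" "R \<le> 1 / 4" and \<eta>: "cmod \<eta> = 1" "1 / 2 \<le> \<bar>Re \<eta>\<bar>"
  shows "(\<integral>\<^sup>+w\<in>ball 0 1 \<inter> cball \<eta> R. ennreal ((1 - (cmod w)\<^sup>2) powr \<alpha>) \<partial>lborel)
    \<le> ennreal (4 * 4 powr \<bar>\<alpha>\<bar> * 8 powr (\<alpha> + 1) / (\<alpha> + 1) * R powr (2 + \<alpha>))" (is "?L \<le> _")
proof -
  have "?L \<le> (\<integral>\<^sup>+w. ennreal ((1 - (cmod w)\<^sup>2) powr \<alpha>)
        * indicator {w. cmod w < 1 \<and> 1 / 4 \<le> \<bar>Re w\<bar> \<and> 1 - (cmod w)\<^sup>2 \<le> 2 * R \<and> \<bar>Im w - Im \<eta>\<bar> \<le> R} w \<partial>lborel)"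
  proof (intro nn_integral_mono mult_left_mono)
    fix w
    have "cmod w < 1 \<Longrightarrow> dist \<eta> w \<le> R \<Longrightarrow> 1 / 4 \<le> \<bar>Re w\<bar> \<and> 1 - (cmod w)\<^sup>2 \<le> 2 * R \<and> \<bar>Im w - Im \<eta>\<bar> \<le> R"
    proof (intro conjI)
      assume w: "cmod w < 1" "dist \<eta> w \<le> R"
      have d: "cmod (w - \<eta>) \<le> R" using w by (simp add: dist_norm norm_minus_commute)
      then show "\<bar>Im w - Im \<eta>\<bar> \<le> R" using abs_Im_le_cmod[of "w - \<eta>"] by simp
      show "1 / 4 \<le> \<bar>Re w\<bar>" using d R \<eta> abs_Re_le_cmod[of "w - \<eta>"] by simp
      have "1 - cmod w \<le> R" using d \<eta> norm_triangle_ineq3[of \<eta> w] by (simp add: norm_minus_commute)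
      have "1 - (cmod w)\<^sup>2 = (1 - cmod w) * (1 + cmod w)"
        by (simp add: algebra_simps power2_eq_square)
      also have "\<dots> \<le> R * 2"
        using w R \<open>1 - cmod w \<le> R\<close> by (intro mult_mono) auto
      finally show "1 - (cmod w)\<^sup>2 \<le> 2 * R" by simp
    qed
    then show "indicator (ball 0 1 \<inter> cball \<eta> R) w \<le>
      (indicator {w. cmod w < 1 \<and> 1 / 4 \<le> \<bar>Re w\<bar> \<and> 1 - (cmod w)\<^sup>2 \<le> 2 * R \<and> \<bar>Im w - Im \<eta>\<bar> \<le> R} w :: ennreal)"
      by (auto simp: indicator_def)
  qed simp
  also have "\<dots> \<le> ennreal (4 * 4 powr \<bar>\<alpha>\<bar> * (4 * (2 * R)) powr (\<alpha> + 1) / (\<alpha> + 1) * R)"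
    by (rule disk_strip) (use \<alpha> R in auto)
  also have "(4 * (2 * R)) powr (\<alpha> + 1) = 8 powr (\<alpha> + 1) * R powr (\<alpha> + 1)"
    using R by (simp flip: powr_mult)
  also have "4 * 4 powr \<bar>\<alpha>\<bar> * (8 powr (\<alpha> + 1) * R powr (\<alpha> + 1)) / (\<alpha> + 1) * R
      = 4 * 4 powr \<bar>\<alpha>\<bar> * 8 powr (\<alpha> + 1) / (\<alpha> + 1) * (R powr (\<alpha> + 1) * R powr 1)"
    using R by simp
  also have "R powr (\<alpha> + 1) * R powr 1 = R powr (2 + \<alpha>)"
    by (subst powr_add[symmetric]) (rule arg_cong[where f = "(powr) R"], simp)
  finally show ?thesis .
qed

text \<open>A unit vector has a coordinate of absolute value at least 1/2; if it is the imaginary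
  one, a quarter turn exchanges the coordinates. Caps with R > 1/4 are charged with the mass of the
  whole disk, since 4 R > 1.\<close>

lemma disk_cap:
  fixes \<alpha> :: real
  assumes \<alpha>: "\<alpha> > -1"
  obtains C where "C > 0" "\<And>\<eta> R. cmod \<eta> = 1 \<Longrightarrow> R > 0 \<Longrightarrow>
    (\<integral>\<^sup>+w\<in>ball 0 1 \<inter> cball \<eta> R. ennreal ((1 - (cmod w)\<^sup>2) powr \<alpha>) \<partial>lborel) \<le> ennreal (C * R powr (2 + \<alpha>))"
proof -
  obtain C0 where C0: "C0 > 0"
    "(\<integral>\<^sup>+w\<in>ball 0 1. ennreal ((1 - (cmod w)\<^sup>2) powr \<alpha>) \<partial>lborel) \<le> ennreal C0"
    using disk_weight_finite[OF \<alpha>] by blast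
  define C1 where "C1 = 4 * 4 powr \<bar>\<alpha>\<bar> * 8 powr (\<alpha> + 1) / (\<alpha> + 1)"
  have C1: "C1 > 0" using \<alpha> by (simp add: C1_def)
  define C where "C = C1 + C0 * 4 powr (2 + \<alpha>)"
  have C: "C > 0" "C1 \<le> C" "C0 * 4 powr (2 + \<alpha>) \<le> C" using C0 C1 by (auto simp: C_def add_pos_nonneg)
  have "(\<integral>\<^sup>+w\<in>ball 0 1 \<inter> cball \<eta> R. ennreal ((1 - (cmod w)\<^sup>2) powr \<alpha>) \<partial>lborel) \<le> ennreal (C * R powr (2 + \<alpha>))"
    if \<eta>: "cmod \<eta> = 1" and R: "R > 0" for \<eta> R
  proof -
    consider "R > 1 / 4" | "R \<le> 1 / 4" "1 / 2 \<le> \<bar>Re \<eta>\<bar>" | "R \<le> 1 / 4" "1 / 2 \<le> \<bar>Im \<eta>\<bar>"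
    proof -
      have False if "\<bar>Re \<eta>\<bar> < 1 / 2" "\<bar>Im \<eta>\<bar> < 1 / 2"
      proof -
        have "\<bar>Re \<eta>\<bar>\<^sup>2 \<le> (1 / 2)\<^sup>2" "\<bar>Im \<eta>\<bar>\<^sup>2 \<le> (1 / 2)\<^sup>2"
          by (rule power_mono; use that in simp)+
        moreover have "\<bar>Re \<eta>\<bar>\<^sup>2 < (1 / 2)\<^sup>2" by (rule power_strict_mono) (use that in auto)
        ultimately have "(cmod \<eta>)\<^sup>2 < 2 * (1 / 2)\<^sup>2" unfolding cmod_power2 by simp
        then show False using \<eta> by (simp add: power2_eq_square)
      qed
      then show ?thesis using that by fastforce
    qed
    then show ?thesis
    proof cases
      case 1
      have "(\<integral>\<^sup>+w\<in>ball 0 1 \<inter> cball \<eta> R. ennreal ((1 - (cmod w)\<^sup>2) powr \<alpha>) \<partial>lborel) \<le> ennreal C0"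
        by (rule order_trans[OF nn_integral_mono C0(2)]) (auto simp: indicator_def)
      also have "C0 * 1 \<le> C0 * (4 * R) powr (2 + \<alpha>)"
        using C0 1 \<alpha> by (intro mult_left_mono ge_one_powr_ge_zero) auto
      then have "C0 \<le> C0 * 4 powr (2 + \<alpha>) * R powr (2 + \<alpha>)"
        using R by (simp add: powr_mult)
      also have "\<dots> \<le> C * R powr (2 + \<alpha>)" by (intro mult_right_mono C) auto
      finally show ?thesis by (simp add: ennreal_leI)
    next
      case 2
      show ?thesis
        by (rule order_trans[OF disk_cap_right[OF \<alpha> R 2(1) \<eta> 2(2), folded C1_def]])
          (intro ennreal_leI mult_right_mono C, simp)
    next
      case 3
      have "(\<integral>\<^sup>+w\<in>ball 0 1 \<inter> cball \<eta> R. ennreal ((1 - (cmod w)\<^sup>2) powr \<alpha>) \<partial>lborel)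
          = (\<integral>\<^sup>+w. ennreal ((1 - (cmod (\<i> * w))\<^sup>2) powr \<alpha>) * indicator (ball 0 1 \<inter> cball (\<i> * \<eta>) R) (\<i> * w) \<partial>lborel)"
      proof (intro nn_integral_cong)
        fix w
        have "dist (\<i> * \<eta>) (\<i> * w) = dist \<eta> w"
          by (simp add: dist_norm norm_mult flip: right_diff_distrib)
        then show "ennreal ((1 - (cmod w)\<^sup>2) powr \<alpha>) * indicator (ball 0 1 \<inter> cball \<eta> R) w
          = ennreal ((1 - (cmod (\<i> * w))\<^sup>2) powr \<alpha>) * indicator (ball 0 1 \<inter> cball (\<i> * \<eta>) R) (\<i> * w)"
          by (auto simp: indicator_def norm_mult)
      qed
      also have "\<dots> = (\<integral>\<^sup>+w\<in>ball 0 1 \<inter> cball (\<i> * \<eta>) R. ennreal ((1 - (cmod w)\<^sup>2) powr \<alpha>) \<partial>lborel)"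
        by (rule nn_integral_rotate[where u = \<i>], measurable) (simp_all add: complex_eq_iff)
      also have "\<dots> \<le> ennreal (C1 * R powr (2 + \<alpha>))"
        unfolding C1_def by (rule disk_cap_right[OF \<alpha> R 3(1)]) (use \<eta> 3 in \<open>auto simp: norm_mult\<close>)
      also have "\<dots> \<le> ennreal (C * R powr (2 + \<alpha>))"
        by (intro ennreal_leI mult_right_mono C) auto
      finally show ?thesis .
    qed
  qed
  then show ?thesis using C(1) that by blast
qed

lemma disk_kernel_lower:
  assumes "cmod a < 1" "cmod w < 1"
  shows "1 - cmod a \<le> cmod (1 - cnj a * w)"
proof -
  have "cmod (cnj a * w) \<le> cmod a"
    using assms by (simp add: norm_mult mult_left_le)
  then show ?thesis
    using norm_triangle_ineq2[of 1 "cnj a * w"] by simp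
qed

text \<open>Dyadic decomposition around the boundary point nearest to \<open>a\<close>.\<close>

theorem forelli_rudin:
  fixes \<alpha> c :: real
  assumes \<alpha>: "\<alpha> > -1" and c: "c > 2 + \<alpha>"
  obtains C where "C > 0" "\<And>a. cmod a < 1 \<Longrightarrow>
    (\<integral>\<^sup>+w\<in>ball 0 1. ennreal ((1 - (cmod w)\<^sup>2) powr \<alpha> * cmod (1 - cnj a * w) powr (- c)) \<partial>lborel)
      \<le> ennreal (C * (1 - cmod a) powr (2 + \<alpha> - c))"
proof -
  obtain C0 where C0: "C0 > 0" "\<And>\<eta> R. cmod \<eta> = 1 \<Longrightarrow> R > 0 \<Longrightarrow>
      (\<integral>\<^sup>+w\<in>ball 0 1 \<inter> cball \<eta> R. ennreal ((1 - (cmod w)\<^sup>2) powr \<alpha>) \<partial>lborel) \<le> ennreal (C0 * R powr (2 + \<alpha>))"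
    using disk_cap[OF \<alpha>] by blast
  \<comment> \<open>The ratio of the dyadic series; it is below 1 because
    \<open>c > 2 + \<alpha>\<close>.\<close>
  define q where "q = 2 powr (2 + \<alpha> - c)"
  have q: "0 < q" "q < 1" using c by (auto simp: q_def powr_less_one)
  define C where "C = C0 * 2 powr c * 2 powr (2 + \<alpha>) / (1 - q)"
  have "C > 0" using C0 q by (simp add: C_def)
  moreover have "(\<integral>\<^sup>+w\<in>ball 0 1. ennreal ((1 - (cmod w)\<^sup>2) powr \<alpha> * cmod (1 - cnj a * w) powr (- c)) \<partial>lborel)
      \<le> ennreal (C * (1 - cmod a) powr (2 + \<alpha> - c))" if a: "cmod a < 1" for a
  proof -
    define \<delta> where "\<delta> = 1 - cmod a"
    have \<delta>: "\<delta> > 0" using a by (simp add: \<delta>_def)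
    obtain \<eta> where \<eta>: "cmod \<eta> = 1" "a = complex_of_real (cmod a) * \<eta>"
    proof (cases "a = 0")
      case True
      then show ?thesis using that[of 1] by simp
    next
      case False
      have "cmod (sgn a) = 1" using False by (simp add: norm_sgn)
      moreover have "a = complex_of_real (cmod a) * sgn a"
        using False by (simp add: sgn_div_norm scaleR_conv_of_real)
      ultimately show ?thesis using that by blast
    qed
    \<comment> \<open>The j-th cap has mass of order (R j)^(2+\<alpha>), and outside the cap before
      it the kernel is at least \<open>R j / 4\<close>, whence the value of \<open>s j\<close>. For
      the first cap, of radius 2 \<delta>, the trivial lower bound \<delta> for the kernel is used
      instead.\<close>
    define R where "R j = 2 ^ (j + 1) * \<delta>" for j :: nat
    define s where "s j = (R j / 4) powr (- c)" for j :: nat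
    have [measurable]: "ball 0 1 \<inter> cball \<eta> (R j) \<in> sets borel" for j by auto
    have R: "R j > 0" for j using \<delta> by (simp add: R_def)
    \<comment> \<open>With \<eta> in place of \<open>a\<close> the kernel has modulus exactly |w -
      \<eta>|. Passing from \<eta> to \<open>a\<close> costs at most \<delta>, which is itself a
      lower bound for the kernel.\<close>
    have low: "cmod (w - \<eta>) \<le> 2 * cmod (1 - cnj a * w)" if w: "cmod w < 1" for w
    proof -
      have u: "\<eta> * cnj \<eta> = 1" using \<eta> by (simp add: complex_norm_square[symmetric])
      have ca: "cnj a = complex_of_real (cmod a) * cnj \<eta>" by (subst \<eta>(2)) simp
      have "w - \<eta> = - \<eta> * (1 - cnj \<eta> * w)"
        using u by (simp add: algebra_simps)
      then have "cmod (w - \<eta>) = cmod (1 - cnj \<eta> * w)" using \<eta> by (simp add: norm_mult)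
      also have "1 - cnj \<eta> * w = (1 - cnj a * w) - complex_of_real \<delta> * cnj \<eta> * w"
        unfolding ca \<delta>_def by (simp add: algebra_simps)
      also have "cmod \<dots> \<le> cmod (1 - cnj a * w) + cmod (complex_of_real \<delta> * cnj \<eta> * w)"
        by (rule norm_triangle_ineq4)
      also have "cmod (complex_of_real \<delta> * cnj \<eta> * w) \<le> \<delta>"
        using \<eta> w \<delta> by (simp add: norm_mult mult_left_le)
      also have "\<delta> \<le> cmod (1 - cnj a * w)"
        unfolding \<delta>_def by (rule disk_kernel_lower[OF a w])
      finally show ?thesis by simp
    qed
    have le: "ennreal ((1 - (cmod w)\<^sup>2) powr \<alpha> * cmod (1 - cnj a * w) powr (- c)) * indicator (ball 0 1) w
      \<le> (\<Sum>j. ennreal (s j) * (ennreal ((1 - (cmod w)\<^sup>2) powr \<alpha>) * indicator (ball 0 1 \<inter> cball \<eta> (R j)) w))"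
      (is "_ \<le> (\<Sum>j. ?f j)") for w
    proof (cases "cmod w < 1")
      case True
      define d where "d = cmod (w - \<eta>)"
      have ex: "\<exists>j. d \<le> R j"
      proof -
        obtain n where "d / \<delta> < 2 ^ n" using real_arch_pow[of 2 "d / \<delta>"] by auto
        then have "d < 2 ^ n * \<delta>" using \<delta> by (simp add: pos_divide_less_eq)
        moreover have "0 \<le> 2 ^ n * \<delta>" using \<delta> by simp
        moreover have "R n = 2 * (2 ^ n * \<delta>)" by (simp add: R_def)
        ultimately have "d \<le> R n" by linarith
        then show ?thesis by blast
      qed
      \<comment> \<open>The caps are nested and need not be made disjoint: the term with the least
        admissible index alone dominates the integrand.\<close>
      define j where "j = (LEAST j. d \<le> R j)"
      have dj: "d \<le> R j" unfolding j_def using ex by (rule LeastI_ex)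
      have "R j / 4 \<le> cmod (1 - cnj a * w)"
      proof (cases j)
        case 0
        then show ?thesis
          using disk_kernel_lower[OF a True] \<delta> by (simp add: R_def \<delta>_def)
      next
        case (Suc i)
        then have "\<not> d \<le> R i" using not_less_Least[of i "\<lambda>j. d \<le> R j"] by (simp add: j_def)
        then show ?thesis using low[OF True] Suc by (simp add: R_def d_def)
      qed
      then have "cmod (1 - cnj a * w) powr (- c) \<le> s j"
        unfolding s_def using R[of j] c \<alpha> by (intro powr_mono2') auto
      then have "ennreal ((1 - (cmod w)\<^sup>2) powr \<alpha> * cmod (1 - cnj a * w) powr (- c)) * indicator (ball 0 1) w \<le> ?f j"
      proof -
        assume "cmod (1 - cnj a * w) powr (- c) \<le> s j"
        then have "ennreal ((1 - (cmod w)\<^sup>2) powr \<alpha> * cmod (1 - cnj a * w) powr (- c))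
            \<le> ennreal (s j * (1 - (cmod w)\<^sup>2) powr \<alpha>)"
          by (intro ennreal_leI) (subst mult.commute, rule mult_right_mono, auto)
        also have "\<dots> = ennreal (s j) * ennreal ((1 - (cmod w)\<^sup>2) powr \<alpha>)"
          by (rule ennreal_mult) (auto simp: s_def)
        finally show ?thesis
          using True dj by (simp add: d_def dist_norm norm_minus_commute)
      qed
      also have "\<dots> \<le> (\<Sum>j. ?f j)"
        using sum_le_suminf[of ?f "{j}"] by (simp add: summableI)
      finally show ?thesis .
    qed simp
    have "(\<integral>\<^sup>+w\<in>ball 0 1. ennreal ((1 - (cmod w)\<^sup>2) powr \<alpha> * cmod (1 - cnj a * w) powr (- c)) \<partial>lborel)
        \<le> (\<integral>\<^sup>+w. (\<Sum>j. ennreal (s j) * (ennreal ((1 - (cmod w)\<^sup>2) powr \<alpha>) * indicator (ball 0 1 \<inter> cball \<eta> (R j)) w)) \<partial>lborel)"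
      by (intro nn_integral_mono le)
    also have "\<dots> = (\<Sum>j. \<integral>\<^sup>+w. ennreal (s j) * (ennreal ((1 - (cmod w)\<^sup>2) powr \<alpha>) * indicator (ball 0 1 \<inter> cball \<eta> (R j)) w) \<partial>lborel)"
      by (rule nn_integral_suminf) measurable
    also have "\<dots> = (\<Sum>j. ennreal (s j) * (\<integral>\<^sup>+w\<in>ball 0 1 \<inter> cball \<eta> (R j). ennreal ((1 - (cmod w)\<^sup>2) powr \<alpha>) \<partial>lborel))"
      by (intro suminf_cong nn_integral_cmult) measurable
    also have "\<dots> \<le> (\<Sum>j. ennreal (s j) * ennreal (C0 * R j powr (2 + \<alpha>)))"
      by (intro suminf_le mult_left_mono C0 \<eta> R) auto
    also have "\<dots> = (\<Sum>j. ennreal (C0 * 2 powr c * 2 powr (2 + \<alpha>) * \<delta> powr (2 + \<alpha> - c) * q ^ j))"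
    proof (intro suminf_cong)
      fix j
      have "s j * R j powr (2 + \<alpha>) = 4 powr c * R j powr (2 + \<alpha> - c)"
        using R[of j] by (simp add: s_def powr_divide powr_minus powr_diff field_simps)
      also have "R j powr (2 + \<alpha> - c) = (2 powr (2 + \<alpha> - c)) powr (real (j + 1)) * \<delta> powr (2 + \<alpha> - c)"
        using \<delta> by (simp add: R_def powr_mult powr_powr mult.commute flip: powr_realpow)
          (simp add: algebra_simps flip: powr_add)
      also have "(2 powr (2 + \<alpha> - c)) powr (real (j + 1)) = q ^ j * q"
        using q by (subst powr_realpow) (auto simp: q_def)
      also have "4 powr c = 2 powr c * 2 powr c"
        using powr_mult[of 2 2 c] by simp
      also have "2 powr c * 2 powr c * (q ^ j * q * \<delta> powr (2 + \<alpha> - c))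
          = 2 powr c * (2 powr c * q) * \<delta> powr (2 + \<alpha> - c) * q ^ j" by simp
      also have "2 powr c * q = 2 powr (2 + \<alpha>)" by (simp add: q_def flip: powr_add)
      finally show "ennreal (s j) * ennreal (C0 * R j powr (2 + \<alpha>))
        = ennreal (C0 * 2 powr c * 2 powr (2 + \<alpha>) * \<delta> powr (2 + \<alpha> - c) * q ^ j)"
        using C0 by (simp add: s_def flip: ennreal_mult) (simp add: mult_ac)
    qed
    also have "\<dots> = ennreal (\<Sum>j. C0 * 2 powr c * 2 powr (2 + \<alpha>) * \<delta> powr (2 + \<alpha> - c) * q ^ j)"
      using q C0 by (intro suminf_ennreal2 summable_mult summable_geometric) auto
    also have "(\<Sum>j. C0 * 2 powr c * 2 powr (2 + \<alpha>) * \<delta> powr (2 + \<alpha> - c) * q ^ j) = C * \<delta> powr (2 + \<alpha> - c)"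
      using q by (simp add: suminf_mult suminf_geometric summable_geometric C_def)
    finally show ?thesis by (simp add: \<delta>_def)
  qed
  ultimately show ?thesis using that by blast
qed

section \<open>Averages over small disks and the geometric condition on the measure\<close>

lemma ball_subset_unit_disk:
  assumes "r \<le> 1 - cmod a"
  shows "ball a r \<subseteq> unit_disk"
proof
  fix z assume "z \<in> ball a r"
  then show "z \<in> unit_disk"
    using norm_triangle_ineq[of a "z - a"] assms by (simp add: dist_norm norm_minus_commute)
qed

text \<open>From |\<zeta> - w| < (1 - |w|)/4 follows 1 - |\<zeta>| > 3/4 (1 - |w|), hence |\<zeta> -
  w| < (1 - |\<zeta>|)/3. The radii 1/4 and 1/2 are chosen so that centre and point can change roles
  when integrals are exchanged.\<close>

lemma disk_ball_quarter:
  assumes w: "cmod w < 1" and \<zeta>: "\<zeta> \<in> ball w ((1 - cmod w) / 4)"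
  shows "cmod \<zeta> < 1" "dist \<zeta> w < (1 - cmod \<zeta>) / 2"
    "(1 - cmod w) / (1 - cmod \<zeta>) \<in> {1 / 2..2}" "(1 - cmod \<zeta>) / (1 - cmod w) \<in> {1 / 2..2}"
proof -
  have d: "cmod (\<zeta> - w) < (1 - cmod w) / 4"
    using \<zeta> by (simp add: dist_norm norm_minus_commute)
  have a: "\<bar>cmod \<zeta> - cmod w\<bar> \<le> cmod (\<zeta> - w)" by (rule norm_triangle_ineq3)
  have 1: "cmod \<zeta> \<le> cmod w + (1 - cmod w) / 4" "cmod w - (1 - cmod w) / 4 \<le> cmod \<zeta>"
    using a d by linarith+
  then show *: "cmod \<zeta> < 1" using w by (simp add: field_simps)
  show "dist \<zeta> w < (1 - cmod \<zeta>) / 2" using d 1 w by (simp add: dist_norm field_simps)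
  show "(1 - cmod w) / (1 - cmod \<zeta>) \<in> {1 / 2..2}" "(1 - cmod \<zeta>) / (1 - cmod w) \<in> {1 / 2..2}"
    using 1 w * by (auto simp: field_simps)
qed

lemma powr_le_powr_ratio:
  fixes x y a :: real
  assumes "0 < y" "x / y \<in> {1 / 2..2}"
  shows "x powr a \<le> 2 powr \<bar>a\<bar> * y powr a"
proof -
  have "0 < x / y" using assms by auto
  then have "x > 0" using assms(1) by (simp add: zero_less_divide_iff)
  have "(x / y) powr a \<le> 2 powr \<bar>a\<bar>"
    using assms by (intro powr_le_powr_abs) auto
  then show ?thesis using assms(1) \<open>x > 0\<close> by (simp add: powr_divide pos_divide_le_eq)
qed

lemma measurable_disk_id:
  assumes "sets \<mu> = sets (restrict_space borel unit_disk)"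
  shows "(\<lambda>w. w) \<in> borel_measurable \<mu>"
  by (subst measurable_cong_sets[OF assms refl], rule measurable_restrict_space1) simp

lemma space_disk:
  assumes "sets \<mu> = sets (restrict_space borel unit_disk)"
  shows "space \<mu> = unit_disk"
  using sets_eq_imp_space_eq[OF assms] by (simp add: space_restrict_space)

lemma measurable_disk_fun:
  fixes f :: "complex \<Rightarrow> 'a::topological_space"
  assumes "sets \<mu> = sets (restrict_space borel unit_disk)" "continuous_on unit_disk f"
  shows "f \<in> borel_measurable \<mu>"
  by (subst measurable_cong_sets[OF assms(1) refl])
    (rule borel_measurable_continuous_on_restrict[OF assms(2)])

text \<open>Lebesgue measure and the weight (1 - |z|)^\<alpha> differ from the normalised ones only
  by constants, see \<open>bergman_integral_compare\<close>. The root is left out so that Tonelli's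
  theorem applies directly.\<close>

definition disk_integral :: "real \<Rightarrow> real \<Rightarrow> (complex \<Rightarrow> complex) \<Rightarrow> ennreal" where
  "disk_integral p \<alpha> f = (\<integral>\<^sup>+z\<in>unit_disk. ennreal (cmod (f z) powr p * (1 - cmod z) powr \<alpha>) \<partial>lborel)"

lemma set_borel_measurable_powr_weight':
  assumes [measurable]: "(\<lambda>z. indicator unit_disk z *\<^sub>R f z) \<in> borel_measurable borel"
    and [measurable]: "h \<in> borel_measurable borel"
  shows "(\<lambda>z. ennreal (cmod (f z) powr p * h z) * indicator unit_disk z) \<in> borel_measurable borel"
proof -
  have [measurable]: "unit_disk \<in> sets borel" by simp
  have "(\<lambda>z. ennreal (cmod (indicator unit_disk z *\<^sub>R f z) powr p * h z) * indicator unit_disk z)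
      \<in> borel_measurable borel"
    by measurable
  moreover have "ennreal (cmod (indicator unit_disk z *\<^sub>R f z) powr p * h z) * indicator unit_disk z
      = ennreal (cmod (f z) powr p * h z) * indicator unit_disk z" for z
    by (cases "z \<in> unit_disk") (simp_all only: indicator_simps scaleR_one mult_zero_right not_False_eq_True)
  ultimately show ?thesis by (simp only:)
qed

lemma set_borel_measurable_powr_weight:
  assumes "f holomorphic_on unit_disk"
  shows "(\<lambda>z. ennreal (cmod (f z) powr p * (1 - cmod z) powr \<alpha>) * indicator unit_disk z) \<in> borel_measurable borel"
  by (rule set_borel_measurable_powr_weight'[OF set_borel_measurable_holomorphic[OF assms]]) auto

text \<open>On the disk of radius (1 - |w|)/4 the weight is constant up to the factor
  \<open>2 powr \<bar>\<tau> - 2\<bar>\<close>, so it can be moved under the integral of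
  \<open>sub_mean_value_powr\<close>. Division by the squared radius turns \<tau> into \<tau> - 2
  and gives the 16.\<close>

lemma sub_mean_value_disk:
  assumes f: "f holomorphic_on unit_disk" and w: "cmod w < 1" and p: "0 < p" "p \<le> 1"
  shows "ennreal (cmod (f w) powr p * (1 - cmod w) powr \<tau>)
    \<le> ennreal (16 * 4 powr (1 / p) / pi * 2 powr \<bar>\<tau> - 2\<bar>) *
      (\<integral>\<^sup>+\<zeta>\<in>ball w ((1 - cmod w) / 4). ennreal (cmod (f \<zeta>) powr p * (1 - cmod \<zeta>) powr (\<tau> - 2)) \<partial>lborel)"
proof -
  define r where "r = (1 - cmod w) / 4"
  have r: "r > 0" "r < 1 - cmod w" using w by (auto simp: r_def)
  have sub: "ball w (1 - cmod w) \<subseteq> unit_disk"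
    by (rule ball_subset_unit_disk) simp
  have sub': "ball w r \<subseteq> unit_disk"
    using sub subset_ball[of r "1 - cmod w" w] r by auto
  have [measurable]: "ball w r \<in> sets borel" by simp
  have m: "(\<lambda>z. ennreal (cmod (f z) powr p) * indicator (ball w r) z) \<in> borel_measurable borel"
  proof -
    have "(\<lambda>z. ennreal (cmod (f z) powr p * (1 - cmod z) powr 0) * indicator unit_disk z * indicator (ball w r) z) \<in> borel_measurable borel"
      by (intro borel_measurable_times_ennreal set_borel_measurable_powr_weight f borel_measurable_indicator) simp
    moreover have "ennreal (cmod (f z) powr p * (1 - cmod z) powr 0) * indicator unit_disk z * indicator (ball w r) z
        = ennreal (cmod (f z) powr p) * indicator (ball w r) z" for z
      using sub' by (cases "z \<in> ball w r") auto
    ultimately show ?thesis by (simp only:)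
  qed
  have "cmod (f w) powr p * (1 - cmod w) powr \<tau>
      = 16 * (1 - cmod w) powr (\<tau> - 2) * (cmod (f w) powr p * r\<^sup>2)"
    using w by (simp add: r_def powr_diff power_divide)
  then have "ennreal (cmod (f w) powr p * (1 - cmod w) powr \<tau>)
      = ennreal (16 * (1 - cmod w) powr (\<tau> - 2)) * ennreal (cmod (f w) powr p * r\<^sup>2)"
    by (simp only:) (rule ennreal_mult; simp)
  also have "\<dots> \<le> ennreal (16 * (1 - cmod w) powr (\<tau> - 2)) * (ennreal (4 powr (1 / p) / pi) *
      (\<integral>\<^sup>+z\<in>ball w r. ennreal (cmod (f z) powr p) \<partial>lborel))"
    by (intro mult_left_mono sub_mean_value_powr[OF holomorphic_on_subset[OF f sub] r p]) simp
  also have "\<dots> = ennreal (16 * 4 powr (1 / p) / pi) * (ennreal ((1 - cmod w) powr (\<tau> - 2)) *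
      (\<integral>\<^sup>+z\<in>ball w r. ennreal (cmod (f z) powr p) \<partial>lborel))"
  proof -
    have "ennreal (16 * (1 - cmod w) powr (\<tau> - 2)) * ennreal (4 powr (1 / p) / pi)
      = ennreal (16 * 4 powr (1 / p) / pi) * ennreal ((1 - cmod w) powr (\<tau> - 2))"
      by (simp add: mult_ac flip: ennreal_mult)
    then show ?thesis by (simp only: mult.assoc[symmetric])
  qed
  also have "ennreal ((1 - cmod w) powr (\<tau> - 2)) * (\<integral>\<^sup>+z\<in>ball w r. ennreal (cmod (f z) powr p) \<partial>lborel)
      = (\<integral>\<^sup>+z. ennreal ((1 - cmod w) powr (\<tau> - 2)) * (ennreal (cmod (f z) powr p) * indicator (ball w r) z) \<partial>lborel)"
    by (rule nn_integral_cmult[symmetric]) (use m in \<open>simp only: measurable_lborel2\<close>)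
  also have "\<dots> \<le> (\<integral>\<^sup>+z. ennreal (2 powr \<bar>\<tau> - 2\<bar>) *
      (ennreal (cmod (f z) powr p * (1 - cmod z) powr (\<tau> - 2)) * indicator (ball w r) z) \<partial>lborel)"
  proof (rule nn_integral_mono)
    fix z
    show "ennreal ((1 - cmod w) powr (\<tau> - 2)) * (ennreal (cmod (f z) powr p) * indicator (ball w r) z)
      \<le> ennreal (2 powr \<bar>\<tau> - 2\<bar>) * (ennreal (cmod (f z) powr p * (1 - cmod z) powr (\<tau> - 2)) * indicator (ball w r) z)"
    proof (cases "z \<in> ball w r")
      case True
      have z: "cmod z < 1" "(1 - cmod w) / (1 - cmod z) \<in> {1 / 2..2}"
        using disk_ball_quarter[OF w, of z] True by (simp_all add: r_def)
      have "(1 - cmod w) powr (\<tau> - 2) * cmod (f z) powr p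
          \<le> (2 powr \<bar>\<tau> - 2\<bar> * (1 - cmod z) powr (\<tau> - 2)) * cmod (f z) powr p"
        using z by (intro mult_right_mono powr_le_powr_ratio) auto
      then have "(1 - cmod w) powr (\<tau> - 2) * cmod (f z) powr p
          \<le> 2 powr \<bar>\<tau> - 2\<bar> * (cmod (f z) powr p * (1 - cmod z) powr (\<tau> - 2))"
        by (simp only: mult_ac)
      then have "ennreal ((1 - cmod w) powr (\<tau> - 2) * cmod (f z) powr p)
          \<le> ennreal (2 powr \<bar>\<tau> - 2\<bar> * (cmod (f z) powr p * (1 - cmod z) powr (\<tau> - 2)))"
        by (rule ennreal_leI)
      then have "ennreal ((1 - cmod w) powr (\<tau> - 2)) * ennreal (cmod (f z) powr p)
          \<le> ennreal (2 powr \<bar>\<tau> - 2\<bar>) * ennreal (cmod (f z) powr p * (1 - cmod z) powr (\<tau> - 2))"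
        by (subst (1 2) ennreal_mult[symmetric]) simp_all
      then show ?thesis using True by (simp only: indicator_simps mult_1_right)
    qed (simp only: indicator_simps not_False_eq_True mult_zero_right order_refl)
  qed
  also have "\<dots> = ennreal (2 powr \<bar>\<tau> - 2\<bar>) *
      (\<integral>\<^sup>+z\<in>ball w r. ennreal (cmod (f z) powr p * (1 - cmod z) powr (\<tau> - 2)) \<partial>lborel)"
  proof (rule nn_integral_cmult)
    have "(\<lambda>z. ennreal (cmod (f z) powr p) * indicator (ball w r) z * ennreal ((1 - cmod z) powr (\<tau> - 2))) \<in> borel_measurable borel"
      by (intro borel_measurable_times_ennreal m) measurable
    moreover have "ennreal (cmod (f z) powr p) * indicator (ball w r) z * ennreal ((1 - cmod z) powr (\<tau> - 2))
        = ennreal (cmod (f z) powr p * (1 - cmod z) powr (\<tau> - 2)) * indicator (ball w r) z" for z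
      by (subst ennreal_mult) (simp_all add: mult_ac)
    ultimately show "(\<lambda>z. ennreal (cmod (f z) powr p * (1 - cmod z) powr (\<tau> - 2)) * indicator (ball w r) z) \<in> borel_measurable lborel"
      by (simp only: measurable_lborel2)
  qed
  finally have "ennreal (cmod (f w) powr p * (1 - cmod w) powr \<tau>)
    \<le> ennreal (16 * 4 powr (1 / p) / pi) * (ennreal (2 powr \<bar>\<tau> - 2\<bar>) *
      (\<integral>\<^sup>+\<zeta>\<in>ball w r. ennreal (cmod (f \<zeta>) powr p * (1 - cmod \<zeta>) powr (\<tau> - 2)) \<partial>lborel))"
    by (simp add: mult_left_mono)
  also have "ennreal (16 * 4 powr (1 / p) / pi) * (ennreal (2 powr \<bar>\<tau> - 2\<bar>) * J)
      = ennreal (16 * 4 powr (1 / p) / pi * 2 powr \<bar>\<tau> - 2\<bar>) * J" for J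
    by (subst ennreal_mult) (simp_all add: mult.assoc)
  finally show ?thesis by (simp only: r_def)
qed

text \<open>For \<tau> = 2 + \<alpha> the weight in the average is that of
  \<open>disk_integral\<close>, and the small disk is enlarged to the whole one.\<close>

lemma pointwise_bound_disk:
  assumes f: "f holomorphic_on unit_disk" and w: "cmod w < 1" and p: "0 < p" "p \<le> 1"
  shows "ennreal (cmod (f w) powr p * (1 - cmod w) powr (2 + \<alpha>))
    \<le> ennreal (16 * 4 powr (1 / p) / pi * 2 powr \<bar>\<alpha>\<bar>) * disk_integral p \<alpha> f"
proof -
  have "ball w ((1 - cmod w) / 4) \<subseteq> unit_disk"
    using disk_ball_quarter(1)[OF w] by auto
  then have "(\<integral>\<^sup>+\<zeta>\<in>ball w ((1 - cmod w) / 4). ennreal (cmod (f \<zeta>) powr p * (1 - cmod \<zeta>) powr (2 + \<alpha> - 2)) \<partial>lborel)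
      \<le> disk_integral p \<alpha> f"
    unfolding disk_integral_def by (intro nn_integral_mono mult_left_mono) (auto simp: indicator_def)
  then show ?thesis
    using order_trans[OF sub_mean_value_disk[OF f w p, of "2 + \<alpha>"] mult_left_mono] by simp
qed

text \<open>The disks are comparable to hyperbolic disks of fixed radius, so this is the usual
  geometric form of a Carleson condition for Bergman spaces.\<close>

definition ball_condition :: "complex measure \<Rightarrow> real \<Rightarrow> bool" where
  "ball_condition \<mu> \<sigma> \<longleftrightarrow> (\<exists>K>0. \<forall>\<zeta>\<in>unit_disk.
     emeasure \<mu> (ball \<zeta> ((1 - cmod \<zeta>) / 2)) \<le> ennreal (K * (1 - cmod \<zeta>) powr \<sigma>))"

text \<open>Each |f w|^p is averaged over the small disk about \<open>w\<close>, then the integrals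
  are exchanged: for fixed \<zeta>, the points \<open>w\<close> whose small disk contains \<zeta>
  lie in the disk that \<open>ball_condition\<close> measures. The free exponent \<tau> lets the
  weight on the right be prescribed.\<close>

lemma ball_condition_embedding:
  assumes fin: "finite_measure \<mu>" and sets: "sets \<mu> = sets (restrict_space borel unit_disk)"
    and ball: "ball_condition \<mu> \<sigma>" and p: "0 < p" "p \<le> 1"
  obtains C where "C > 0" "\<And>f. f holomorphic_on unit_disk \<Longrightarrow>
    (\<integral>\<^sup>+w. ennreal (cmod (f w) powr p * (1 - cmod w) powr \<tau>) \<partial>\<mu>)
      \<le> ennreal C * disk_integral p (\<sigma> + \<tau> - 2) f"
proof -
  interpret finite_measure \<mu> by fact
  interpret pair_sigma_finite \<mu> "lborel :: complex measure" ..
  obtain K where K: "K > 0" "\<And>\<zeta>. cmod \<zeta> < 1 \<Longrightarrow>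
      emeasure \<mu> (ball \<zeta> ((1 - cmod \<zeta>) / 2)) \<le> ennreal (K * (1 - cmod \<zeta>) powr \<sigma>)"
    using ball by (auto simp: ball_condition_def)
  define A where "A = 16 * 4 powr (1 / p) / pi * 2 powr \<bar>\<tau> - 2\<bar>"
  have A: "A > 0" by (simp add: A_def)
  have "(\<integral>\<^sup>+w. ennreal (cmod (f w) powr p * (1 - cmod w) powr \<tau>) \<partial>\<mu>)
      \<le> ennreal (A * K) * disk_integral p (\<sigma> + \<tau> - 2) f" if f: "f holomorphic_on unit_disk" for f
  proof -
    define g where "g \<zeta> = ennreal (cmod (f \<zeta>) powr p * (1 - cmod \<zeta>) powr (\<tau> - 2)) * indicator unit_disk \<zeta>" for \<zeta>
    \<comment> \<open>The cut-off is centred at \<zeta> and not at \<open>w\<close>, so that its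
      integral over \<open>w\<close> is a quantity controlled by the hypothesis.\<close>
    define k where "k w \<zeta> = (if dist \<zeta> w < (1 - cmod \<zeta>) / 2 then 1 else 0 :: ennreal)" for w \<zeta> :: complex
    have g[measurable]: "g \<in> borel_measurable borel"
      unfolding g_def by (rule set_borel_measurable_powr_weight[OF f])
    have meas1: "(\<lambda>\<zeta>. g \<zeta> * k w \<zeta>) \<in> borel_measurable lborel" for w
      unfolding k_def by measurable
    have [measurable]: "(\<lambda>w. w) \<in> borel_measurable \<mu>"
      by (rule measurable_disk_id[OF sets])
    have [measurable]: "(\<lambda>x. k (fst x) (snd x)) \<in> borel_measurable (\<mu> \<Otimes>\<^sub>M lborel)"
      unfolding k_def by measurable
    have meas: "(\<lambda>(w, \<zeta>). g \<zeta> * k w \<zeta>) \<in> borel_measurable (\<mu> \<Otimes>\<^sub>M lborel)"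
      unfolding case_prod_beta by measurable
    have meas2: "(\<lambda>w. k w \<zeta>) \<in> borel_measurable \<mu>" for \<zeta>
      unfolding k_def by measurable
    have meas3: "(\<lambda>w. \<integral>\<^sup>+\<zeta>. g \<zeta> * k w \<zeta> \<partial>lborel) \<in> borel_measurable \<mu>"
      using lborel.borel_measurable_nn_integral[OF meas] by simp
    have "(\<integral>\<^sup>+w. ennreal (cmod (f w) powr p * (1 - cmod w) powr \<tau>) \<partial>\<mu>)
        \<le> (\<integral>\<^sup>+w. ennreal A * (\<integral>\<^sup>+\<zeta>. g \<zeta> * k w \<zeta> \<partial>lborel) \<partial>\<mu>)"
    proof (rule nn_integral_mono)
      fix w assume "w \<in> space \<mu>"
      then have w: "cmod w < 1" by (simp add: space_disk[OF sets])
      have "(\<integral>\<^sup>+\<zeta>\<in>ball w ((1 - cmod w) / 4). ennreal (cmod (f \<zeta>) powr p * (1 - cmod \<zeta>) powr (\<tau> - 2)) \<partial>lborel)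
          \<le> (\<integral>\<^sup>+\<zeta>. g \<zeta> * k w \<zeta> \<partial>lborel)"
      proof (rule nn_integral_mono)
        fix \<zeta>
        show "ennreal (cmod (f \<zeta>) powr p * (1 - cmod \<zeta>) powr (\<tau> - 2)) * indicator (ball w ((1 - cmod w) / 4)) \<zeta> \<le> g \<zeta> * k w \<zeta>"
          using disk_ball_quarter(1,2)[OF w, of \<zeta>]
          by (cases "\<zeta> \<in> ball w ((1 - cmod w) / 4)") (simp_all add: g_def k_def)
      qed
      then show "ennreal (cmod (f w) powr p * (1 - cmod w) powr \<tau>) \<le> ennreal A * (\<integral>\<^sup>+\<zeta>. g \<zeta> * k w \<zeta> \<partial>lborel)"
        using order_trans[OF sub_mean_value_disk[OF f w p, of \<tau>] mult_left_mono] by (simp add: A_def)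
    qed
    also have "\<dots> = ennreal A * (\<integral>\<^sup>+w. \<integral>\<^sup>+\<zeta>. g \<zeta> * k w \<zeta> \<partial>lborel \<partial>\<mu>)"
      by (rule nn_integral_cmult[OF meas3])
    also have "(\<integral>\<^sup>+w. \<integral>\<^sup>+\<zeta>. g \<zeta> * k w \<zeta> \<partial>lborel \<partial>\<mu>) = (\<integral>\<^sup>+\<zeta>. \<integral>\<^sup>+w. g \<zeta> * k w \<zeta> \<partial>\<mu> \<partial>lborel)"
      by (rule Fubini'[symmetric, OF meas])
    also have "\<dots> \<le> (\<integral>\<^sup>+\<zeta>. ennreal K * (ennreal (cmod (f \<zeta>) powr p * (1 - cmod \<zeta>) powr (\<sigma> + \<tau> - 2)) * indicator unit_disk \<zeta>) \<partial>lborel)"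
    proof (rule nn_integral_mono)
      fix \<zeta> :: complex
      have eq: "(\<integral>\<^sup>+w. g \<zeta> * k w \<zeta> \<partial>\<mu>) = g \<zeta> * (\<integral>\<^sup>+w. k w \<zeta> \<partial>\<mu>)"
        by (rule nn_integral_cmult[OF meas2])
      show "(\<integral>\<^sup>+w. g \<zeta> * k w \<zeta> \<partial>\<mu>)
        \<le> ennreal K * (ennreal (cmod (f \<zeta>) powr p * (1 - cmod \<zeta>) powr (\<sigma> + \<tau> - 2)) * indicator unit_disk \<zeta>)"
      proof (cases "\<zeta> \<in> unit_disk")
        case True
        then have \<zeta>: "cmod \<zeta> < 1" by simp
        have "ball \<zeta> ((1 - cmod \<zeta>) / 2) \<subseteq> unit_disk"
          by (rule ball_subset_unit_disk) (use \<zeta> in auto)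
        then have S: "ball \<zeta> ((1 - cmod \<zeta>) / 2) \<in> sets \<mu>"
          unfolding sets by (subst sets_restrict_space_iff) auto
        have "(\<integral>\<^sup>+w. k w \<zeta> \<partial>\<mu>) = (\<integral>\<^sup>+w. indicator (ball \<zeta> ((1 - cmod \<zeta>) / 2)) w \<partial>\<mu>)"
          by (intro nn_integral_cong) (auto simp: k_def indicator_def)
        also have "\<dots> = emeasure \<mu> (ball \<zeta> ((1 - cmod \<zeta>) / 2))"
          by (rule nn_integral_indicator[OF S])
        also have "\<dots> \<le> ennreal (K * (1 - cmod \<zeta>) powr \<sigma>)" by (rule K(2)[OF \<zeta>])
        finally have "g \<zeta> * (\<integral>\<^sup>+w. k w \<zeta> \<partial>\<mu>) \<le> g \<zeta> * ennreal (K * (1 - cmod \<zeta>) powr \<sigma>)"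
          by (rule mult_left_mono) simp
        also have "\<dots> = ennreal (cmod (f \<zeta>) powr p * (1 - cmod \<zeta>) powr (\<tau> - 2) * (K * (1 - cmod \<zeta>) powr \<sigma>))"
          using True K(1) by (simp add: g_def flip: ennreal_mult)
        also have "cmod (f \<zeta>) powr p * (1 - cmod \<zeta>) powr (\<tau> - 2) * (K * (1 - cmod \<zeta>) powr \<sigma>)
            = K * (cmod (f \<zeta>) powr p * ((1 - cmod \<zeta>) powr \<sigma> * (1 - cmod \<zeta>) powr (\<tau> - 2)))"
          by (simp only: mult_ac)
        also have "(1 - cmod \<zeta>) powr \<sigma> * (1 - cmod \<zeta>) powr (\<tau> - 2) = (1 - cmod \<zeta>) powr (\<sigma> + \<tau> - 2)"
          by (subst powr_add[symmetric]) (simp add: algebra_simps)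
        finally show ?thesis
          unfolding eq using True K(1) by (simp flip: ennreal_mult)
      next
        case False
        then show ?thesis unfolding eq by (simp add: g_def)
      qed
    qed
    also have "\<dots> = ennreal K * disk_integral p (\<sigma> + \<tau> - 2) f"
      unfolding disk_integral_def
      by (rule nn_integral_cmult) (use set_borel_measurable_powr_weight[OF f] in \<open>simp only: measurable_lborel2\<close>)
    finally have "(\<integral>\<^sup>+w. ennreal (cmod (f w) powr p * (1 - cmod w) powr \<tau>) \<partial>\<mu>)
        \<le> ennreal A * (ennreal K * disk_integral p (\<sigma> + \<tau> - 2) f)"
      by (simp add: mult_left_mono)
    then show ?thesis using A K(1) by (simp add: ennreal_mult mult.assoc)
  qed
  moreover have "A * K > 0" using A K by simp
  ultimately show ?thesis using that by blast
qed

subsection \<open>Carleson measures\<close>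

lemma ennreal_powr_ennreal: "x \<ge> 0 \<Longrightarrow> ennreal_powr (ennreal x) a = ennreal (x powr a)"
  by (simp add: ennreal_powr_def)

lemma ennreal_powr_leI:
  assumes "X \<le> ennreal Q" "a > 0" "Q \<ge> 0"
  shows "ennreal_powr X a \<le> ennreal (Q powr a)"
  using assms by (cases X) (auto simp: ennreal_powr_ennreal top_unique intro!: ennreal_leI powr_mono2)

lemma ennreal_powr_leD:
  assumes "ennreal_powr X (1 / s) \<le> ennreal Q" "s > 0" "Q \<ge> 0"
  shows "X \<le> ennreal (Q powr s)"
proof (cases X)
  case (real x)
  then have "x powr (1 / s) \<le> Q"
    using assms by (simp add: ennreal_powr_ennreal)
  then have "(x powr (1 / s)) powr s \<le> Q powr s"
    using assms by (intro powr_mono2) auto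
  then show ?thesis using real assms by (simp add: powr_powr ennreal_leI)
next
  case top
  then show ?thesis using assms by (simp add: ennreal_powr_def top_unique)
qed

lemma nn_integral_area_measure:
  assumes "(\<lambda>z. g z * indicator unit_disk z) \<in> borel_measurable borel"
  shows "(\<integral>\<^sup>+z. g z \<partial>area_measure) = ennreal (1 / pi) * (\<integral>\<^sup>+z\<in>unit_disk. g z \<partial>lborel)"
proof -
  have "g \<in> borel_measurable (restrict_space lborel unit_disk)"
    using assms by (subst borel_measurable_restrict_space_iff_ennreal) (auto simp: measurable_lborel2)
  then show ?thesis
    unfolding area_measure_def
    by (subst nn_integral_scale_measure, simp, subst nn_integral_restrict_space) simp_all
qed

definition bergman_integral :: "real \<Rightarrow> real \<Rightarrow> (complex \<Rightarrow> complex) \<Rightarrow> ennreal" where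
  "bergman_integral p \<alpha> f = (\<integral>\<^sup>+z. ennreal (cmod (f z) powr p * bergman_weight \<alpha> z) \<partial>area_measure)"

lemma bergman_norm_eq: "bergman_norm p \<alpha> f = ennreal_powr (bergman_integral p \<alpha> f) (1 / p)"
  by (simp add: bergman_norm_def bergman_integral_def)

lemma disk_weight_compare:
  fixes \<alpha> x :: real
  assumes "0 \<le> x" "x < 1"
  shows "(1 - x\<^sup>2) powr \<alpha> \<le> 2 powr \<bar>\<alpha>\<bar> * (1 - x) powr \<alpha>"
    and "(1 - x) powr \<alpha> \<le> 2 powr \<bar>\<alpha>\<bar> * (1 - x\<^sup>2) powr \<alpha>"
proof -
  have e: "1 - x\<^sup>2 = (1 - x) * (1 + x)" by (simp add: algebra_simps power2_eq_square)
  have q: "(1 - x\<^sup>2) / (1 - x) = 1 + x" "(1 - x) / (1 - x\<^sup>2) = 1 / (1 + x)"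
    unfolding e using assms by simp_all
  have r: "(1 - x\<^sup>2) / (1 - x) \<in> {1 / 2..2}" "(1 - x) / (1 - x\<^sup>2) \<in> {1 / 2..2}"
    unfolding q using assms by (auto simp: field_simps)
  have pos: "0 < 1 - x\<^sup>2" unfolding e using assms by simp
  show "(1 - x\<^sup>2) powr \<alpha> \<le> 2 powr \<bar>\<alpha>\<bar> * (1 - x) powr \<alpha>"
    by (rule powr_le_powr_ratio) (use r assms in auto)
  show "(1 - x) powr \<alpha> \<le> 2 powr \<bar>\<alpha>\<bar> * (1 - x\<^sup>2) powr \<alpha>"
    by (rule powr_le_powr_ratio) (use r pos in auto)
qed

text \<open>The factor 1 + |z| of 1 - |z|^2 lies between 1 and 2. Measurability on the disk is
  assumed in place of holomorphy because \<open>f\<close> may be an image under the Toeplitz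
  operator.\<close>

lemma bergman_integral_compare:
  assumes \<alpha>: "\<alpha> > -1" and f: "(\<lambda>z. indicator unit_disk z *\<^sub>R f z) \<in> borel_measurable borel"
  shows "bergman_integral p \<alpha> f \<le> ennreal ((1 + \<alpha>) * 2 powr \<bar>\<alpha>\<bar> / pi) * disk_integral p \<alpha> f"
    and "disk_integral p \<alpha> f \<le> ennreal (pi * 2 powr \<bar>\<alpha>\<bar> / (1 + \<alpha>)) * bergman_integral p \<alpha> f"
proof -
  let ?w = "\<lambda>z. ennreal (cmod (f z) powr p * bergman_weight \<alpha> z) * indicator unit_disk z"
  let ?v = "\<lambda>z. ennreal (cmod (f z) powr p * (1 - cmod z) powr \<alpha>) * indicator unit_disk z"
  have mw: "?w \<in> borel_measurable borel"
    unfolding bergman_weight_def by (rule set_borel_measurable_powr_weight'[OF f]) measurable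
  have mv: "?v \<in> borel_measurable borel"
    by (rule set_borel_measurable_powr_weight'[OF f]) measurable
  have B: "bergman_integral p \<alpha> f = ennreal (1 / pi) * (\<integral>\<^sup>+z. ?w z \<partial>lborel)"
    unfolding bergman_integral_def by (rule nn_integral_area_measure[OF mw])
  have wv: "?w z \<le> ennreal ((1 + \<alpha>) * 2 powr \<bar>\<alpha>\<bar>) * ?v z" for z
  proof (cases "z \<in> unit_disk")
    case True
    then have "cmod (f z) powr p * bergman_weight \<alpha> z
        \<le> cmod (f z) powr p * ((1 + \<alpha>) * (2 powr \<bar>\<alpha>\<bar> * (1 - cmod z) powr \<alpha>))"
      unfolding bergman_weight_def using \<alpha>
      by (intro mult_left_mono disk_weight_compare) auto
    also have "\<dots> = (1 + \<alpha>) * 2 powr \<bar>\<alpha>\<bar> * (cmod (f z) powr p * (1 - cmod z) powr \<alpha>)"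
      by (simp only: mult_ac)
    finally show ?thesis
      using True \<alpha> by (simp add: ennreal_leI flip: ennreal_mult)
  qed simp
  have vw: "?v z \<le> ennreal (2 powr \<bar>\<alpha>\<bar> / (1 + \<alpha>)) * ?w z" for z
  proof (cases "z \<in> unit_disk")
    case True
    then have "cmod (f z) powr p * (1 - cmod z) powr \<alpha>
        \<le> cmod (f z) powr p * (2 powr \<bar>\<alpha>\<bar> * (1 - (cmod z)\<^sup>2) powr \<alpha>)"
      using \<alpha> by (intro mult_left_mono disk_weight_compare) auto
    also have "\<dots> = 2 powr \<bar>\<alpha>\<bar> / (1 + \<alpha>) * (cmod (f z) powr p * bergman_weight \<alpha> z)"
      using \<alpha> by (simp add: bergman_weight_def)
    finally have "ennreal (cmod (f z) powr p * (1 - cmod z) powr \<alpha>)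
        \<le> ennreal (2 powr \<bar>\<alpha>\<bar> / (1 + \<alpha>) * (cmod (f z) powr p * bergman_weight \<alpha> z))"
      by (rule ennreal_leI)
    also have "\<dots> = ennreal (2 powr \<bar>\<alpha>\<bar> / (1 + \<alpha>)) * ennreal (cmod (f z) powr p * bergman_weight \<alpha> z)"
      using \<alpha> by (intro ennreal_mult) (auto simp: bergman_weight_def)
    finally show ?thesis using True by simp
  qed simp
  have "(\<integral>\<^sup>+z. ?w z \<partial>lborel) \<le> (\<integral>\<^sup>+z. ennreal ((1 + \<alpha>) * 2 powr \<bar>\<alpha>\<bar>) * ?v z \<partial>lborel)"
    by (intro nn_integral_mono wv)
  also have "\<dots> = ennreal ((1 + \<alpha>) * 2 powr \<bar>\<alpha>\<bar>) * disk_integral p \<alpha> f"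
    unfolding disk_integral_def by (rule nn_integral_cmult) (use mv in \<open>simp only: measurable_lborel2\<close>)
  finally have "bergman_integral p \<alpha> f \<le> ennreal (1 / pi) * (ennreal ((1 + \<alpha>) * 2 powr \<bar>\<alpha>\<bar>) * disk_integral p \<alpha> f)"
    unfolding B by (rule mult_left_mono) simp
  also have "\<dots> = ennreal ((1 + \<alpha>) * 2 powr \<bar>\<alpha>\<bar> / pi) * disk_integral p \<alpha> f"
    using \<alpha> by (simp add: mult.assoc[symmetric] flip: ennreal_mult)
  finally show "bergman_integral p \<alpha> f \<le> ennreal ((1 + \<alpha>) * 2 powr \<bar>\<alpha>\<bar> / pi) * disk_integral p \<alpha> f" .
  have "disk_integral p \<alpha> f \<le> (\<integral>\<^sup>+z. ennreal (2 powr \<bar>\<alpha>\<bar> / (1 + \<alpha>)) * ?w z \<partial>lborel)"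
    unfolding disk_integral_def by (intro nn_integral_mono vw)
  also have "\<dots> = ennreal (2 powr \<bar>\<alpha>\<bar> / (1 + \<alpha>)) * (\<integral>\<^sup>+z. ?w z \<partial>lborel)"
    by (rule nn_integral_cmult) (use mw in \<open>simp only: measurable_lborel2\<close>)
  also have "ennreal (2 powr \<bar>\<alpha>\<bar> / (1 + \<alpha>)) = ennreal (pi * 2 powr \<bar>\<alpha>\<bar> / (1 + \<alpha>)) * ennreal (1 / pi)"
    using \<alpha> by (simp flip: ennreal_mult)
  finally show "disk_integral p \<alpha> f \<le> ennreal (pi * 2 powr \<bar>\<alpha>\<bar> / (1 + \<alpha>)) * bergman_integral p \<alpha> f"
    unfolding B by (simp only: mult.assoc)
qed

section \<open>Powers of the kernel as test functions\<close>

lemma Re_disk_kernel_pos: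
  assumes "cmod a < 1" "cmod w < 1"
  shows "0 < Re (1 - cnj a * w)"
proof -
  have "cmod (cnj a * w) < 1"
    using mult_strict_mono'[of "cmod a" 1 "cmod w" 1] assms by (simp add: norm_mult)
  then show ?thesis using complex_Re_le_cmod[of "cnj a * w"] by simp
qed

lemma cmod_powr_of_real: "cmod (z powr complex_of_real c) = cmod z powr c"
  by (simp add: norm_powr_real_powr')

lemma holomorphic_disk_kernel:
  assumes "cmod a < 1"
  shows "(\<lambda>w. (1 - cnj a * w) powr complex_of_real c) holomorphic_on unit_disk"
proof (rule holomorphic_on_powr)
  fix w assume "w \<in> unit_disk"
  then have "0 < Re (1 - cnj a * w)" using Re_disk_kernel_pos assms by simp
  then show "1 - cnj a * w \<notin> \<real>\<^sub>\<le>\<^sub>0" by (auto simp: complex_nonpos_Reals_iff)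
qed (intro holomorphic_intros)+

text \<open>Near \<open>a\<close> the kernel is almost constant: \<open>1 - cnj a * w\<close>
  differs from 1 - |a|^2 \<le> 2 (1 - |a|) by at most |w - a|, whence 5/2 = 2 + 1/2. With
  \<open>disk_kernel_lower\<close> this fixes its size on the disk.\<close>

lemma disk_kernel_upper:
  assumes a: "cmod a < 1" and w: "w \<in> ball a ((1 - cmod a) / 2)"
  shows "cmod (1 - cnj a * w) \<le> 5 / 2 * (1 - cmod a)"
proof -
  have "1 - cnj a * w = complex_of_real (1 - (cmod a)\<^sup>2) - cnj a * (w - a)"
    using complex_norm_square[of a] by (simp add: algebra_simps)
  then have "cmod (1 - cnj a * w) \<le> \<bar>1 - (cmod a)\<^sup>2\<bar> + cmod a * cmod (w - a)"
    by (metis norm_triangle_ineq4 norm_mult complex_mod_cnj norm_of_real)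
  moreover have "\<bar>1 - (cmod a)\<^sup>2\<bar> = (1 - cmod a) * (1 + cmod a)"
    using power_le_one[of "cmod a" 2] a by (simp add: algebra_simps power2_eq_square)
  moreover have "(1 - cmod a) * (1 + cmod a) \<le> (1 - cmod a) * 2" using a by (intro mult_left_mono) auto
  moreover have "cmod a * cmod (w - a) \<le> 1 * ((1 - cmod a) / 2)"
    using a w by (intro mult_mono) (auto simp: dist_norm norm_minus_commute)
  ultimately show ?thesis by argo
qed

lemma kernel_disk_integral:
  assumes \<alpha>: "\<alpha> > -1" and c: "c * p > 2 + \<alpha>"
  obtains C where "C > 0" "\<And>a. cmod a < 1 \<Longrightarrow>
    disk_integral p \<alpha> (\<lambda>w. (1 - cnj a * w) powr complex_of_real (- c))
      \<le> ennreal (C * (1 - cmod a) powr (2 + \<alpha> - c * p))"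
proof -
  obtain C0 where C0: "C0 > 0" "\<And>a. cmod a < 1 \<Longrightarrow>
    (\<integral>\<^sup>+w\<in>ball 0 1. ennreal ((1 - (cmod w)\<^sup>2) powr \<alpha> * cmod (1 - cnj a * w) powr (- (c * p))) \<partial>lborel)
      \<le> ennreal (C0 * (1 - cmod a) powr (2 + \<alpha> - c * p))"
    using forelli_rudin[OF \<alpha> c] by blast
  have "disk_integral p \<alpha> (\<lambda>w. (1 - cnj a * w) powr complex_of_real (- c))
      \<le> ennreal (2 powr \<bar>\<alpha>\<bar> * C0 * (1 - cmod a) powr (2 + \<alpha> - c * p))" if a: "cmod a < 1" for a
  proof -
    let ?v = "\<lambda>w. ennreal ((1 - (cmod w)\<^sup>2) powr \<alpha> * cmod (1 - cnj a * w) powr (- (c * p))) * indicator unit_disk w"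
    have [measurable]: "unit_disk \<in> sets borel" by simp
    have mv: "?v \<in> borel_measurable borel" by measurable
    have "disk_integral p \<alpha> (\<lambda>w. (1 - cnj a * w) powr complex_of_real (- c))
        \<le> (\<integral>\<^sup>+w. ennreal (2 powr \<bar>\<alpha>\<bar>) * ?v w \<partial>lborel)"
      unfolding disk_integral_def cmod_powr_of_real powr_powr
    proof (rule nn_integral_mono)
      fix w
      show "ennreal (cmod (1 - cnj a * w) powr (- c * p) * (1 - cmod w) powr \<alpha>) * indicator unit_disk w
        \<le> ennreal (2 powr \<bar>\<alpha>\<bar>) * ?v w"
      proof (cases "w \<in> unit_disk")
        case True
        have "cmod (1 - cnj a * w) powr (- c * p) * (1 - cmod w) powr \<alpha>
          \<le> cmod (1 - cnj a * w) powr (- c * p) * (2 powr \<bar>\<alpha>\<bar> * (1 - (cmod w)\<^sup>2) powr \<alpha>)"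
          using True by (intro mult_left_mono disk_weight_compare) auto
        also have "\<dots> = 2 powr \<bar>\<alpha>\<bar> * ((1 - (cmod w)\<^sup>2) powr \<alpha> * cmod (1 - cnj a * w) powr (- (c * p)))"
          by (simp add: mult_ac)
        finally show ?thesis using True by (simp add: ennreal_leI flip: ennreal_mult)
      qed simp
    qed
    also have "\<dots> = ennreal (2 powr \<bar>\<alpha>\<bar>) * (\<integral>\<^sup>+w. ?v w \<partial>lborel)"
      by (rule nn_integral_cmult) (use mv in \<open>simp only: measurable_lborel2\<close>)
    also have "\<dots> \<le> ennreal (2 powr \<bar>\<alpha>\<bar>) * ennreal (C0 * (1 - cmod a) powr (2 + \<alpha> - c * p))"
      by (intro mult_left_mono C0(2) a) simp
    finally show ?thesis using C0(1) by (simp add: mult.assoc flip: ennreal_mult)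
  qed
  then show ?thesis using C0(1) by (intro that[of "2 powr \<bar>\<alpha>\<bar> * C0"]) auto
qed

text \<open>The kernel to the power -M is at least (5/2 \<delta>)^(-M) on the disk about
  \<open>a\<close>, while its norm is at most of order \<delta>^(2 + \<alpha> - M). In the
  comparison of s-th powers M cancels and \<delta>^(s (2 + \<alpha>)) remains.\<close>

lemma carleson_imp_ball_condition:
  assumes sets: "sets \<mu> = sets (restrict_space borel unit_disk)"
    and \<alpha>: "\<alpha> > -1" and s: "s > 0" and carl: "carleson_measure s 1 \<alpha> \<mu>"
  shows "ball_condition \<mu> (s * (2 + \<alpha>))"
proof -
  \<comment> \<open>Any exponent above 2 + \<alpha> is in the Forelli--Rudin range.\<close>
  define M where "M = 3 + \<alpha>"
  have M: "M * 1 > 2 + \<alpha>" "M > 0" using \<alpha> by (auto simp: M_def)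
  obtain C1 where C1: "C1 > 0" "\<And>a. cmod a < 1 \<Longrightarrow>
    disk_integral 1 \<alpha> (\<lambda>w. (1 - cnj a * w) powr complex_of_real (- M))
      \<le> ennreal (C1 * (1 - cmod a) powr (2 + \<alpha> - M * 1))"
    using kernel_disk_integral[OF \<alpha> M(1)] by blast
  obtain C2 where C2: "C2 > 0" "\<And>f. f \<in> bergman_space 1 \<alpha> \<Longrightarrow>
        ennreal_powr (\<integral>\<^sup>+ w. ennreal (cmod (f w) powr s) \<partial>\<mu>) (1 / s) \<le> ennreal C2 * bergman_norm 1 \<alpha> f"
    using carl by (auto simp: carleson_measure_def)
  define C3 where "C3 = C2 * ((1 + \<alpha>) * 2 powr \<bar>\<alpha>\<bar> / pi * C1)"
  have C3: "C3 > 0" using C1 C2 \<alpha> by (simp add: C3_def)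
  define K where "K = C3 powr s * (5 / 2) powr (M * s)"
  have "emeasure \<mu> (ball a ((1 - cmod a) / 2)) \<le> ennreal (K * (1 - cmod a) powr (s * (2 + \<alpha>)))"
    if a: "cmod a < 1" for a
  proof -
    define \<delta> where "\<delta> = 1 - cmod a"
    have \<delta>: "\<delta> > 0" using a by (simp add: \<delta>_def)
    define f where "f w = (1 - cnj a * w) powr complex_of_real (- M)" for w
    have hol: "f holomorphic_on unit_disk"
      unfolding f_def by (rule holomorphic_disk_kernel[OF a])
    have fm: "cmod (f w) = cmod (1 - cnj a * w) powr (- M)" for w
      unfolding f_def by (rule cmod_powr_of_real)
    define Q where "Q = (1 + \<alpha>) * 2 powr \<bar>\<alpha>\<bar> / pi * (C1 * \<delta> powr (2 + \<alpha> - M))"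
    have Q: "Q \<ge> 0" using \<alpha> C1 by (simp add: Q_def)
    have "bergman_integral 1 \<alpha> f \<le> ennreal ((1 + \<alpha>) * 2 powr \<bar>\<alpha>\<bar> / pi) * disk_integral 1 \<alpha> f"
      by (intro bergman_integral_compare \<alpha> set_borel_measurable_holomorphic[OF hol]) simp
    also have "\<dots> \<le> ennreal ((1 + \<alpha>) * 2 powr \<bar>\<alpha>\<bar> / pi) * ennreal (C1 * \<delta> powr (2 + \<alpha> - M))"
      using C1(2)[OF a] by (intro mult_left_mono) (simp_all add: f_def[abs_def] \<delta>_def)
    also have "\<dots> = ennreal Q" unfolding Q_def using \<alpha> C1 by (intro ennreal_mult[symmetric]) auto
    finally have "bergman_norm 1 \<alpha> f \<le> ennreal (Q powr (1 / 1))"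
      unfolding bergman_norm_eq by (intro ennreal_powr_leI Q) auto
    then have norm: "bergman_norm 1 \<alpha> f \<le> ennreal Q" using Q by simp
    then have "f \<in> bergman_space 1 \<alpha>"
      using hol by (simp add: bergman_space_def le_less_trans)
    then have "ennreal_powr (\<integral>\<^sup>+ w. ennreal (cmod (f w) powr s) \<partial>\<mu>) (1 / s) \<le> ennreal C2 * bergman_norm 1 \<alpha> f"
      by (rule C2)
    also have "\<dots> \<le> ennreal C2 * ennreal Q" by (intro mult_left_mono norm) simp
    also have "\<dots> = ennreal (C2 * Q)" using C2 Q by (simp add: ennreal_mult)
    also have "C2 * Q = C3 * \<delta> powr (2 + \<alpha> - M)" by (simp add: Q_def C3_def)
    finally have up: "(\<integral>\<^sup>+ w. ennreal (cmod (f w) powr s) \<partial>\<mu>) \<le> ennreal ((C3 * \<delta> powr (2 + \<alpha> - M)) powr s)"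
      using C3 s by (intro ennreal_powr_leD) auto
    let ?B = "ball a ((1 - cmod a) / 2)"
    have "?B \<subseteq> unit_disk"
      by (rule ball_subset_unit_disk) (use a in auto)
    then have S: "?B \<in> sets \<mu>"
      unfolding sets by (subst sets_restrict_space_iff) auto
    let ?c = "(5 / 2 * \<delta>) powr (- M * s)"
    have "ennreal ?c * emeasure \<mu> ?B = (\<integral>\<^sup>+w. ennreal ?c * indicator ?B w \<partial>\<mu>)"
      by (rule nn_integral_cmult_indicator[symmetric, OF S])
    also have "\<dots> \<le> (\<integral>\<^sup>+ w. ennreal (cmod (f w) powr s) \<partial>\<mu>)"
    proof (rule nn_integral_mono)
      fix w assume "w \<in> space \<mu>"
      then have w: "cmod w < 1" by (simp add: space_disk[OF sets])
      show "ennreal ?c * indicator ?B w \<le> ennreal (cmod (f w) powr s)"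
      proof (cases "w \<in> ?B")
        case True
        have "?c \<le> cmod (1 - cnj a * w) powr (- M * s)"
          using disk_kernel_upper[OF a True] disk_kernel_lower[OF a w] M s a
          by (intro powr_mono2') (auto simp: \<delta>_def)
        then show ?thesis using True by (simp add: fm powr_powr ennreal_leI)
      qed simp
    qed
    also note up
    finally have "ennreal ((5 / 2 * \<delta>) powr (M * s)) * (ennreal ?c * emeasure \<mu> ?B)
        \<le> ennreal ((5 / 2 * \<delta>) powr (M * s)) * ennreal ((C3 * \<delta> powr (2 + \<alpha> - M)) powr s)"
      by (rule mult_left_mono) simp
    also have "ennreal ((5 / 2 * \<delta>) powr (M * s)) * (ennreal ?c * emeasure \<mu> ?B) = emeasure \<mu> ?B"
    proof -
      have "(5 / 2 * \<delta>) powr (M * s) * ?c = 1"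
        using \<delta> by (subst powr_add[symmetric]) simp
      then have "ennreal ((5 / 2 * \<delta>) powr (M * s)) * ennreal ?c = 1"
        by (subst ennreal_mult[symmetric]) (simp_all only: powr_ge_zero ennreal_1)
      then show ?thesis by (simp only: mult.assoc[symmetric] mult_1_left)
    qed
    also have "ennreal ((5 / 2 * \<delta>) powr (M * s)) * ennreal ((C3 * \<delta> powr (2 + \<alpha> - M)) powr s)
        = ennreal ((5 / 2 * \<delta>) powr (M * s) * (C3 * \<delta> powr (2 + \<alpha> - M)) powr s)"
      by (rule ennreal_mult[symmetric]) auto
    also have "(5 / 2 * \<delta>) powr (M * s) * (C3 * \<delta> powr (2 + \<alpha> - M)) powr s
        = K * (\<delta> powr (M * s) * \<delta> powr ((2 + \<alpha> - M) * s))"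
      using \<delta> C3 powr_mult[of "5 / 2" \<delta> "M * s"] by (simp add: K_def powr_mult powr_powr)
    also have "\<delta> powr (M * s) * \<delta> powr ((2 + \<alpha> - M) * s) = \<delta> powr (s * (2 + \<alpha>))"
      by (subst powr_add[symmetric]) (simp add: algebra_simps)
    finally show ?thesis by (simp only: \<delta>_def)
  qed
  moreover have "K > 0" using C3 by (simp add: K_def)
  ultimately show ?thesis by (auto simp: ball_condition_def)
qed

lemma ball_condition_imp_carleson:
  assumes fin: "finite_measure \<mu>" and sets: "sets \<mu> = sets (restrict_space borel unit_disk)"
    and \<alpha>: "\<alpha> > -1" and s: "s \<ge> 1" and ball: "ball_condition \<mu> (s * (2 + \<alpha>))"
  shows "carleson_measure s 1 \<alpha> \<mu>"
proof -
  \<comment> \<open>The pointwise bound turns |f|^(s-1) into this power of 1 - |w|, and with it the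
    embedding lands exactly on the weight \<alpha>.\<close>
  define \<tau> where "\<tau> = - ((2 + \<alpha>) * (s - 1))"
  have exp: "s * (2 + \<alpha>) + \<tau> - 2 = \<alpha>" by (simp add: \<tau>_def algebra_simps)
  obtain C0 where C0: "C0 > 0" "\<And>f. f holomorphic_on unit_disk \<Longrightarrow>
    (\<integral>\<^sup>+w. ennreal (cmod (f w) powr 1 * (1 - cmod w) powr \<tau>) \<partial>\<mu>) \<le> ennreal C0 * disk_integral 1 \<alpha> f"
    using ball_condition_embedding[OF fin sets ball, of 1 \<tau>] unfolding exp by auto
  define C1 where "C1 = 16 * 4 powr (1 / 1) / pi * 2 powr \<bar>\<alpha>\<bar>"
  define C2 where "C2 = pi * 2 powr \<bar>\<alpha>\<bar> / (1 + \<alpha>)"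
  have C12: "C1 > 0" "C2 > 0" using \<alpha> by (auto simp: C1_def C2_def)
  define C where "C = ((C1 * C2) powr (s - 1) * (C0 * C2)) powr (1 / s)"
  have "ennreal_powr (\<integral>\<^sup>+ w. ennreal (cmod (f w) powr s) \<partial>\<mu>) (1 / s) \<le> ennreal C * bergman_norm 1 \<alpha> f"
    if f: "f \<in> bergman_space 1 \<alpha>" for f
  proof -
    have hol: "f holomorphic_on unit_disk" using f by (simp add: bergman_space_def)
    have "bergman_integral 1 \<alpha> f \<noteq> top"
      using f by (auto simp: bergman_space_def bergman_norm_eq ennreal_powr_def)
    then obtain N where N: "bergman_integral 1 \<alpha> f = ennreal N" "N \<ge> 0"
      by (cases "bergman_integral 1 \<alpha> f") auto
    then have norm: "bergman_norm 1 \<alpha> f = ennreal N"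
      by (simp add: bergman_norm_eq ennreal_powr_ennreal)
    have "disk_integral 1 \<alpha> f \<le> ennreal C2 * bergman_integral 1 \<alpha> f"
      unfolding C2_def by (intro bergman_integral_compare \<alpha> set_borel_measurable_holomorphic[OF hol]) simp
    then have D: "disk_integral 1 \<alpha> f \<le> ennreal (C2 * N)"
      using N C12 by (simp add: ennreal_mult)
    have pt: "cmod (f w) * (1 - cmod w) powr (2 + \<alpha>) \<le> C1 * C2 * N" if w: "cmod w < 1" for w
    proof -
      have "ennreal (cmod (f w) powr 1 * (1 - cmod w) powr (2 + \<alpha>)) \<le> ennreal C1 * disk_integral 1 \<alpha> f"
        unfolding C1_def by (rule pointwise_bound_disk[OF hol w]) auto
      also have "\<dots> \<le> ennreal C1 * ennreal (C2 * N)" by (intro mult_left_mono D) simp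
      also have "\<dots> = ennreal (C1 * C2 * N)"
        using C12 N by (simp add: mult.assoc flip: ennreal_mult)
      finally show ?thesis using C12 N by (subst (asm) ennreal_le_iff) auto
    qed
    have le: "cmod (f w) powr s \<le> (C1 * C2 * N) powr (s - 1) * (cmod (f w) powr 1 * (1 - cmod w) powr \<tau>)"
      if w: "cmod w < 1" for w
    proof (cases "f w = 0")
      case False
      have "(cmod (f w) * (1 - cmod w) powr (2 + \<alpha>)) powr (s - 1) \<le> (C1 * C2 * N) powr (s - 1)"
        using s by (intro powr_mono2 pt w) auto
      then have "(cmod (f w) * (1 - cmod w) powr (2 + \<alpha>)) powr (s - 1) * (cmod (f w) powr 1 * (1 - cmod w) powr \<tau>)
          \<le> (C1 * C2 * N) powr (s - 1) * (cmod (f w) powr 1 * (1 - cmod w) powr \<tau>)"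
        by (rule mult_right_mono) simp
      moreover have "(cmod (f w) * (1 - cmod w) powr (2 + \<alpha>)) powr (s - 1) * (cmod (f w) powr 1 * (1 - cmod w) powr \<tau>)
          = (cmod (f w) powr (s - 1) * cmod (f w) powr 1) * ((1 - cmod w) powr ((2 + \<alpha>) * (s - 1)) * (1 - cmod w) powr \<tau>)"
        by (simp add: powr_mult powr_powr)
      moreover have "cmod (f w) powr (s - 1) * cmod (f w) powr 1 = cmod (f w) powr s"
        by (subst powr_add[symmetric]) simp
      moreover have "(1 - cmod w) powr ((2 + \<alpha>) * (s - 1)) * (1 - cmod w) powr \<tau> = 1"
        using w by (subst powr_add[symmetric]) (simp add: \<tau>_def)
      ultimately show ?thesis by (simp only: mult_1_right)
    qed simp
    let ?g = "\<lambda>w. ennreal (cmod (f w) powr 1 * (1 - cmod w) powr \<tau>)"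
    have mg: "?g \<in> borel_measurable \<mu>"
    proof -
      have [measurable]: "f \<in> borel_measurable \<mu>"
        by (rule measurable_disk_fun[OF sets holomorphic_on_imp_continuous_on[OF hol]])
      have [measurable]: "(\<lambda>w. w) \<in> borel_measurable \<mu>" by (rule measurable_disk_id[OF sets])
      show ?thesis by measurable
    qed
    have "(\<integral>\<^sup>+ w. ennreal (cmod (f w) powr s) \<partial>\<mu>) \<le> (\<integral>\<^sup>+ w. ennreal ((C1 * C2 * N) powr (s - 1)) * ?g w \<partial>\<mu>)"
    proof (rule nn_integral_mono)
      fix w assume "w \<in> space \<mu>"
      then have "cmod w < 1" by (simp add: space_disk[OF sets])
      then show "ennreal (cmod (f w) powr s) \<le> ennreal ((C1 * C2 * N) powr (s - 1)) * ?g w"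
        using le[of w] by (subst ennreal_mult[symmetric]) (auto intro!: ennreal_leI)
    qed
    also have "\<dots> = ennreal ((C1 * C2 * N) powr (s - 1)) * (\<integral>\<^sup>+ w. ?g w \<partial>\<mu>)"
      by (rule nn_integral_cmult[OF mg])
    also have "\<dots> \<le> ennreal ((C1 * C2 * N) powr (s - 1)) * (ennreal C0 * ennreal (C2 * N))"
      by (intro mult_left_mono order_trans[OF C0(2)[OF hol]] D) auto
    also have "\<dots> = ennreal ((C1 * C2 * N) powr (s - 1) * (C0 * (C2 * N)))"
      using C0 C12 N by (simp flip: ennreal_mult)
    also have "(C1 * C2 * N) powr (s - 1) * (C0 * (C2 * N))
        = (C1 * C2) powr (s - 1) * (C0 * C2) * (N powr (s - 1) * N powr 1)"
      using C12 N by (simp add: powr_mult)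
    also have "N powr (s - 1) * N powr 1 = N powr s"
      by (subst powr_add[symmetric]) simp
    finally have "ennreal_powr (\<integral>\<^sup>+ w. ennreal (cmod (f w) powr s) \<partial>\<mu>) (1 / s)
        \<le> ennreal (((C1 * C2) powr (s - 1) * (C0 * C2) * N powr s) powr (1 / s))"
      using s C0 C12 by (intro ennreal_powr_leI) auto
    also have "((C1 * C2) powr (s - 1) * (C0 * C2) * N powr s) powr (1 / s) = C * N"
      using s N C0 C12 by (simp add: C_def powr_mult powr_powr)
    finally show ?thesis
      using N by (simp add: norm C_def ennreal_mult)
  qed
  moreover have "C > 0" using C0 C12 by (simp add: C_def)
  ultimately show ?thesis by (auto simp: carleson_measure_def)
qed

subsection \<open>Sufficiency\<close>

text \<open>For z, w in the disk the argument of the power stays in the right half-plane, where the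
  principal branch is continuous. Cutting it off outside gives a Borel function on the whole plane,
  so that the Toeplitz integrand becomes jointly measurable.\<close>

lemma powr_right_half_plane_measurable:
  obtains \<phi> where "\<phi> \<in> borel_measurable borel" "\<And>u. 0 < Re u \<Longrightarrow> \<phi> u = u powr complex_of_real c"
proof
  let ?\<phi> = "\<lambda>u. indicator {u. 0 < Re u} u *\<^sub>R (u powr complex_of_real c)"
  have "open {u. 0 < Re u}" by (rule open_halfspace_Re_gt)
  moreover have "continuous_on {u. 0 < Re u} (\<lambda>u. u powr complex_of_real c)"
    by (intro continuous_intros) (auto simp: complex_nonpos_Reals_iff)
  ultimately show "?\<phi> \<in> borel_measurable borel"
    by (intro borel_measurable_continuous_on_indicator) auto
qed simp

lemma set_borel_measurable_toeplitz:
  assumes fin: "finite_measure \<mu>" and sets: "sets \<mu> = sets (restrict_space borel unit_disk)"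
    and f: "continuous_on unit_disk f"
  shows "(\<lambda>z. indicator unit_disk z *\<^sub>R toeplitz \<mu> \<beta> f z) \<in> borel_measurable borel"
proof -
  interpret finite_measure \<mu> by fact
  obtain \<phi> where \<phi>[measurable]: "\<phi> \<in> borel_measurable borel"
    and \<phi>_eq: "\<And>u. 0 < Re u \<Longrightarrow> \<phi> u = u powr complex_of_real (2 + \<beta>)"
    using powr_right_half_plane_measurable[of "2 + \<beta>"] by blast
  have cnj[measurable]: "cnj \<in> borel_measurable borel"
    by (intro borel_measurable_continuous_onI continuous_intros)
  have f[measurable]: "f \<in> borel_measurable \<mu>" by (rule measurable_disk_fun[OF sets f])
  have id[measurable]: "(\<lambda>w. w) \<in> borel_measurable \<mu>" by (rule measurable_disk_id[OF sets])
  have "(\<lambda>x. snd x) \<in> borel_measurable (borel \<Otimes>\<^sub>M \<mu>)"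
    using measurable_compose[OF measurable_snd id] .
  then have [measurable]: "(\<lambda>x. cnj (snd x)) \<in> borel_measurable ((borel :: complex measure) \<Otimes>\<^sub>M \<mu>)"
    by (rule measurable_compose) (rule cnj)
  have "(\<lambda>x. f (snd x) / \<phi> (1 - fst x * cnj (snd x))) \<in> borel_measurable (borel \<Otimes>\<^sub>M \<mu>)"
    by (intro borel_measurable_divide measurable_compose[OF measurable_snd f] measurable_compose[OF _ \<phi>]) measurable
  then have [measurable]: "(\<lambda>z. \<integral>w. f w / \<phi> (1 - z * cnj w) \<partial>\<mu>) \<in> borel_measurable borel"
    by (intro borel_measurable_lebesgue_integral) (simp add: case_prod_beta)
  have [measurable]: "unit_disk \<in> sets borel" by simp
  have "(\<lambda>z. indicator unit_disk z *\<^sub>R (\<integral>w. f w / \<phi> (1 - z * cnj w) \<partial>\<mu>)) \<in> borel_measurable borel"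
    by measurable
  moreover have "indicator unit_disk z *\<^sub>R (\<integral>w. f w / \<phi> (1 - z * cnj w) \<partial>\<mu>)
      = indicator unit_disk z *\<^sub>R toeplitz \<mu> \<beta> f z" for z
  proof (cases "z \<in> unit_disk")
    case True
    have "(\<integral>w. f w / \<phi> (1 - z * cnj w) \<partial>\<mu>) = toeplitz \<mu> \<beta> f z"
      unfolding toeplitz_def
    proof (rule Bochner_Integration.integral_cong[OF refl])
      fix w assume "w \<in> space \<mu>"
      then have "cmod w < 1" by (simp add: space_disk[OF sets])
      then have "0 < Re (1 - z * cnj w)"
        using Re_disk_kernel_pos[of "cnj z" "cnj w"] True by simp
      then show "f w / \<phi> (1 - z * cnj w) = f w / (1 - z * cnj w) powr complex_of_real (2 + \<beta>)"
        by (simp add: \<phi>_eq)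
    qed
    then show ?thesis by simp
  qed simp
  ultimately show ?thesis by (simp only:)
qed

lemma cmod_disk_kernel_sym: "cmod (1 - z * cnj w) = cmod (1 - cnj z * w)" "cmod (1 - cnj w * z) = cmod (1 - cnj z * w)"
proof -
  have "1 - z * cnj w = cnj (1 - cnj z * w)" by simp
  then show "cmod (1 - z * cnj w) = cmod (1 - cnj z * w)" by (metis complex_mod_cnj)
  then show "cmod (1 - cnj w * z) = cmod (1 - cnj z * w)" by (simp add: mult.commute)
qed

lemma norm_toeplitz_le:
  "ennreal (cmod (toeplitz \<mu> \<beta> f z))
    \<le> (\<integral>\<^sup>+w. ennreal (cmod (f w) * cmod (1 - cnj z * w) powr (- (2 + \<beta>))) \<partial>\<mu>)"
proof (cases "integrable \<mu> (\<lambda>w. f w / (1 - z * cnj w) powr complex_of_real (2 + \<beta>))")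
  case True
  have "ennreal (cmod (toeplitz \<mu> \<beta> f z)) \<le> (\<integral>\<^sup>+w. norm (f w / (1 - z * cnj w) powr complex_of_real (2 + \<beta>)) \<partial>\<mu>)"
    unfolding toeplitz_def by (rule integral_norm_bound_ennreal[OF True])
  also have "\<dots> = (\<integral>\<^sup>+w. ennreal (cmod (f w) * cmod (1 - cnj z * w) powr (- (2 + \<beta>))) \<partial>\<mu>)"
    by (simp only: divide_inverse norm_mult norm_inverse cmod_powr_of_real cmod_disk_kernel_sym(1) powr_minus)
  finally show ?thesis .
next
  \<comment> \<open>A divergent Bochner integral has the value 0, and the bound is trivial.\<close>
  case False
  then show ?thesis by (simp add: toeplitz_def not_integrable_integral_eq)
qed

text \<open>Above the level \<open>A\<close> one has x = x^q x^(1-q) \<le> x^q A^(1-q). Integrated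
  with a well chosen \<open>A\<close>, this linear inequality takes the place of Jensen's and
  Hoelder's inequalities.\<close>

lemma le_add_powr:
  fixes x A q :: real
  assumes "x \<ge> 0" "A > 0" "q > 1"
  shows "x \<le> A + A powr (1 - q) * x powr q"
proof (cases "x \<le> A")
  case False
  then have "x = x powr q * x powr (1 - q)" using assms by (subst powr_add[symmetric]) simp
  also have "\<dots> \<le> x powr q * A powr (1 - q)"
    using False assms by (intro mult_left_mono powr_mono2') auto
  finally show ?thesis using assms by (simp add: mult.commute)
qed (use assms in \<open>simp add: add_increasing2\<close>)

text \<open>A substitute for Jensen's inequality that avoids the division by the total mass.\<close>

lemma nn_integral_powr_le:
  fixes k :: "'a \<Rightarrow> real" and \<nu> :: "'a \<Rightarrow> ennreal"
  assumes [measurable]: "\<nu> \<in> borel_measurable M" "k \<in> borel_measurable M" and k: "\<And>x. k x \<ge> 0"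
    and \<nu>: "(\<integral>\<^sup>+x. \<nu> x \<partial>M) \<le> ennreal l" and l: "l > 0" and q: "q > 1"
    and x: "ennreal x \<le> (\<integral>\<^sup>+x. \<nu> x * ennreal (k x) \<partial>M)" "x \<ge> 0"
  shows "ennreal (x powr q) \<le> ennreal (2 powr q * l powr (q - 1)) * (\<integral>\<^sup>+x. \<nu> x * ennreal (k x powr q) \<partial>M)"
proof (cases "(\<integral>\<^sup>+x. \<nu> x * ennreal (k x powr q) \<partial>M)")
  case (real G)
  show ?thesis
  proof (cases "x = 0")
    case False
    \<comment> \<open>With this level the term \<open>A * l\<close> equals x/2 and is absorbed by
      the left-hand side; the halving is the source of \<open>2 powr q\<close>.\<close>
    define A where "A = x / (2 * l)"
    have A: "A > 0" using False x l by (simp add: A_def)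
    have "ennreal x \<le> (\<integral>\<^sup>+x. \<nu> x * ennreal (k x) \<partial>M)" by (rule x)
    also have "\<dots> \<le> (\<integral>\<^sup>+x. ennreal A * \<nu> x + ennreal (A powr (1 - q)) * (\<nu> x * ennreal (k x powr q)) \<partial>M)"
    proof (rule nn_integral_mono)
      fix y
      have "ennreal (k y) \<le> ennreal (A + A powr (1 - q) * k y powr q)"
        by (intro ennreal_leI le_add_powr k A q)
      also have "\<dots> = ennreal A + ennreal (A powr (1 - q)) * ennreal (k y powr q)"
        using A by (simp add: ennreal_mult)
      finally have "\<nu> y * ennreal (k y) \<le> \<nu> y * (ennreal A + ennreal (A powr (1 - q)) * ennreal (k y powr q))"
        by (rule mult_left_mono) simp
      then show "\<nu> y * ennreal (k y) \<le> ennreal A * \<nu> y + ennreal (A powr (1 - q)) * (\<nu> y * ennreal (k y powr q))"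
        by (simp add: distrib_left mult_ac)
    qed
    also have "\<dots> = ennreal A * (\<integral>\<^sup>+x. \<nu> x \<partial>M) + ennreal (A powr (1 - q)) * (\<integral>\<^sup>+x. \<nu> x * ennreal (k x powr q) \<partial>M)"
      by (simp add: nn_integral_add nn_integral_cmult)
    also have "\<dots> \<le> ennreal A * ennreal l + ennreal (A powr (1 - q)) * ennreal G"
      unfolding real by (intro add_mono mult_left_mono \<nu>) auto
    also have "\<dots> = ennreal (A * l + A powr (1 - q) * G)"
      using A l real by (simp add: ennreal_mult)
    finally have "x \<le> A * l + A powr (1 - q) * G"
      using A l real by (subst (asm) ennreal_le_iff) auto
    then have "x / 2 \<le> A powr (1 - q) * G" using l by (simp add: A_def)
    then have "(x / 2) * A powr (q - 1) \<le> A powr (1 - q) * G * A powr (q - 1)"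
      by (rule mult_right_mono) simp
    also have "\<dots> = (A powr (1 - q) * A powr (q - 1)) * G" by simp
    also have "A powr (1 - q) * A powr (q - 1) = 1"
      using A by (subst powr_add[symmetric]) simp
    finally have *: "(x / 2) * A powr (q - 1) \<le> G" by simp
    have "x powr q = 2 powr q * ((x / 2) powr 1 * (x / 2) powr (q - 1))"
      using x False by (subst powr_add[symmetric]) (simp add: powr_divide)
    also have "(x / 2) powr (q - 1) = A powr (q - 1) * l powr (q - 1)"
      using x l by (subst powr_mult[symmetric]) (simp_all add: A_def)
    also have "2 powr q * ((x / 2) powr 1 * (A powr (q - 1) * l powr (q - 1)))
        = (2 powr q * l powr (q - 1)) * ((x / 2) * A powr (q - 1))"
      using x by simp
    also have "\<dots> \<le> (2 powr q * l powr (q - 1)) * G"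
      by (rule mult_left_mono[OF *]) simp
    finally show ?thesis
      using real by (simp add: ennreal_leI flip: ennreal_mult)
  qed simp
next
  case top
  then show ?thesis using l by (simp add: ennreal_mult_top)
qed

text \<open>The integral of \<open>f\<close> enters only through a positive upper bound
  \<open>l\<close>. With e = (1 - p)/p its powers add up to e q from the pointwise bound, q - 1 from
  the Jensen step and 1 from the last integration, that is, to q/p.\<close>

lemma ball_condition_imp_toeplitz_bound:
  assumes fin: "finite_measure \<mu>" and sets: "sets \<mu> = sets (restrict_space borel unit_disk)"
    and p: "0 < p" "p \<le> 1" and q: "1 < q" and qq': "1 / q + 1 / q' = 1"
    and \<beta>: "\<beta> > -1" and ball: "ball_condition \<mu> ((2 + \<alpha>) / p + (2 + \<beta>) / q')"
  obtains C where "C > 0" "\<And>f l. f holomorphic_on unit_disk \<Longrightarrow> l > 0 \<Longrightarrow> disk_integral p \<alpha> f \<le> ennreal l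
    \<Longrightarrow> disk_integral q \<beta> (toeplitz \<mu> \<beta> f) \<le> ennreal (C * l powr (q / p))"
proof -
  define \<gamma> where "\<gamma> = 2 + \<beta>"
  define \<sigma> where "\<sigma> = (2 + \<alpha>) / p + \<gamma> / q'"
  \<comment> \<open>Writing |f| as |f|^p times the power (1 - p)/p of |f|^p, the pointwise bound for
    the second factor contributes this power of 1 - |w|.\<close>
  define \<tau> where "\<tau> = - ((2 + \<alpha>) * ((1 - p) / p))"
  have \<gamma>: "\<gamma> > 1" using \<beta> by (simp add: \<gamma>_def)
  have q': "1 / q' = (q - 1) / q" using qq' q by (simp add: field_simps)
  have gq: "\<gamma> / q' = \<gamma> * ((q - 1) / q)" using q' by (metis divide_inverse inverse_eq_divide)
  have exp: "\<sigma> + \<tau> - 2 = \<alpha> + \<gamma> / q'"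
    using p by (simp add: \<sigma>_def \<tau>_def field_simps)
  obtain C0 where C0: "C0 > 0" "\<And>h. h holomorphic_on unit_disk \<Longrightarrow>
    (\<integral>\<^sup>+w. ennreal (cmod (h w) powr p * (1 - cmod w) powr \<tau>) \<partial>\<mu>) \<le> ennreal C0 * disk_integral p (\<alpha> + \<gamma> / q') h"
    using ball_condition_embedding[OF fin sets ball p, of \<tau>]
    unfolding \<gamma>_def[symmetric] \<sigma>_def[symmetric] exp by blast
  \<comment> \<open>The q-th power of the kernel will be integrated in \<open>z\<close> against the
    weight \<beta>; q > 1 puts its exponent \<gamma> q above 2 + \<beta> = \<gamma>.\<close>
  have "\<gamma> * q * 1 > 2 + \<beta>" using \<gamma> q by (simp flip: \<gamma>_def)
  then obtain C2 where C2: "C2 > 0" "\<And>a. cmod a < 1 \<Longrightarrow>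
    disk_integral 1 \<beta> (\<lambda>w. (1 - cnj a * w) powr complex_of_real (- (\<gamma> * q)))
      \<le> ennreal (C2 * (1 - cmod a) powr (2 + \<beta> - \<gamma> * q * 1))"
    using kernel_disk_integral[OF \<beta>] by blast
  define C1 where "C1 = 16 * 4 powr (1 / p) / pi * 2 powr \<bar>\<alpha>\<bar>"
  have C1: "C1 > 0" by (simp add: C1_def)
  define e where "e = (1 - p) / p"
  define C where "C = (C1 powr e * C0) powr q * 2 powr q * C2"
  have "disk_integral q \<beta> (toeplitz \<mu> \<beta> f) \<le> ennreal (C * l powr (q / p))"
    if hol: "f holomorphic_on unit_disk" and l: "l > 0" and L: "disk_integral p \<alpha> f \<le> ennreal l" for f l
  proof -
    define B where "B = (C1 * l) powr e * C0"
    have B: "B > 0" using C0 C1 l by (simp add: B_def)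
    define \<nu> where "\<nu> \<zeta> = ennreal (cmod (f \<zeta>) powr p * (1 - cmod \<zeta>) powr \<alpha>) * indicator unit_disk \<zeta>" for \<zeta>
    define k where "k z \<zeta> = (1 - cmod \<zeta>) powr (\<gamma> / q') * cmod (1 - cnj z * \<zeta>) powr (- \<gamma>)" for z \<zeta>
    have cnj[measurable]: "cnj \<in> borel_measurable borel"
      by (intro borel_measurable_continuous_onI continuous_intros)
    have \<nu>[measurable]: "\<nu> \<in> borel_measurable borel"
      unfolding \<nu>_def by (rule set_borel_measurable_powr_weight[OF hol])
    have [measurable]: "k z \<in> borel_measurable borel" for z
      unfolding k_def by measurable
    have \<nu>l: "(\<integral>\<^sup>+\<zeta>. \<nu> \<zeta> \<partial>lborel) \<le> ennreal l" using L by (simp add: disk_integral_def \<nu>_def)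
    have pt: "cmod (f w) powr p * (1 - cmod w) powr (2 + \<alpha>) \<le> C1 * l" if w: "cmod w < 1" for w
    proof -
      have "ennreal (cmod (f w) powr p * (1 - cmod w) powr (2 + \<alpha>)) \<le> ennreal C1 * disk_integral p \<alpha> f"
        unfolding C1_def by (rule pointwise_bound_disk[OF hol w p])
      also have "\<dots> \<le> ennreal C1 * ennreal l" by (intro mult_left_mono L) simp
      also have "\<dots> = ennreal (C1 * l)" using C1 l by (simp add: ennreal_mult)
      finally show ?thesis using C1 l by (subst (asm) ennreal_le_iff) auto
    qed
    have fle: "cmod (f w) \<le> (C1 * l) powr e * (cmod (f w) powr p * (1 - cmod w) powr \<tau>)" if w: "cmod w < 1" for w
    proof (cases "f w = 0")
      case False
      have "(cmod (f w) powr p * (1 - cmod w) powr (2 + \<alpha>)) powr e \<le> (C1 * l) powr e"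
        using p by (intro powr_mono2 pt w) (auto simp: e_def)
      then have "(cmod (f w) powr p * (1 - cmod w) powr (2 + \<alpha>)) powr e * (cmod (f w) powr p * (1 - cmod w) powr \<tau>)
          \<le> (C1 * l) powr e * (cmod (f w) powr p * (1 - cmod w) powr \<tau>)"
        by (rule mult_right_mono) simp
      moreover have "(cmod (f w) powr p * (1 - cmod w) powr (2 + \<alpha>)) powr e * (cmod (f w) powr p * (1 - cmod w) powr \<tau>)
          = (cmod (f w) powr (p * e) * cmod (f w) powr p) * ((1 - cmod w) powr ((2 + \<alpha>) * e) * (1 - cmod w) powr \<tau>)"
        by (simp add: powr_mult powr_powr)
      moreover have "cmod (f w) powr (p * e) * cmod (f w) powr p = cmod (f w)"
      proof -
        have "p * e + p = 1" using p by (simp add: e_def)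
        then show ?thesis using False by (subst powr_add[symmetric]) simp
      qed
      moreover have "(1 - cmod w) powr ((2 + \<alpha>) * e) * (1 - cmod w) powr \<tau> = 1"
        using w by (subst powr_add[symmetric]) (simp add: \<tau>_def e_def)
      ultimately show ?thesis by (simp only: mult_1_right)
    qed simp
    \<comment> \<open>Division by \<open>B\<close> gives the form required by
      \<open>nn_integral_powr_le\<close>, where \<nu> is the density of a measure of mass at most
      \<open>l\<close>.\<close>
    have T: "ennreal (cmod (toeplitz \<mu> \<beta> f z) / B) \<le> (\<integral>\<^sup>+\<zeta>. \<nu> \<zeta> * ennreal (k z \<zeta>) \<partial>lborel)" if z: "cmod z < 1" for z
    proof -
      \<comment> \<open>The kernel to the power -\<gamma>/p is attached to \<open>f\<close>, so that
        |h|^p carries the kernel to the power -\<gamma> and the embedding applies to one holomorphic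
        function.\<close>
      define h where "h w = f w * (1 - cnj z * w) powr complex_of_real (- \<gamma> / p)" for w
      have h: "h holomorphic_on unit_disk"
        unfolding h_def by (intro holomorphic_on_mult hol holomorphic_disk_kernel z)
      have hm: "cmod (h w) powr p = cmod (f w) powr p * cmod (1 - cnj z * w) powr (- \<gamma>)" for w
        unfolding h_def norm_mult cmod_powr_of_real using p by (simp add: powr_mult powr_powr)
      let ?g = "\<lambda>w. ennreal (cmod (h w) powr p * (1 - cmod w) powr \<tau>)"
      have mg: "?g \<in> borel_measurable \<mu>"
      proof -
        have [measurable]: "h \<in> borel_measurable \<mu>"
          by (rule measurable_disk_fun[OF sets holomorphic_on_imp_continuous_on[OF h]])
        have [measurable]: "(\<lambda>w. w) \<in> borel_measurable \<mu>" by (rule measurable_disk_id[OF sets])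
        show ?thesis by measurable
      qed
      have "ennreal (cmod (toeplitz \<mu> \<beta> f z)) \<le> (\<integral>\<^sup>+w. ennreal (cmod (f w) * cmod (1 - cnj z * w) powr (- \<gamma>)) \<partial>\<mu>)"
        unfolding \<gamma>_def by (rule norm_toeplitz_le)
      also have "\<dots> \<le> (\<integral>\<^sup>+w. ennreal ((C1 * l) powr e) * ?g w \<partial>\<mu>)"
      proof (rule nn_integral_mono)
        fix w assume "w \<in> space \<mu>"
        then have w: "cmod w < 1" by (simp add: space_disk[OF sets])
        have "cmod (f w) * cmod (1 - cnj z * w) powr (- \<gamma>)
            \<le> (C1 * l) powr e * (cmod (f w) powr p * (1 - cmod w) powr \<tau>) * cmod (1 - cnj z * w) powr (- \<gamma>)"
          by (intro mult_right_mono fle w) simp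
        also have "\<dots> = (C1 * l) powr e * (cmod (h w) powr p * (1 - cmod w) powr \<tau>)"
          by (simp only: hm mult_ac)
        finally show "ennreal (cmod (f w) * cmod (1 - cnj z * w) powr (- \<gamma>)) \<le> ennreal ((C1 * l) powr e) * ?g w"
          by (subst ennreal_mult[symmetric]) (auto intro!: ennreal_leI)
      qed
      also have "\<dots> = ennreal ((C1 * l) powr e) * (\<integral>\<^sup>+w. ?g w \<partial>\<mu>)"
        by (rule nn_integral_cmult[OF mg])
      also have "\<dots> \<le> ennreal ((C1 * l) powr e) * (ennreal C0 * disk_integral p (\<alpha> + \<gamma> / q') h)"
        by (intro mult_left_mono C0(2) h) simp
      also have "\<dots> = ennreal B * disk_integral p (\<alpha> + \<gamma> / q') h"
        using C0 by (simp add: B_def ennreal_mult mult.assoc)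
      also have "disk_integral p (\<alpha> + \<gamma> / q') h = (\<integral>\<^sup>+\<zeta>. \<nu> \<zeta> * ennreal (k z \<zeta>) \<partial>lborel)"
        unfolding disk_integral_def
      proof (rule nn_integral_cong)
        fix \<zeta>
        have "cmod (h \<zeta>) powr p * (1 - cmod \<zeta>) powr (\<alpha> + \<gamma> / q')
            = cmod (f \<zeta>) powr p * (1 - cmod \<zeta>) powr \<alpha> * k z \<zeta>"
          by (simp add: hm k_def powr_add)
        moreover have "k z \<zeta> \<ge> 0" by (simp add: k_def)
        ultimately show "ennreal (cmod (h \<zeta>) powr p * (1 - cmod \<zeta>) powr (\<alpha> + \<gamma> / q')) * indicator unit_disk \<zeta>
            = \<nu> \<zeta> * ennreal (k z \<zeta>)"
          unfolding \<nu>_def by (simp add: ennreal_mult mult_ac)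
      qed
      finally have "ennreal (1 / B) * ennreal (cmod (toeplitz \<mu> \<beta> f z))
          \<le> ennreal (1 / B) * (ennreal B * (\<integral>\<^sup>+\<zeta>. \<nu> \<zeta> * ennreal (k z \<zeta>) \<partial>lborel))"
        by (rule mult_left_mono) simp
      also have "ennreal (1 / B) * (ennreal B * X) = X" for X
        using B by (simp add: mult.assoc[symmetric] flip: ennreal_mult)
      finally show ?thesis using B by (simp flip: ennreal_mult)
    qed
    have T2: "ennreal (cmod (toeplitz \<mu> \<beta> f z) powr q)
        \<le> ennreal (B powr q * (2 powr q * l powr (q - 1))) * (\<integral>\<^sup>+\<zeta>. \<nu> \<zeta> * ennreal (k z \<zeta> powr q) \<partial>lborel)"
      if z: "cmod z < 1" for z
    proof -
      have "ennreal (B powr q) * ennreal ((cmod (toeplitz \<mu> \<beta> f z) / B) powr q)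
        \<le> ennreal (B powr q) * (ennreal (2 powr q * l powr (q - 1)) * (\<integral>\<^sup>+\<zeta>. \<nu> \<zeta> * ennreal (k z \<zeta> powr q) \<partial>lborel))"
        using B by (intro mult_left_mono nn_integral_powr_le[OF _ _ _ \<nu>l l q T[OF z]]) (auto simp: k_def)
      moreover have "ennreal (B powr q) * ennreal ((cmod (toeplitz \<mu> \<beta> f z) / B) powr q) = ennreal (cmod (toeplitz \<mu> \<beta> f z) powr q)"
        using B by (simp add: powr_divide flip: ennreal_mult)
      ultimately show ?thesis by (simp add: ennreal_mult mult.assoc)
    qed
    let ?D = "B powr q * (2 powr q * l powr (q - 1))"
    define u where "u z = ennreal ((1 - cmod z) powr \<beta>) * indicator unit_disk z" for z :: complex
    have [measurable]: "unit_disk \<in> sets borel" by simp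
    have u[measurable]: "u \<in> borel_measurable borel" unfolding u_def by measurable
    have meas: "(\<lambda>(z, \<zeta>). u z * (\<nu> \<zeta> * ennreal (k z \<zeta> powr q))) \<in> borel_measurable (lborel \<Otimes>\<^sub>M lborel)"
      unfolding case_prod_beta k_def by measurable
    have "disk_integral q \<beta> (toeplitz \<mu> \<beta> f) \<le> (\<integral>\<^sup>+z. ennreal ?D * (\<integral>\<^sup>+\<zeta>. u z * (\<nu> \<zeta> * ennreal (k z \<zeta> powr q)) \<partial>lborel) \<partial>lborel)"
      unfolding disk_integral_def
    proof (rule nn_integral_mono)
      fix z
      have "(\<integral>\<^sup>+\<zeta>. u z * (\<nu> \<zeta> * ennreal (k z \<zeta> powr q)) \<partial>lborel) = u z * (\<integral>\<^sup>+\<zeta>. \<nu> \<zeta> * ennreal (k z \<zeta> powr q) \<partial>lborel)"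
        by (rule nn_integral_cmult) simp
      moreover have "ennreal (cmod (toeplitz \<mu> \<beta> f z) powr q * (1 - cmod z) powr \<beta>) * indicator unit_disk z
          \<le> ennreal ?D * (u z * (\<integral>\<^sup>+\<zeta>. \<nu> \<zeta> * ennreal (k z \<zeta> powr q) \<partial>lborel))"
      proof (cases "z \<in> unit_disk")
        case True
        then have "ennreal (cmod (toeplitz \<mu> \<beta> f z) powr q * (1 - cmod z) powr \<beta>) * indicator unit_disk z
            = ennreal (cmod (toeplitz \<mu> \<beta> f z) powr q) * u z"
          by (simp add: u_def ennreal_mult)
        also have "\<dots> \<le> (ennreal ?D * (\<integral>\<^sup>+\<zeta>. \<nu> \<zeta> * ennreal (k z \<zeta> powr q) \<partial>lborel)) * u z"
          using True by (intro mult_right_mono T2) auto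
        finally show ?thesis by (simp only: mult_ac)
      qed simp
      ultimately show "ennreal (cmod (toeplitz \<mu> \<beta> f z) powr q * (1 - cmod z) powr \<beta>) * indicator unit_disk z
          \<le> ennreal ?D * (\<integral>\<^sup>+\<zeta>. u z * (\<nu> \<zeta> * ennreal (k z \<zeta> powr q)) \<partial>lborel)"
        by simp
    qed
    also have "\<dots> = ennreal ?D * (\<integral>\<^sup>+z. \<integral>\<^sup>+\<zeta>. u z * (\<nu> \<zeta> * ennreal (k z \<zeta> powr q)) \<partial>lborel \<partial>lborel)"
      by (rule nn_integral_cmult) (use lborel.borel_measurable_nn_integral[OF meas] in simp)
    also have "(\<integral>\<^sup>+z. \<integral>\<^sup>+\<zeta>. u z * (\<nu> \<zeta> * ennreal (k z \<zeta> powr q)) \<partial>lborel \<partial>lborel)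
        = (\<integral>\<^sup>+\<zeta>. \<integral>\<^sup>+z. u z * (\<nu> \<zeta> * ennreal (k z \<zeta> powr q)) \<partial>lborel \<partial>lborel)"
      by (rule lborel_pair.Fubini'[symmetric, OF meas])
    \<comment> \<open>The factor (1 - |\<zeta>|)^(\<gamma> (q - 1)) contained in the q-th power of
      \<open>k\<close> exactly cancels the Forelli--Rudin growth (1 - |\<zeta>|)^(2 + \<beta> -
      \<gamma> q), so the integral over \<open>z\<close> is bounded uniformly in \<zeta>.\<close>
    also have "\<dots> \<le> (\<integral>\<^sup>+\<zeta>. ennreal C2 * \<nu> \<zeta> \<partial>lborel)"
    proof (rule nn_integral_mono)
      fix \<zeta>
      show "(\<integral>\<^sup>+z. u z * (\<nu> \<zeta> * ennreal (k z \<zeta> powr q)) \<partial>lborel) \<le> ennreal C2 * \<nu> \<zeta>"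
      proof (cases "\<zeta> \<in> unit_disk")
        case True
        then have \<zeta>: "cmod \<zeta> < 1" by simp
        let ?s = "(1 - cmod \<zeta>) powr (\<gamma> * (q - 1))"
        let ?j = "\<lambda>z. ennreal (cmod ((1 - cnj \<zeta> * z) powr complex_of_real (- (\<gamma> * q))) powr 1 * (1 - cmod z) powr \<beta>) * indicator unit_disk z"
        have kq: "k z \<zeta> powr q = ?s * cmod ((1 - cnj \<zeta> * z) powr complex_of_real (- (\<gamma> * q)))" for z
        proof -
          have "\<gamma> / q' * q = \<gamma> * (q - 1)" using gq q by simp
          then show ?thesis
            unfolding k_def cmod_powr_of_real cmod_disk_kernel_sym(2)[of \<zeta> z]
            using \<zeta> by (simp add: powr_mult powr_powr)
        qed
        have "u z * (\<nu> \<zeta> * ennreal (k z \<zeta> powr q)) = (\<nu> \<zeta> * ennreal ?s) * ?j z" for z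
          unfolding kq u_def by (simp add: ennreal_mult mult_ac)
        then have "(\<integral>\<^sup>+z. u z * (\<nu> \<zeta> * ennreal (k z \<zeta> powr q)) \<partial>lborel) = (\<integral>\<^sup>+z. (\<nu> \<zeta> * ennreal ?s) * ?j z \<partial>lborel)"
          by (simp only:)
        also have "\<dots> = (\<nu> \<zeta> * ennreal ?s) * disk_integral 1 \<beta> (\<lambda>w. (1 - cnj \<zeta> * w) powr complex_of_real (- (\<gamma> * q)))"
          unfolding disk_integral_def
          by (rule nn_integral_cmult)
            (use set_borel_measurable_powr_weight[OF holomorphic_disk_kernel[OF \<zeta>], of "- (\<gamma> * q)" 1 \<beta>] in \<open>simp only: measurable_lborel2\<close>)
        also have "\<dots> \<le> (\<nu> \<zeta> * ennreal ?s) * ennreal (C2 * (1 - cmod \<zeta>) powr (2 + \<beta> - \<gamma> * q * 1))"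
          by (intro mult_left_mono C2(2) \<zeta>) simp
        also have "\<dots> = \<nu> \<zeta> * ennreal (C2 * (?s * (1 - cmod \<zeta>) powr (2 + \<beta> - \<gamma> * q * 1)))"
          using C2(1) by (simp add: ennreal_mult mult_ac)
        also have "?s * (1 - cmod \<zeta>) powr (2 + \<beta> - \<gamma> * q * 1) = 1"
          using \<zeta> by (subst powr_add[symmetric]) (simp add: \<gamma>_def algebra_simps)
        finally show ?thesis by (simp add: mult.commute)
      next
        case False
        then show ?thesis by (simp add: \<nu>_def)
      qed
    qed
    also have "\<dots> = ennreal C2 * (\<integral>\<^sup>+\<zeta>. \<nu> \<zeta> \<partial>lborel)" by (rule nn_integral_cmult) simp
    also have "\<dots> \<le> ennreal C2 * ennreal l" by (intro mult_left_mono \<nu>l) simp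
    finally have "disk_integral q \<beta> (toeplitz \<mu> \<beta> f) \<le> ennreal ?D * (ennreal C2 * ennreal l)"
      by (simp add: mult_left_mono)
    also have "\<dots> = ennreal (?D * (C2 * l))" using C2 l by (simp flip: ennreal_mult)
    also have "?D * (C2 * l) = C * (l powr (e * q) * (l powr (q - 1) * l powr 1))"
      using C0 C1 l by (simp add: B_def C_def powr_mult powr_powr)
    also have "l powr (e * q) * (l powr (q - 1) * l powr 1) = l powr (q / p)"
    proof -
      have "e * q + (q - 1 + 1) = q / p" using p by (simp add: e_def field_simps)
      then show ?thesis by (simp only: powr_add[symmetric])
    qed
    finally show ?thesis .
  qed
  moreover have "C > 0" using C0 C1 C2 by (simp add: C_def)
  ultimately show ?thesis using that by blast
qed

lemma ball_condition_imp_toeplitz_bounded: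
  assumes fin: "finite_measure \<mu>" and sets: "sets \<mu> = sets (restrict_space borel unit_disk)"
    and p: "0 < p" "p \<le> 1" and q: "1 < q" and qq': "1 / q + 1 / q' = 1"
    and \<alpha>: "\<alpha> > -1" and \<beta>: "\<beta> > -1" and ball: "ball_condition \<mu> ((2 + \<alpha>) / p + (2 + \<beta>) / q')"
  shows "toeplitz_bounded \<mu> p \<alpha> q \<beta>"
proof -
  obtain C0 where C0: "C0 > 0" "\<And>f l. f holomorphic_on unit_disk \<Longrightarrow> l > 0 \<Longrightarrow> disk_integral p \<alpha> f \<le> ennreal l
    \<Longrightarrow> disk_integral q \<beta> (toeplitz \<mu> \<beta> f) \<le> ennreal (C0 * l powr (q / p))"
    using ball_condition_imp_toeplitz_bound[OF fin sets p q qq' \<beta> ball] by blast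
  define C1 where "C1 = pi * 2 powr \<bar>\<alpha>\<bar> / (1 + \<alpha>)"
  define C2 where "C2 = (1 + \<beta>) * 2 powr \<bar>\<beta>\<bar> / pi"
  have C12: "C1 > 0" "C2 > 0" using \<alpha> \<beta> by (auto simp: C1_def C2_def)
  define C where "C = (C2 * (C0 * C1 powr (q / p))) powr (1 / q)"
  have "bergman_norm q \<beta> (toeplitz \<mu> \<beta> (poly P)) \<le> ennreal C * bergman_norm p \<alpha> (poly P)" for P
  proof -
    have hol: "poly P holomorphic_on unit_disk" by (intro holomorphic_intros)
    have cont: "continuous_on unit_disk (poly P)" by (intro continuous_intros)
    consider "bergman_integral p \<alpha> (poly P) = top" | "bergman_integral p \<alpha> (poly P) = 0"
      | N where "bergman_integral p \<alpha> (poly P) = ennreal N" "N > 0"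
      by (cases "bergman_integral p \<alpha> (poly P)") (auto simp: less_le)
    then show ?thesis
    proof cases
      case 1
      \<comment> \<open>In \<open>ennreal\<close> the product of 0 and \<open>top\<close> is 0, so
        an infinite right-hand side requires a positive constant.\<close>
      moreover have "C > 0" using C0 C12 by (simp add: C_def)
      ultimately show ?thesis
        by (simp add: bergman_norm_eq[of p] ennreal_powr_def ennreal_mult_top)
    next
      case 2
      \<comment> \<open>The bound obtained before asks for \<open>l > 0\<close>. For norm 0 the
        pointwise estimate makes the polynomial vanish on the disk, which is the whole space of
        \<mu>.\<close>
      have "disk_integral p \<alpha> (poly P) \<le> ennreal C1 * bergman_integral p \<alpha> (poly P)"
        unfolding C1_def by (intro bergman_integral_compare \<alpha> set_borel_measurable_holomorphic[OF hol]) simp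
      then have D: "disk_integral p \<alpha> (poly P) = 0" using 2 by simp
      have z: "poly P w = 0" if "cmod w < 1" for w
        using pointwise_bound_disk[OF hol that p, of \<alpha>] that unfolding D by (auto simp: ennreal_eq_0_iff mult_le_0_iff not_less)
      have "toeplitz \<mu> \<beta> (poly P) = (\<lambda>_. 0)"
      proof
        fix x
        have "toeplitz \<mu> \<beta> (poly P) x = (\<integral>w. 0 \<partial>\<mu>)"
          unfolding toeplitz_def
          by (rule Bochner_Integration.integral_cong) (auto simp: z space_disk[OF sets])
        then show "toeplitz \<mu> \<beta> (poly P) x = 0" by simp
      qed
      then show ?thesis using q by (simp add: bergman_norm_eq bergman_integral_def ennreal_powr_def)
    next
      case (3 N)
      have "disk_integral p \<alpha> (poly P) \<le> ennreal C1 * bergman_integral p \<alpha> (poly P)"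
        unfolding C1_def by (intro bergman_integral_compare \<alpha> set_borel_measurable_holomorphic[OF hol]) simp
      then have D: "disk_integral p \<alpha> (poly P) \<le> ennreal (C1 * N)"
        using 3 C12 by (simp add: ennreal_mult)
      have "bergman_integral q \<beta> (toeplitz \<mu> \<beta> (poly P)) \<le> ennreal C2 * disk_integral q \<beta> (toeplitz \<mu> \<beta> (poly P))"
        unfolding C2_def by (intro bergman_integral_compare \<beta> set_borel_measurable_toeplitz fin sets cont)
      also have "\<dots> \<le> ennreal C2 * ennreal (C0 * (C1 * N) powr (q / p))"
        using C12 3 by (intro mult_left_mono C0(2) hol D) auto
      also have "\<dots> = ennreal (C2 * (C0 * C1 powr (q / p)) * N powr (q / p))"
        using C12 C0 3 by (simp add: powr_mult mult_ac flip: ennreal_mult)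
      finally have "bergman_norm q \<beta> (toeplitz \<mu> \<beta> (poly P))
          \<le> ennreal ((C2 * (C0 * C1 powr (q / p)) * N powr (q / p)) powr (1 / q))"
        unfolding bergman_norm_eq using C12 C0 q by (intro ennreal_powr_leI) auto
      also have "(C2 * (C0 * C1 powr (q / p)) * N powr (q / p)) powr (1 / q) = C * N powr (1 / p)"
        using C12 C0 3 q p by (simp add: C_def powr_mult powr_powr)
      also have "ennreal (C * N powr (1 / p)) = ennreal C * bergman_norm p \<alpha> (poly P)"
        using 3 by (simp add: bergman_norm_eq ennreal_powr_ennreal C_def ennreal_mult)
      finally show ?thesis .
    qed
  qed
  moreover have "C \<ge> 0" by (simp add: C_def)
  ultimately show ?thesis unfolding toeplitz_bounded_def by blast
qed

subsection \<open>Necessity\<close>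

text \<open>A radius of convergence above 1 makes the Taylor polynomials converge uniformly on the
  closed unit disk. Boundedness of the operator speaks of polynomials only, and the test function is
  not one.\<close>

lemma polynomial_approximation:
  assumes hol: "f holomorphic_on ball 0 R" and R: "R > 1" and \<epsilon>: "\<epsilon> > 0"
  obtains P where "\<And>w. cmod w < 1 \<Longrightarrow> cmod (poly P w - f w) < \<epsilon>"
proof -
  define c where "c n = (deriv ^^ n) f 0 / fact n" for n
  have ser: "(\<lambda>n. c n * w ^ n) sums f w" if "cmod w < R" for w
    using holomorphic_power_series[OF hol, of w] that by (simp add: c_def)
  obtain \<rho> where \<rho>: "1 < \<rho>" "\<rho> < R" using R dense by blast
  have "summable (\<lambda>n. c n * complex_of_real \<rho> ^ n)"
    using ser[of "complex_of_real \<rho>"] \<rho> by (auto simp: sums_iff)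
  then have "ereal (norm (complex_of_real \<rho>)) \<le> conv_radius c"
    by (rule conv_radius_geI)
  moreover have "ereal 1 < ereal (norm (complex_of_real \<rho>))" using \<rho> by simp
  ultimately have "ereal 1 < conv_radius c" by (rule less_le_trans[rotated])
  then have "uniform_limit (cball 0 1) (\<lambda>n x. \<Sum>i<n. c i * (x - 0) ^ i) (\<lambda>x. suminf (\<lambda>i. c i * (x - 0) ^ i)) sequentially"
    by (rule powser_uniform_limit)
  then have "\<forall>\<^sub>F n in sequentially. \<forall>x\<in>cball 0 1. dist (\<Sum>i<n. c i * x ^ i) (\<Sum>i. c i * x ^ i) < \<epsilon>"
    using \<epsilon> by (simp add: uniform_limit_iff)
  then obtain n where n: "\<forall>x\<in>cball 0 1. dist (\<Sum>i<n. c i * x ^ i) (\<Sum>i. c i * x ^ i) < \<epsilon>"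
    unfolding eventually_sequentially by blast
  define P where "P = (\<Sum>i<n. monom (c i) i)"
  have P: "poly P x = (\<Sum>i<n. c i * x ^ i)" for x
    by (simp add: P_def poly_sum poly_monom)
  have "cmod (poly P w - f w) < \<epsilon>" if "cmod w < 1" for w
    using bspec[OF n, of w] ser[of w] that R by (simp add: P dist_norm sums_iff)
  then show ?thesis using that by blast
qed

lemma higher_deriv_kernel:
  assumes c: "cmod c < 1" and z: "cmod z < 1"
  shows "(deriv ^^ k) (\<lambda>z. (1 - z * c) powr (- complex_of_real \<gamma>)) z
    = pochhammer (complex_of_real \<gamma>) k * c ^ k * (1 - z * c) powr (- complex_of_real \<gamma> - of_nat k)"
  using z
proof (induction k arbitrary: z)
  case (Suc k)
  let ?F = "\<lambda>z. pochhammer (complex_of_real \<gamma>) k * c ^ k * (1 - z * c) powr (- complex_of_real \<gamma> - of_nat k)"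
  have "0 < Re (1 - z * c)"
    using Re_disk_kernel_pos[of "cnj z" c] c Suc.prems by simp
  then have "1 - z * c \<notin> \<real>\<^sub>\<le>\<^sub>0" by (auto simp: complex_nonpos_Reals_iff)
  then have "(?F has_field_derivative pochhammer (complex_of_real \<gamma>) k * c ^ k *
      ((- complex_of_real \<gamma> - of_nat k) * (1 - z * c) powr (- complex_of_real \<gamma> - of_nat k - 1) * (- c))) (at z)"
    by (auto intro!: derivative_eq_intros)
  \<comment> \<open>The induction hypothesis identifies the k-th derivative only on the unit disk,
    which is an open neighbourhood of \<open>z\<close>.\<close>
  then have "((deriv ^^ k) (\<lambda>z. (1 - z * c) powr (- complex_of_real \<gamma>)) has_field_derivative
      pochhammer (complex_of_real \<gamma>) k * c ^ k *
      ((- complex_of_real \<gamma> - of_nat k) * (1 - z * c) powr (- complex_of_real \<gamma> - of_nat k - 1) * (- c))) (at z)"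
    by (rule has_field_derivative_transform_within_open[of _ _ _ unit_disk]) (use Suc in auto)
  then have "(deriv ^^ Suc k) (\<lambda>z. (1 - z * c) powr (- complex_of_real \<gamma>)) z
      = pochhammer (complex_of_real \<gamma>) k * c ^ k *
      ((- complex_of_real \<gamma> - of_nat k) * (1 - z * c) powr (- complex_of_real \<gamma> - of_nat k - 1) * (- c))"
    by (simp add: DERIV_imp_deriv)
  also have "- complex_of_real \<gamma> - of_nat k - 1 = - complex_of_real \<gamma> - of_nat (Suc k)" by simp
  finally show ?case by (simp add: pochhammer_Suc algebra_simps)
qed simp

text \<open>Fubini's theorem reduces the claim to a single \<open>w\<close>, where
  \<open>area_taylor\<close> applies to the kernel as a function of \<open>z\<close>. Its k-th
  derivative brings down \<open>cnj w ^ k\<close>, the origin of the factor w^k in the test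
  function.\<close>

lemma toeplitz_area_coefficient:
  assumes fin: "finite_measure \<mu>" and sets: "sets \<mu> = sets (restrict_space borel unit_disk)"
    and r: "0 < r" "r < 1 - cmod a" and \<beta>: "\<beta> > -2"
    and f: "continuous_on unit_disk f" and F: "\<And>w. cmod w < 1 \<Longrightarrow> cmod (f w) \<le> F"
  shows "(LINT z:ball a r|lborel. cnj (z - a) ^ k * toeplitz \<mu> \<beta> f z)
    = pochhammer (complex_of_real (2 + \<beta>)) k / fact k * complex_of_real (LINT z:ball (0::complex) r|lborel. cmod z ^ (2 * k))
      * (\<integral>w. f w * cnj w ^ k * (1 - a * cnj w) powr (- complex_of_real (2 + \<beta>) - of_nat k) \<partial>\<mu>)"
proof -
  interpret finite_measure \<mu> by fact
  interpret pair_sigma_finite \<mu> "lborel :: complex measure" ..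
  define \<gamma> where "\<gamma> = 2 + \<beta>"
  have \<gamma>: "\<gamma> > 0" using \<beta> by (simp add: \<gamma>_def)
  have a: "cmod a < 1" using r by simp
  have "cmod (f 0) \<le> F" by (rule F) simp
  then have F0: "0 \<le> F" by (rule order_trans[OF norm_ge_zero])
  have zD: "cmod z < 1" "1 - cmod a - r \<le> 1 - cmod z" if "z \<in> ball a r" for z
    using norm_triangle_ineq[of a "z - a"] that r by (auto simp: dist_norm norm_minus_commute)
  \<comment> \<open>A globally Borel substitute for the principal power, which makes the integrand
    jointly measurable.\<close>
  obtain \<phi> where \<phi>[measurable]: "\<phi> \<in> borel_measurable borel"
    and \<phi>_eq: "\<And>u. 0 < Re u \<Longrightarrow> \<phi> u = u powr complex_of_real \<gamma>"
    using powr_right_half_plane_measurable[of \<gamma>] by blast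
  have \<phi>k: "\<phi> (1 - z * cnj w) = (1 - z * cnj w) powr complex_of_real \<gamma>" if "cmod z < 1" "cmod w < 1" for z w
    using Re_disk_kernel_pos[of "cnj z" "cnj w"] that by (intro \<phi>_eq) simp
  have cnj: "cnj \<in> borel_measurable borel"
    by (intro borel_measurable_continuous_onI continuous_intros)
  have fm: "f \<in> borel_measurable \<mu>" by (rule measurable_disk_fun[OF sets f])
  have id: "(\<lambda>w. w) \<in> borel_measurable \<mu>" by (rule measurable_disk_id[OF sets])
  define G where "G w z = indicator (ball a r) z *\<^sub>R (cnj (z - a) ^ k * (f w / \<phi> (1 - z * cnj w)))" for w z
  have mz[measurable]: "(\<lambda>x. snd x) \<in> borel_measurable (\<mu> \<Otimes>\<^sub>M lborel)"
    using measurable_snd[of \<mu> lborel] by simp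
  have mw: "(\<lambda>x. fst x) \<in> borel_measurable (\<mu> \<Otimes>\<^sub>M lborel)"
    using measurable_compose[OF measurable_fst id] .
  have [measurable]: "(\<lambda>x. cnj (fst x)) \<in> borel_measurable (\<mu> \<Otimes>\<^sub>M lborel)"
    by (rule measurable_compose[OF mw cnj])
  have [measurable]: "(\<lambda>x. cnj (snd x - a)) \<in> borel_measurable (\<mu> \<Otimes>\<^sub>M lborel)"
    by (rule measurable_compose[OF _ cnj]) measurable
  have [measurable]: "(\<lambda>x. f (fst x)) \<in> borel_measurable (\<mu> \<Otimes>\<^sub>M lborel)"
    by (rule measurable_compose[OF measurable_fst fm])
  have [measurable]: "(\<lambda>x. \<phi> (1 - snd x * cnj (fst x))) \<in> borel_measurable (\<mu> \<Otimes>\<^sub>M lborel)"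
    by (rule measurable_compose[OF _ \<phi>]) measurable
  have [measurable]: "ball a r \<in> sets borel" by simp
  have [measurable]: "(\<lambda>x. indicator (ball a r) (snd x) :: real) \<in> borel_measurable (\<mu> \<Otimes>\<^sub>M lborel)"
    by (rule measurable_compose[OF mz]) measurable
  have Gm: "case_prod G \<in> borel_measurable (\<mu> \<Otimes>\<^sub>M lborel)"
    unfolding G_def case_prod_beta by measurable
  \<comment> \<open>The gap between the disk and the unit circle bounds the kernel from below
    uniformly in \<open>w\<close>; the integrand is then bounded and supported on a set of finite
    measure.\<close>
  define \<kappa> where "\<kappa> = 1 - cmod a - r"
  have \<kappa>: "\<kappa> > 0" using r by (simp add: \<kappa>_def)
  have Gb: "norm (G w z) \<le> r ^ k * (F * \<kappa> powr (- \<gamma>))" if w: "cmod w < 1" for w z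
  proof (cases "z \<in> ball a r")
    case True
    note z = zD[OF True]
    have "\<kappa> \<le> cmod (1 - z * cnj w)"
      using disk_kernel_lower[of "cnj z" "cnj w"] z w by (simp add: \<kappa>_def)
    then have "cmod (1 - z * cnj w) powr (- \<gamma>) \<le> \<kappa> powr (- \<gamma>)"
      using \<kappa> \<gamma> by (intro powr_mono2') auto
    moreover have "cmod (z - a) ^ k \<le> r ^ k"
      using True by (intro power_mono) (auto simp: dist_norm norm_minus_commute)
    moreover have "norm (G w z) = cmod (z - a) ^ k * (cmod (f w) * cmod (1 - z * cnj w) powr (- \<gamma>))"
    proof -
      have "cmod (cnj (z - a) ^ k) = cmod (z - a) ^ k"
        unfolding norm_power complex_mod_cnj ..
      then show ?thesis
        using True unfolding G_def \<phi>k[OF z(1) w] norm_scaleR norm_mult divide_inverse norm_inverse cmod_powr_of_real powr_minus by simp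
    qed
    ultimately show ?thesis
      using F[OF w] F0 r by (auto intro!: mult_mono)
  next
    case False
    then show ?thesis using F0 r by (simp add: G_def)
  qed
  have int: "integrable (\<mu> \<Otimes>\<^sub>M lborel) (case_prod G)"
  proof (rule integrableI_bounded_set[where A = "space \<mu> \<times> ball a r" and B = "r ^ k * (F * \<kappa> powr (- \<gamma>))"])
    show "space \<mu> \<times> ball a r \<in> sets (\<mu> \<Otimes>\<^sub>M lborel)" by (intro pair_measureI) auto
    show "emeasure (\<mu> \<Otimes>\<^sub>M lborel) (space \<mu> \<times> ball a r) < \<infinity>"
    proof -
      have "emeasure \<mu> (space \<mu>) < top" by (simp add: less_top[symmetric])
      then show ?thesis
        using emeasure_lborel_ball_finite[of a r]
        by (subst lborel.emeasure_pair_measure_Times) (auto simp: ennreal_mult_less_top)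
    qed
    show "AE x in \<mu> \<Otimes>\<^sub>M lborel. x \<in> space \<mu> \<times> ball a r \<longrightarrow> norm (case x of (w, z) \<Rightarrow> G w z) \<le> r ^ k * (F * \<kappa> powr (- \<gamma>))"
      by (rule AE_I2) (auto simp: space_pair_measure space_disk[OF sets] intro!: Gb)
    show "AE x in \<mu> \<Otimes>\<^sub>M lborel. x \<notin> space \<mu> \<times> ball a r \<longrightarrow> (case x of (w, z) \<Rightarrow> G w z) = 0"
      by (rule AE_I2) (auto simp: space_pair_measure G_def indicator_def split: if_splits)
  qed (rule Gm)
  have inner: "(\<integral>z. G w z \<partial>lborel) = pochhammer (complex_of_real \<gamma>) k / fact k * complex_of_real (LINT z:ball (0::complex) r|lborel. cmod z ^ (2 * k))
      * (f w * cnj w ^ k * (1 - a * cnj w) powr (- complex_of_real \<gamma> - of_nat k))" if w: "cmod w < 1" for w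
  proof -
    let ?g = "\<lambda>z. (1 - z * cnj w) powr (- complex_of_real \<gamma>)"
    have "(\<lambda>z. (1 - cnj w * z) powr complex_of_real (- \<gamma>)) holomorphic_on unit_disk"
      by (rule holomorphic_disk_kernel[OF w])
    then have "?g holomorphic_on unit_disk" by (simp add: mult.commute)
    moreover have "ball a (1 - cmod a) \<subseteq> unit_disk"
      by (rule ball_subset_unit_disk) simp
    ultimately have g: "?g holomorphic_on ball a (1 - cmod a)" by (rule holomorphic_on_subset)
    have "(\<integral>z. G w z \<partial>lborel) = (\<integral>z. f w * (indicator (ball a r) z *\<^sub>R (cnj (z - a) ^ k * ?g z)) \<partial>lborel)"
    proof (rule Bochner_Integration.integral_cong[OF refl])
      fix z
      show "G w z = f w * (indicator (ball a r) z *\<^sub>R (cnj (z - a) ^ k * ?g z))"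
        using \<phi>k[OF zD(1)[of z] w] by (cases "z \<in> ball a r") (simp_all add: G_def powr_minus divide_inverse)
    qed
    also have "\<dots> = f w * (LINT z:ball a r|lborel. cnj (z - a) ^ k * ?g z)"
      unfolding set_lebesgue_integral_def by (rule integral_mult_right_zero)
    also have "(LINT z:ball a r|lborel. cnj (z - a) ^ k * ?g z)
        = (deriv ^^ k) ?g a / fact k * complex_of_real (LINT z:ball (0::complex) r|lborel. cmod z ^ (2 * k))"
      by (rule area_taylor[OF g r])
    also have "(deriv ^^ k) ?g a = pochhammer (complex_of_real \<gamma>) k * cnj w ^ k * (1 - a * cnj w) powr (- complex_of_real \<gamma> - of_nat k)"
      by (rule higher_deriv_kernel) (use w a in auto)
    finally show ?thesis by (simp only: mult_ac times_divide_eq_right times_divide_eq_left)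
  qed
  have "(LINT z:ball a r|lborel. cnj (z - a) ^ k * toeplitz \<mu> \<beta> f z) = (\<integral>z. \<integral>w. G w z \<partial>\<mu> \<partial>lborel)"
    unfolding set_lebesgue_integral_def
  proof (rule Bochner_Integration.integral_cong[OF refl])
    fix z
    show "indicator (ball a r) z *\<^sub>R (cnj (z - a) ^ k * toeplitz \<mu> \<beta> f z) = (\<integral>w. G w z \<partial>\<mu>)"
    proof (cases "z \<in> ball a r")
      case True
      have "(\<integral>w. G w z \<partial>\<mu>) = (\<integral>w. cnj (z - a) ^ k * (f w / (1 - z * cnj w) powr complex_of_real \<gamma>) \<partial>\<mu>)"
        using True zD(1)[OF True]
        by (intro Bochner_Integration.integral_cong refl) (simp add: G_def \<phi>k space_disk[OF sets])
      also have "\<dots> = cnj (z - a) ^ k * toeplitz \<mu> \<beta> f z"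
        unfolding toeplitz_def \<gamma>_def by (rule integral_mult_right_zero)
      finally show ?thesis using True by simp
    qed (simp add: G_def)
  qed
  also have "\<dots> = (\<integral>w. \<integral>z. G w z \<partial>lborel \<partial>\<mu>)"
    by (rule Fubini_integral[OF int])
  also have "\<dots> = (\<integral>w. pochhammer (complex_of_real \<gamma>) k / fact k * complex_of_real (LINT z:ball (0::complex) r|lborel. cmod z ^ (2 * k))
      * (f w * cnj w ^ k * (1 - a * cnj w) powr (- complex_of_real \<gamma> - of_nat k)) \<partial>\<mu>)"
    by (intro Bochner_Integration.integral_cong refl) (simp only: space_disk[OF sets] mem_ball_0 inner)
  finally show ?thesis by (simp only: \<gamma>_def integral_mult_right_zero)
qed

text \<open>The disk has area of order \<delta>^2 and on it the weight is of order \<delta>^\<beta>;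
  Hoelder's inequality there would give the same power of \<delta>.\<close>

lemma local_L1_bound:
  assumes a: "cmod a < 1" and q: "q > 1" and M: "M > 0"
    and T: "(\<lambda>z. indicator unit_disk z *\<^sub>R T z) \<in> borel_measurable borel"
    and D: "disk_integral q \<beta> T \<le> ennreal (M powr q)"
  shows "(\<integral>\<^sup>+z\<in>ball a ((1 - cmod a) / 2). ennreal (cmod (T z)) \<partial>lborel)
    \<le> ennreal ((pi + 2 powr \<bar>\<beta>\<bar>) * M * (1 - cmod a) powr (2 - (2 + \<beta>) / q))"
proof -
  define \<delta> where "\<delta> = 1 - cmod a"
  have \<delta>: "\<delta> > 0" using a by (simp add: \<delta>_def)
  define B where "B = ball a (\<delta> / 2)"
  \<comment> \<open>If |T|^q were constant on the disk, the hypothesis would make |T|^q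
    \<delta>^(2+\<beta>) at most of order M^q. At this level both terms of
    \<open>le_add_powr\<close> contribute the same power of \<delta>.\<close>
  define A where "A = M * \<delta> powr (- ((2 + \<beta>) / q))"
  have A: "A > 0" using M \<delta> by (simp add: A_def)
  define c where "c = A powr (1 - q) * (2 powr \<bar>\<beta>\<bar> * \<delta> powr (- \<beta>))"
  let ?v = "\<lambda>z. ennreal (cmod (T z) powr q * (1 - cmod z) powr \<beta>) * indicator unit_disk z"
  have mv: "?v \<in> borel_measurable lborel"
    unfolding measurable_lborel2 by (rule set_borel_measurable_powr_weight'[OF T]) measurable
  have le: "ennreal (cmod (T z)) * indicator B z \<le> ennreal A * indicator B z + ennreal c * ?v z" for z
  proof (cases "z \<in> B")
    case True
    have d: "cmod (z - a) < \<delta> / 2" using True by (simp add: B_def dist_norm norm_minus_commute)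
    have 1: "\<bar>cmod z - cmod a\<bar> \<le> cmod (z - a)" by (rule norm_triangle_ineq3)
    have 2: "cmod z < cmod a + \<delta> / 2" "cmod a - \<delta> / 2 < cmod z" using 1 d by linarith+
    then have z: "cmod z < 1" using \<delta> unfolding \<delta>_def by argo
    have "\<delta> / (1 - cmod z) \<in> {1 / 2..2}"
      using 2 z \<delta> by (auto simp: \<delta>_def field_simps)
    then have "\<delta> powr \<beta> \<le> 2 powr \<bar>\<beta>\<bar> * (1 - cmod z) powr \<beta>"
      using z by (intro powr_le_powr_ratio) auto
    then have "\<delta> powr (- \<beta>) * \<delta> powr \<beta> \<le> \<delta> powr (- \<beta>) * (2 powr \<bar>\<beta>\<bar> * (1 - cmod z) powr \<beta>)"
      by (rule mult_left_mono) simp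
    moreover have "\<delta> powr (- \<beta>) * \<delta> powr \<beta> = 1" using \<delta> by (subst powr_add[symmetric]) simp
    ultimately have 3: "1 \<le> \<delta> powr (- \<beta>) * (2 powr \<bar>\<beta>\<bar> * (1 - cmod z) powr \<beta>)" by simp
    have "cmod (T z) \<le> A + A powr (1 - q) * cmod (T z) powr q * 1"
      using le_add_powr[of "cmod (T z)" A q] A q by simp
    also have "\<dots> \<le> A + A powr (1 - q) * cmod (T z) powr q * (\<delta> powr (- \<beta>) * (2 powr \<bar>\<beta>\<bar> * (1 - cmod z) powr \<beta>))"
      by (intro add_left_mono mult_left_mono 3) simp
    also have "\<dots> = A + c * (cmod (T z) powr q * (1 - cmod z) powr \<beta>)"
      by (simp add: c_def mult_ac)
    finally have "ennreal (cmod (T z)) \<le> ennreal (A + c * (cmod (T z) powr q * (1 - cmod z) powr \<beta>))"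
      by (rule ennreal_leI)
    also have "\<dots> = ennreal A + ennreal c * ennreal (cmod (T z) powr q * (1 - cmod z) powr \<beta>)"
      using A by (simp add: c_def ennreal_mult)
    finally show ?thesis using True z by simp
  qed simp
  have eB: "emeasure lborel B \<le> ennreal (pi * \<delta>\<^sup>2)"
    using \<delta> by (simp add: B_def emeasure_ball unit_ball_vol_2 power2_eq_square ennreal_leI)
  have "(\<integral>\<^sup>+z\<in>B. ennreal (cmod (T z)) \<partial>lborel) \<le> (\<integral>\<^sup>+z. ennreal A * indicator B z + ennreal c * ?v z \<partial>lborel)"
    by (intro nn_integral_mono le)
  also have "\<dots> = (\<integral>\<^sup>+z. ennreal A * indicator B z \<partial>lborel) + (\<integral>\<^sup>+z. ennreal c * ?v z \<partial>lborel)"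
  proof (rule nn_integral_add)
    show "(\<lambda>z. ennreal A * indicator B z) \<in> borel_measurable lborel"
      unfolding B_def by (intro borel_measurable_times_ennreal borel_measurable_const borel_measurable_indicator) simp
    show "(\<lambda>z. ennreal c * ?v z) \<in> borel_measurable lborel"
      by (intro borel_measurable_times_ennreal[OF borel_measurable_const mv])
  qed
  also have "(\<integral>\<^sup>+z. ennreal A * indicator B z \<partial>lborel) = ennreal A * emeasure lborel B"
    by (rule nn_integral_cmult_indicator) (simp add: B_def)
  also have "(\<integral>\<^sup>+z. ennreal c * ?v z \<partial>lborel) = ennreal c * disk_integral q \<beta> T"
    unfolding disk_integral_def by (rule nn_integral_cmult[OF mv])
  also have "ennreal A * emeasure lborel B + ennreal c * disk_integral q \<beta> T
      \<le> ennreal A * ennreal (pi * \<delta>\<^sup>2) + ennreal c * ennreal (M powr q)"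
    by (intro add_mono mult_left_mono eB D) auto
  also have "\<dots> = ennreal (A * (pi * \<delta>\<^sup>2) + c * M powr q)"
    using A by (simp add: c_def ennreal_mult)
  also have "A * (pi * \<delta>\<^sup>2) = pi * M * \<delta> powr (2 - (2 + \<beta>) / q)"
  proof -
    have "\<delta> powr (- ((2 + \<beta>) / q)) * \<delta>\<^sup>2 = \<delta> powr (- ((2 + \<beta>) / q)) * \<delta> powr 2"
      using \<delta> by simp
    also have "\<dots> = \<delta> powr (2 - (2 + \<beta>) / q)"
      by (subst powr_add[symmetric]) simp
    finally show ?thesis by (simp add: A_def mult_ac)
  qed
  also have "c * M powr q = 2 powr \<bar>\<beta>\<bar> * M * \<delta> powr (2 - (2 + \<beta>) / q)"
  proof -
    have "A powr (1 - q) = M powr (1 - q) * \<delta> powr (- ((2 + \<beta>) / q) * (1 - q))"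
      unfolding A_def using M by (simp add: powr_mult powr_powr)
    then have "c * M powr q = 2 powr \<bar>\<beta>\<bar> * (M powr (1 - q) * M powr q) * (\<delta> powr (- ((2 + \<beta>) / q) * (1 - q)) * \<delta> powr (- \<beta>))"
      by (simp add: c_def mult_ac)
    also have "M powr (1 - q) * M powr q = M"
      using M by (subst powr_add[symmetric]) simp
    also have "\<delta> powr (- ((2 + \<beta>) / q) * (1 - q)) * \<delta> powr (- \<beta>) = \<delta> powr (2 - (2 + \<beta>) / q)"
    proof -
      have "- ((2 + \<beta>) / q) * (1 - q) + - \<beta> = 2 - (2 + \<beta>) / q"
        using q by (simp add: field_simps)
      then show ?thesis by (simp only: powr_add[symmetric])
    qed
    finally show ?thesis .
  qed
  also have "pi * M * \<delta> powr (2 - (2 + \<beta>) / q) + 2 powr \<bar>\<beta>\<bar> * M * \<delta> powr (2 - (2 + \<beta>) / q)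
      = (pi + 2 powr \<bar>\<beta>\<bar>) * M * \<delta> powr (2 - (2 + \<beta>) / q)"
    by (simp add: algebra_simps)
  finally show ?thesis by (simp add: B_def \<delta>_def)
qed

lemma norm_area_coefficient_le:
  assumes r: "r \<ge> 0" and T: "(\<lambda>z. indicator (ball a r) z *\<^sub>R T z) \<in> borel_measurable borel"
  shows "ennreal (cmod (LINT z:ball a r|lborel. cnj (z - a) ^ k * T z))
    \<le> ennreal (r ^ k) * (\<integral>\<^sup>+z\<in>ball a r. ennreal (cmod (T z)) \<partial>lborel)"
proof (cases "integrable lborel (\<lambda>z. indicator (ball a r) z *\<^sub>R (cnj (z - a) ^ k * T z))")
  case True
  have "(\<lambda>z. ennreal (cmod (indicator (ball a r) z *\<^sub>R T z))) \<in> borel_measurable borel"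
    using T by measurable
  moreover have "ennreal (cmod (indicator (ball a r) z *\<^sub>R T z)) = ennreal (cmod (T z)) * indicator (ball a r) z" for z
    by (cases "z \<in> ball a r") auto
  ultimately have m: "(\<lambda>z. ennreal (cmod (T z)) * indicator (ball a r) z) \<in> borel_measurable lborel"
    by (simp only: measurable_lborel2)
  have "ennreal (cmod (LINT z:ball a r|lborel. cnj (z - a) ^ k * T z))
      \<le> (\<integral>\<^sup>+z. norm (indicator (ball a r) z *\<^sub>R (cnj (z - a) ^ k * T z)) \<partial>lborel)"
    unfolding set_lebesgue_integral_def by (rule integral_norm_bound_ennreal[OF True])
  also have "\<dots> \<le> (\<integral>\<^sup>+z. ennreal (r ^ k) * (ennreal (cmod (T z)) * indicator (ball a r) z) \<partial>lborel)"
  proof (rule nn_integral_mono)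
    fix z
    show "ennreal (norm (indicator (ball a r) z *\<^sub>R (cnj (z - a) ^ k * T z)))
        \<le> ennreal (r ^ k) * (ennreal (cmod (T z)) * indicator (ball a r) z)"
    proof (cases "z \<in> ball a r")
      case True
      have "cmod (cnj (z - a) ^ k) = cmod (z - a) ^ k"
        unfolding norm_power complex_mod_cnj ..
      also have "\<dots> \<le> r ^ k"
        using True by (intro power_mono) (auto simp: dist_norm norm_minus_commute)
      finally have "cmod (cnj (z - a) ^ k * T z) \<le> r ^ k * cmod (T z)"
        unfolding norm_mult by (rule mult_right_mono) simp
      then have "ennreal (cmod (cnj (z - a) ^ k * T z)) \<le> ennreal (r ^ k) * ennreal (cmod (T z))"
        using r by (subst ennreal_mult[symmetric]) (auto intro: ennreal_leI)
      then show ?thesis using True by (simp only: indicator_simps scaleR_one mult_1_right)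
    qed simp
  qed
  also have "\<dots> = ennreal (r ^ k) * (\<integral>\<^sup>+z\<in>ball a r. ennreal (cmod (T z)) \<partial>lborel)"
    by (rule nn_integral_cmult[OF m])
  finally show ?thesis .
next
  case False
  then show ?thesis by (simp add: set_lebesgue_integral_def not_integrable_integral_eq)
qed

text \<open>In the formula of \<open>toeplitz_area_coefficient\<close> the moment is at least of
  order \<delta>^(2k+2), while the area integral is at most of order M \<delta>^k \<delta>^(2 -
  (2+\<beta>)/q). The quotient has the exponent -k - (2+\<beta>)/q.\<close>

lemma toeplitz_coefficient_bound:
  assumes fin: "finite_measure \<mu>" and sets: "sets \<mu> = sets (restrict_space borel unit_disk)"
    and q: "1 < q" and \<beta>: "\<beta> > -1" and bdd: "toeplitz_bounded \<mu> p \<alpha> q \<beta>"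
  obtains C where "C > 0" "\<And>a P M. cmod a < 1 \<Longrightarrow> M > 0 \<Longrightarrow> bergman_norm p \<alpha> (poly P) \<le> ennreal M \<Longrightarrow>
    cmod (\<integral>w. poly P w * cnj w ^ k * (1 - a * cnj w) powr (- complex_of_real (2 + \<beta>) - of_nat k) \<partial>\<mu>)
      \<le> C * M * (1 - cmod a) powr (- real k - (2 + \<beta>) / q)"
proof -
  define \<gamma> where "\<gamma> = 2 + \<beta>"
  have \<gamma>: "\<gamma> > 0" using \<beta> by (simp add: \<gamma>_def)
  obtain C0 where C0: "C0 \<ge> 0" "\<And>P. bergman_norm q \<beta> (toeplitz \<mu> \<beta> (poly P)) \<le> ennreal C0 * bergman_norm p \<alpha> (poly P)"
    using bdd by (auto simp: toeplitz_bounded_def)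
  define C1 where "C1 = pi * 2 powr \<bar>\<beta>\<bar> / (1 + \<beta>)"
  have C1: "C1 > 0" using \<beta> by (simp add: C1_def)
  \<comment> \<open>\<open>C0\<close> may be 0; adding 1 keeps the constant positive.\<close>
  define C2 where "C2 = C1 powr (1 / q) * (C0 + 1)"
  have C2: "C2 > 0" using C0 C1 by (simp add: C2_def)
  define d where "d = pochhammer \<gamma> k / fact k"
  have d: "d > 0" using \<gamma> by (simp add: d_def pochhammer_pos)
  define C where "C = 4 ^ (k + 1) / d * 2 ^ (k + 2) * ((pi + 2 powr \<bar>\<beta>\<bar>) * C2)"
  have "cmod (\<integral>w. poly P w * cnj w ^ k * (1 - a * cnj w) powr (- complex_of_real (2 + \<beta>) - of_nat k) \<partial>\<mu>)
      \<le> C * M * (1 - cmod a) powr (- real k - (2 + \<beta>) / q)" (is "cmod ?X \<le> _")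
    if a: "cmod a < 1" and M: "M > 0" and norm: "bergman_norm p \<alpha> (poly P) \<le> ennreal M" for a P M
  proof -
    define \<delta> where "\<delta> = 1 - cmod a"
    define r where "r = \<delta> / 2"
    have \<delta>: "\<delta> > 0" and r: "0 < r" "r < 1 - cmod a" using a by (auto simp: \<delta>_def r_def)
    let ?T = "toeplitz \<mu> \<beta> (poly P)"
    have cont: "continuous_on S (poly P)" for S by (intro continuous_intros)
    have T: "(\<lambda>z. indicator unit_disk z *\<^sub>R ?T z) \<in> borel_measurable borel"
      by (rule set_borel_measurable_toeplitz[OF fin sets cont])
    have Tr: "(\<lambda>z. indicator (ball a r) z *\<^sub>R ?T z) \<in> borel_measurable borel"
    proof -
      have "ball a r \<subseteq> unit_disk"
        by (rule ball_subset_unit_disk) (use r in auto)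
      then have "indicator (ball a r) z *\<^sub>R (indicator unit_disk z *\<^sub>R ?T z) = indicator (ball a r) z *\<^sub>R ?T z" for z
        by (cases "z \<in> ball a r") auto
      moreover have "(\<lambda>z. indicator (ball a r) z *\<^sub>R (indicator unit_disk z *\<^sub>R ?T z)) \<in> borel_measurable borel"
        by (intro borel_measurable_scaleR borel_measurable_indicator T) simp
      ultimately show ?thesis by (simp only:)
    qed
    have "bergman_norm q \<beta> ?T \<le> ennreal C0 * ennreal M"
      by (rule order_trans[OF C0(2)]) (intro mult_left_mono norm, simp)
    also have "\<dots> \<le> ennreal ((C0 + 1) * M)"
      using C0(1) M by (simp add: ennreal_leI mult_right_mono flip: ennreal_mult)
    finally have "bergman_integral q \<beta> ?T \<le> ennreal (((C0 + 1) * M) powr q)"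
      unfolding bergman_norm_eq using q C0(1) M by (intro ennreal_powr_leD) auto
    then have "ennreal C1 * bergman_integral q \<beta> ?T \<le> ennreal C1 * ennreal (((C0 + 1) * M) powr q)"
      by (rule mult_left_mono) simp
    moreover have "disk_integral q \<beta> ?T \<le> ennreal C1 * bergman_integral q \<beta> ?T"
      unfolding C1_def by (rule bergman_integral_compare[OF \<beta> T])
    ultimately have "disk_integral q \<beta> ?T \<le> ennreal C1 * ennreal (((C0 + 1) * M) powr q)" by (rule order_trans[rotated])
    also have "\<dots> = ennreal ((C2 * M) powr q)"
      using C1 C0(1) M q by (simp add: C2_def powr_mult powr_powr flip: ennreal_mult)
    finally have L1: "(\<integral>\<^sup>+z\<in>ball a r. ennreal (cmod (?T z)) \<partial>lborel)
        \<le> ennreal ((pi + 2 powr \<bar>\<beta>\<bar>) * (C2 * M) * \<delta> powr (2 - \<gamma> / q))"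
      using local_L1_bound[OF a q _ T, of "C2 * M" \<beta>] C2 M by (simp add: r_def \<delta>_def \<gamma>_def)
    obtain F where F: "\<And>w. w \<in> cball 0 1 \<Longrightarrow> cmod (poly P w) \<le> F"
    proof -
      have "bounded (poly P ` cball 0 1)"
        by (intro compact_imp_bounded compact_continuous_image cont compact_cball)
      then show ?thesis using that unfolding bounded_iff by blast
    qed
    define m where "m = (LINT z:ball (0::complex) r|lborel. cmod z ^ (2 * k))"
    have m: "m \<ge> r ^ (2 * k + 2) / 4 ^ (k + 1)" unfolding m_def by (rule area_moment_diag_ge[OF r(1)])
    have "0 \<le> r ^ (2 * k + 2) / 4 ^ (k + 1)" using r by simp
    then have m0: "0 \<le> m" using m by (rule order_trans)
    have "(LINT z:ball a r|lborel. cnj (z - a) ^ k * ?T z) = complex_of_real d * complex_of_real m * ?X"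
      using toeplitz_area_coefficient[OF fin sets r _ cont, where \<beta> = \<beta> and F = F and k = k] F \<beta>
      by (simp add: m_def d_def \<gamma>_def pochhammer_of_real flip: of_real_add)
    then have "d * m * cmod ?X = cmod (LINT z:ball a r|lborel. cnj (z - a) ^ k * ?T z)"
      using d m0 by (simp add: norm_mult)
    then have "ennreal (d * m * cmod ?X) \<le> ennreal (r ^ k) * (\<integral>\<^sup>+z\<in>ball a r. ennreal (cmod (?T z)) \<partial>lborel)"
      using norm_area_coefficient_le[OF less_imp_le[OF r(1)] Tr, of k] by (simp only:)
    also have "\<dots> \<le> ennreal (r ^ k) * ennreal ((pi + 2 powr \<bar>\<beta>\<bar>) * (C2 * M) * \<delta> powr (2 - \<gamma> / q))"
      by (intro mult_left_mono L1) simp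
    also have "\<dots> = ennreal (r ^ k * ((pi + 2 powr \<bar>\<beta>\<bar>) * (C2 * M) * \<delta> powr (2 - \<gamma> / q)))"
      using r C2 M by (intro ennreal_mult[symmetric]) auto
    finally have 1: "d * m * cmod ?X \<le> r ^ k * ((pi + 2 powr \<bar>\<beta>\<bar>) * (C2 * M) * \<delta> powr (2 - \<gamma> / q))"
      using r C2 M by (subst (asm) ennreal_le_iff) auto
    have pw: "r ^ (2 * k + 2) = r ^ k * r ^ (k + 2)" by (simp add: mult_2 flip: power_add)
    have "r ^ k * (r ^ (k + 2) * (d / 4 ^ (k + 1) * cmod ?X)) = d * (r ^ (2 * k + 2) / 4 ^ (k + 1)) * cmod ?X"
      unfolding pw by (simp only: mult_ac times_divide_eq_right times_divide_eq_left)
    also have "\<dots> \<le> d * m * cmod ?X"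
      using d by (intro mult_right_mono mult_left_mono m) auto
    also note 1
    finally have "r ^ (k + 2) * (d / 4 ^ (k + 1) * cmod ?X) \<le> (pi + 2 powr \<bar>\<beta>\<bar>) * (C2 * M) * \<delta> powr (2 - \<gamma> / q)"
      by (rule mult_left_le_imp_le) (use r in simp)
    then have "cmod ?X \<le> (pi + 2 powr \<bar>\<beta>\<bar>) * (C2 * M) * \<delta> powr (2 - \<gamma> / q) / (r ^ (k + 2) * (d / 4 ^ (k + 1)))"
      using r d by (subst pos_le_divide_eq) (auto simp: mult_ac)
    also have "\<dots> = 4 ^ (k + 1) / d * ((pi + 2 powr \<bar>\<beta>\<bar>) * C2) * M * (\<delta> powr (2 - \<gamma> / q) * inverse (r ^ (k + 2)))"
      using r d by (simp add: field_simps)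
    also have "\<delta> powr (2 - \<gamma> / q) * inverse (r ^ (k + 2)) = 2 ^ (k + 2) * \<delta> powr (- real k - \<gamma> / q)"
    proof -
      have "inverse (r ^ (k + 2)) = 2 ^ (k + 2) * \<delta> powr (- real (k + 2))"
        unfolding r_def power_divide inverse_divide powr_minus powr_realpow[OF \<delta>]
        by (rule divide_inverse)
      moreover have "\<delta> powr (2 - \<gamma> / q) * \<delta> powr (- real (k + 2)) = \<delta> powr (- real k - \<gamma> / q)"
        by (subst powr_add[symmetric]) (simp add: algebra_simps)
      ultimately show ?thesis by (simp only: mult_ac)
    qed
    finally show ?thesis by (simp add: C_def \<delta>_def \<gamma>_def mult_ac)
  qed
  moreover have "C > 0" using d C2 by (simp add: C_def add_pos_pos)
  ultimately show ?thesis using that by blast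
qed

text \<open>The test function F is at least of order \<delta>^(-N) on the disk about
  \<open>a\<close>, so the integral of |F|^2 is at least of order \<delta>^(-2N) times the measure
  of that disk. The coefficient bound gives \<delta>^E from above, with E = (2+\<alpha>)/p - N - k -
  (2+\<beta>)/q. As N = 2 + \<beta> + k, the sum E + 2N is \<sigma>.\<close>

lemma toeplitz_bounded_imp_ball_condition:
  assumes fin: "finite_measure \<mu>" and sets: "sets \<mu> = sets (restrict_space borel unit_disk)"
    and p: "0 < p" and q: "1 < q" and qq': "1 / q + 1 / q' = 1"
    and \<alpha>: "\<alpha> > -1" and \<beta>: "\<beta> > -1" and bdd: "toeplitz_bounded \<mu> p \<alpha> q \<beta>"
  shows "ball_condition \<mu> ((2 + \<alpha>) / p + (2 + \<beta>) / q')"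
proof -
  interpret finite_measure \<mu> by fact
  define \<gamma> where "\<gamma> = 2 + \<beta>"
  define \<sigma> where "\<sigma> = (2 + \<alpha>) / p + \<gamma> / q'"
  have \<gamma>: "\<gamma> > 0" using \<beta> by (simp add: \<gamma>_def)
  have q': "1 / q' = 1 - 1 / q" using qq' by simp
  have gq: "\<gamma> / q' = \<gamma> - \<gamma> / q" using q' by (metis divide_inverse inverse_eq_divide mult.right_neutral right_diff_distrib)
  have "\<gamma> / q \<le> \<gamma>" using q \<gamma> by (simp add: field_simps)
  moreover have "(2 + \<alpha>) / p > 0" using p \<alpha> by simp
  ultimately have \<sigma>: "\<sigma> > 0" unfolding \<sigma>_def gq by linarith
  \<comment> \<open>Large enough to bring N p above 2 + \<alpha> for N = \<gamma> + k, the
    Forelli--Rudin range.\<close>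
  obtain k :: nat where k: "(2 + \<alpha>) / p < real k" using reals_Archimedean2 by blast
  define N where "N = \<gamma> + real k"
  have N: "N > 0" using \<gamma> by (simp add: N_def)
  have Np: "N * p > 2 + \<alpha>"
  proof -
    have "2 + \<alpha> < real k * p" using k p by (simp add: pos_divide_less_eq)
    also have "\<dots> \<le> N * p" using \<gamma> p by (simp add: N_def)
    finally show ?thesis .
  qed
  obtain C1 where C1: "C1 > 0" "\<And>a. cmod a < 1 \<Longrightarrow>
    disk_integral p \<alpha> (\<lambda>w. (1 - cnj a * w) powr complex_of_real (- N)) \<le> ennreal (C1 * (1 - cmod a) powr (2 + \<alpha> - N * p))"
    using kernel_disk_integral[OF \<alpha> Np] by blast
  obtain C2 where C2: "C2 > 0" "\<And>a P M. cmod a < 1 \<Longrightarrow> M > 0 \<Longrightarrow> bergman_norm p \<alpha> (poly P) \<le> ennreal M \<Longrightarrow>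
    cmod (\<integral>w. poly P w * cnj w ^ k * (1 - a * cnj w) powr (- complex_of_real \<gamma> - of_nat k) \<partial>\<mu>)
      \<le> C2 * M * (1 - cmod a) powr (- real k - \<gamma> / q)"
    using toeplitz_coefficient_bound[OF fin sets q \<beta> bdd, of k] unfolding \<gamma>_def[symmetric] by blast
  define C3 where "C3 = ((1 + \<alpha>) * 2 powr \<bar>\<alpha>\<bar> / pi * (2 powr p * C1)) powr (1 / p)"
  have C3: "C3 > 0" using \<alpha> C1 by (simp add: C3_def)
  define E where "E = (2 + \<alpha>) / p - N - real k - \<gamma> / q"
  have E: "E + 2 * N = \<sigma>" by (simp add: E_def \<sigma>_def gq N_def)
  define K1 where "K1 = (C2 * C3 + 1) * (16 ^ k * (5 / 2) powr (2 * N))"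
  have K1: "K1 > 0" using C2 C3 by (simp add: K1_def add_pos_pos)
  \<comment> \<open>The factor w^k spoils the lower bound for |F| near 0, so centres with |a| < 1/2
    are postponed.\<close>
  have main: "measure \<mu> (ball a ((1 - cmod a) / 2)) \<le> K1 * (1 - cmod a) powr \<sigma>"
    if a: "1 / 2 \<le> cmod a" "cmod a < 1" for a
  proof -
    define \<delta> where "\<delta> = 1 - cmod a"
    have \<delta>: "\<delta> > 0" using a by (simp add: \<delta>_def)
    define G where "G w = (1 - cnj a * w) powr complex_of_real (- N)" for w
    define F where "F w = w ^ k * G w" for w
    define V where "V = measure \<mu> (space \<mu>)"
    have V: "V \<ge> 0" by (simp add: V_def)
    \<comment> \<open>Two demands on the approximation: 2^(-N) is a lower bound for |G|, so an error
      below it keeps the polynomial under 2 |G|; the second term keeps the error in the pairing with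
      F under \<delta>^E. The summand 1 allows V = 0.\<close>
    define \<epsilon> where "\<epsilon> = min (2 powr (- N)) (\<delta> powr (E + N) / (V + 1))"
    have \<epsilon>: "\<epsilon> > 0" "\<epsilon> \<le> 2 powr (- N)" "\<epsilon> * V * \<delta> powr (- N) \<le> \<delta> powr E"
    proof -
      show "\<epsilon> > 0" "\<epsilon> \<le> 2 powr (- N)" using \<delta> V by (simp_all add: \<epsilon>_def)
      have "\<epsilon> * V \<le> \<delta> powr (E + N) / (V + 1) * V"
        using V by (intro mult_right_mono) (simp_all add: \<epsilon>_def)
      also have "\<dots> = \<delta> powr (E + N) * (V / (V + 1))" by simp
      also have "\<dots> \<le> \<delta> powr (E + N) * 1"
        using V by (intro mult_left_mono) (simp_all add: divide_le_eq_1)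
      finally have "\<epsilon> * V * \<delta> powr (- N) \<le> \<delta> powr (E + N) * \<delta> powr (- N)"
        by (intro mult_right_mono) simp_all
      also have "\<dots> = \<delta> powr E" by (subst powr_add[symmetric]) simp
      finally show "\<epsilon> * V * \<delta> powr (- N) \<le> \<delta> powr E" .
    qed
    have Gm: "cmod (G w) = cmod (1 - cnj a * w) powr (- N)" for w
      unfolding G_def by (rule cmod_powr_of_real)
    have Gle: "cmod (G w) \<le> \<delta> powr (- N)" if "cmod w < 1" for w
      unfolding Gm using disk_kernel_lower[OF a(2) that] \<delta> N by (intro powr_mono2') (auto simp: \<delta>_def)
    have Gge: "2 powr (- N) \<le> cmod (G w)" if w: "cmod w < 1" for w
    proof -
      have "cmod (1 - cnj a * w) \<le> 1 + cmod (cnj a * w)" using norm_triangle_ineq4[of 1 "cnj a * w"] by simp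
      moreover have "cmod (cnj a * w) \<le> 1" using mult_le_one[of "cmod a" "cmod w"] a w by (simp add: norm_mult)
      moreover have "0 < cmod (1 - cnj a * w)" using disk_kernel_lower[OF a(2) w] a by linarith
      ultimately show ?thesis unfolding Gm using N by (intro powr_mono2') auto
    qed
    have FG: "cmod (F w) \<le> cmod (G w)" if "cmod w < 1" for w
      using that by (simp add: F_def norm_mult norm_power mult_left_le_one_le power_le_one)
    \<comment> \<open>The singularity of G lies at the reciprocal of \<open>cnj a\<close>, outside
      the closed disk; this permits uniform approximation on the disk.\<close>
    have "F holomorphic_on ball 0 (1 / cmod a)"
      unfolding F_def[abs_def] G_def
    proof (intro holomorphic_on_mult holomorphic_on_power holomorphic_on_ident holomorphic_on_powr holomorphic_on_diff holomorphic_on_const)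
      fix w :: complex assume "w \<in> ball 0 (1 / cmod a)"
      then have "cmod w < 1 / cmod a" by simp
      moreover have "0 < cmod a" using a by linarith
      ultimately have "cmod w * cmod a < 1" by (simp only: pos_less_divide_eq)
      then have "cmod (cnj a * w) < 1" by (simp add: norm_mult mult.commute)
      then have "0 < Re (1 - cnj a * w)" using complex_Re_le_cmod[of "cnj a * w"] by simp
      then show "1 - cnj a * w \<notin> \<real>\<^sub>\<le>\<^sub>0" by (auto simp: complex_nonpos_Reals_iff)
    qed
    moreover have "1 / cmod a > 1"
    proof -
      have "0 < cmod a" using a by linarith
      then show ?thesis using a(2) by (simp only: pos_less_divide_eq mult_1_left)
    qed
    ultimately obtain P where P: "\<And>w. cmod w < 1 \<Longrightarrow> cmod (poly P w - F w) < \<epsilon>"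
      using polynomial_approximation \<epsilon>(1) by blast
    have hol: "poly P holomorphic_on unit_disk" by (intro holomorphic_intros)
    have PG: "cmod (poly P w) \<le> 2 * cmod (G w)" if w: "cmod w < 1" for w
      using P[OF w] norm_triangle_ineq[of "poly P w - F w" "F w"] FG[OF w] Gge[OF w] \<epsilon>(2) by simp
    have "disk_integral p \<alpha> (poly P) \<le> (\<integral>\<^sup>+w. ennreal (2 powr p) * (ennreal (cmod (G w) powr p * (1 - cmod w) powr \<alpha>) * indicator unit_disk w) \<partial>lborel)"
      unfolding disk_integral_def
    proof (rule nn_integral_mono)
      fix w
      show "ennreal (cmod (poly P w) powr p * (1 - cmod w) powr \<alpha>) * indicator unit_disk w
        \<le> ennreal (2 powr p) * (ennreal (cmod (G w) powr p * (1 - cmod w) powr \<alpha>) * indicator unit_disk w)"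
      proof (cases "w \<in> unit_disk")
        case True
        then have "cmod (poly P w) powr p \<le> (2 * cmod (G w)) powr p"
          using PG[of w] p by (intro powr_mono2) auto
        then have "cmod (poly P w) powr p * (1 - cmod w) powr \<alpha> \<le> 2 powr p * cmod (G w) powr p * (1 - cmod w) powr \<alpha>"
          by (intro mult_right_mono) (simp_all add: powr_mult)
        then have "ennreal (cmod (poly P w) powr p * (1 - cmod w) powr \<alpha>)
            \<le> ennreal (2 powr p * (cmod (G w) powr p * (1 - cmod w) powr \<alpha>))"
          by (intro ennreal_leI) (simp only: mult.assoc)
        also have "\<dots> = ennreal (2 powr p) * ennreal (cmod (G w) powr p * (1 - cmod w) powr \<alpha>)"
          by (rule ennreal_mult) auto
        finally show ?thesis using True by simp
      qed simp
    qed
    also have "\<dots> = ennreal (2 powr p) * disk_integral p \<alpha> G"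
      unfolding disk_integral_def
      by (rule nn_integral_cmult)
        (use set_borel_measurable_powr_weight[OF holomorphic_disk_kernel[OF a(2)], of "- N" p \<alpha>] in \<open>simp only: measurable_lborel2 G_def\<close>)
    also have "\<dots> \<le> ennreal (2 powr p) * ennreal (C1 * \<delta> powr (2 + \<alpha> - N * p))"
      using C1(2)[OF a(2)] by (intro mult_left_mono) (simp_all add: G_def[abs_def] \<delta>_def)
    also have "\<dots> = ennreal (2 powr p * C1 * \<delta> powr (2 + \<alpha> - N * p))"
      using C1 by (simp add: mult.assoc flip: ennreal_mult)
    finally have D: "disk_integral p \<alpha> (poly P) \<le> ennreal (2 powr p * C1 * \<delta> powr (2 + \<alpha> - N * p))" .
    have "bergman_integral p \<alpha> (poly P) \<le> ennreal ((1 + \<alpha>) * 2 powr \<bar>\<alpha>\<bar> / pi) * disk_integral p \<alpha> (poly P)"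
      by (intro bergman_integral_compare \<alpha> set_borel_measurable_holomorphic[OF hol]) simp
    also have "\<dots> \<le> ennreal ((1 + \<alpha>) * 2 powr \<bar>\<alpha>\<bar> / pi) * ennreal (2 powr p * C1 * \<delta> powr (2 + \<alpha> - N * p))"
      by (intro mult_left_mono D) simp
    also have "\<dots> = ennreal (((1 + \<alpha>) * 2 powr \<bar>\<alpha>\<bar> / pi * (2 powr p * C1)) * \<delta> powr (2 + \<alpha> - N * p))"
      using \<alpha> C1 by (simp add: mult.assoc flip: ennreal_mult)
    finally have "bergman_norm p \<alpha> (poly P) \<le> ennreal ((((1 + \<alpha>) * 2 powr \<bar>\<alpha>\<bar> / pi * (2 powr p * C1)) * \<delta> powr (2 + \<alpha> - N * p)) powr (1 / p))"
      unfolding bergman_norm_eq using p \<alpha> C1 by (intro ennreal_powr_leI) auto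
    also have "(((1 + \<alpha>) * 2 powr \<bar>\<alpha>\<bar> / pi * (2 powr p * C1)) * \<delta> powr (2 + \<alpha> - N * p)) powr (1 / p)
        = C3 * (\<delta> powr (2 + \<alpha> - N * p)) powr (1 / p)"
      unfolding C3_def by (rule powr_mult)
    also have "(\<delta> powr (2 + \<alpha> - N * p)) powr (1 / p) = \<delta> powr ((2 + \<alpha>) / p - N)"
      using p by (simp add: powr_powr diff_divide_distrib)
    finally have norm: "bergman_norm p \<alpha> (poly P) \<le> ennreal (C3 * \<delta> powr ((2 + \<alpha>) / p - N))" .
    have "cmod (\<integral>w. poly P w * cnj w ^ k * (1 - a * cnj w) powr (- complex_of_real \<gamma> - of_nat k) \<partial>\<mu>)
        \<le> C2 * (C3 * \<delta> powr ((2 + \<alpha>) / p - N)) * \<delta> powr (- real k - \<gamma> / q)"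
      using C2(2)[OF a(2) _ norm] C3 \<delta> by (simp add: \<delta>_def)
    also have "\<dots> = C2 * C3 * (\<delta> powr ((2 + \<alpha>) / p - N) * \<delta> powr (- real k - \<gamma> / q))" by simp
    also have "\<delta> powr ((2 + \<alpha>) / p - N) * \<delta> powr (- real k - \<gamma> / q) = \<delta> powr E"
      by (subst powr_add[symmetric]) (simp add: E_def algebra_simps)
    \<comment> \<open>The remaining factors of the coefficient are the conjugate of F: conjugation
      commutes with the principal power because the base has positive real part.\<close>
    also have "(\<integral>w. poly P w * cnj w ^ k * (1 - a * cnj w) powr (- complex_of_real \<gamma> - of_nat k) \<partial>\<mu>)
        = (\<integral>w. poly P w * cnj (F w) \<partial>\<mu>)"
    proof (rule Bochner_Integration.integral_cong[OF refl])
      fix w assume "w \<in> space \<mu>"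
      then have "0 < Re (1 - cnj a * w)"
        using Re_disk_kernel_pos[OF a(2)] by (simp add: space_disk[OF sets])
      then have "cnj (G w) = cnj (1 - cnj a * w) powr cnj (complex_of_real (- N))"
        unfolding G_def by (intro cnj_powr) auto
      also have "\<dots> = (1 - a * cnj w) powr (- complex_of_real \<gamma> - of_nat k)"
        by (simp add: N_def)
      finally show "poly P w * cnj w ^ k * (1 - a * cnj w) powr (- complex_of_real \<gamma> - of_nat k) = poly P w * cnj (F w)"
        by (simp add: F_def)
    qed
    finally have X: "cmod (\<integral>w. poly P w * cnj (F w) \<partial>\<mu>) \<le> C2 * C3 * \<delta> powr E" .
    have contF: "continuous_on unit_disk F"
      unfolding F_def G_def
      by (intro continuous_on_mult continuous_on_power continuous_on_id holomorphic_on_imp_continuous_on holomorphic_disk_kernel a)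
    have Fle: "cmod (F w) \<le> \<delta> powr (- N)" if "cmod w < 1" for w
      using FG[OF that] Gle[OF that] by linarith
    have int1: "integrable \<mu> (\<lambda>w. (poly P w - F w) * cnj (F w))"
    proof (rule integrable_const_bound[where B = "\<epsilon> * \<delta> powr (- N)"])
      show "AE w in \<mu>. norm ((poly P w - F w) * cnj (F w)) \<le> \<epsilon> * \<delta> powr (- N)"
        using P Fle \<epsilon>(1) by (intro AE_I2) (auto simp: norm_mult space_disk[OF sets] less_imp_le intro!: mult_mono)
      show "(\<lambda>w. (poly P w - F w) * cnj (F w)) \<in> borel_measurable \<mu>"
        by (rule measurable_disk_fun[OF sets]) (intro continuous_intros contF)
    qed
    have int2: "integrable \<mu> (\<lambda>w. F w * cnj (F w))"
    proof (rule integrable_const_bound[where B = "\<delta> powr (- N) * \<delta> powr (- N)"])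
      show "AE w in \<mu>. norm (F w * cnj (F w)) \<le> \<delta> powr (- N) * \<delta> powr (- N)"
        using Fle by (intro AE_I2) (auto simp: norm_mult space_disk[OF sets] intro!: mult_mono)
      show "(\<lambda>w. F w * cnj (F w)) \<in> borel_measurable \<mu>"
        by (rule measurable_disk_fun[OF sets]) (intro continuous_intros contF)
    qed
    have int3: "integrable \<mu> (\<lambda>w. (cmod (F w))\<^sup>2)"
    proof (rule integrable_const_bound[where B = "(\<delta> powr (- N))\<^sup>2"])
      show "AE w in \<mu>. norm ((cmod (F w))\<^sup>2) \<le> (\<delta> powr (- N))\<^sup>2"
        using Fle by (intro AE_I2) (auto simp: space_disk[OF sets] intro!: power_mono)
      show "(\<lambda>w. (cmod (F w))\<^sup>2) \<in> borel_measurable \<mu>"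
        by (rule measurable_disk_fun[OF sets]) (intro continuous_intros contF)
    qed
    \<comment> \<open>The integral of |F|^2 differs from the pairing of the polynomial with F only
      by the approximation error.\<close>
    have "(\<integral>w. (cmod (F w))\<^sup>2 \<partial>\<mu>) = cmod (complex_of_real (\<integral>w. (cmod (F w))\<^sup>2 \<partial>\<mu>))"
      by simp
    also have "complex_of_real (\<integral>w. (cmod (F w))\<^sup>2 \<partial>\<mu>) = (\<integral>w. F w * cnj (F w) \<partial>\<mu>)"
      by (simp only: integral_complex_of_real[symmetric] complex_norm_square)
    also have "\<dots> = (\<integral>w. poly P w * cnj (F w) \<partial>\<mu>) - (\<integral>w. (poly P w - F w) * cnj (F w) \<partial>\<mu>)"
    proof -
      have "(\<integral>w. poly P w * cnj (F w) \<partial>\<mu>) = (\<integral>w. (poly P w - F w) * cnj (F w) + F w * cnj (F w) \<partial>\<mu>)"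
        by (intro Bochner_Integration.integral_cong refl) (simp add: algebra_simps)
      then show ?thesis using int1 int2 by simp
    qed
    also have "cmod \<dots> \<le> cmod (\<integral>w. poly P w * cnj (F w) \<partial>\<mu>) + cmod (\<integral>w. (poly P w - F w) * cnj (F w) \<partial>\<mu>)"
      by (rule norm_triangle_ineq4)
    also have "\<dots> \<le> C2 * C3 * \<delta> powr E + \<delta> powr E"
    proof (rule add_mono[OF X])
      have "cmod (\<integral>w. (poly P w - F w) * cnj (F w) \<partial>\<mu>) \<le> (\<integral>w. cmod ((poly P w - F w) * cnj (F w)) \<partial>\<mu>)"
        by (rule integral_norm_bound)
      also have "\<dots> \<le> (\<integral>w. \<epsilon> * \<delta> powr (- N) \<partial>\<mu>)"
      proof (rule integral_mono[OF integrable_norm[OF int1]])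
        fix w assume "w \<in> space \<mu>"
        then show "cmod ((poly P w - F w) * cnj (F w)) \<le> \<epsilon> * \<delta> powr (- N)"
          using P Fle \<epsilon>(1) by (auto simp: norm_mult space_disk[OF sets] less_imp_le intro!: mult_mono)
      qed simp
      also have "\<dots> = \<epsilon> * V * \<delta> powr (- N)" by (simp add: V_def)
      also have "\<dots> \<le> \<delta> powr E" by (rule \<epsilon>)
      finally show "cmod (\<integral>w. (poly P w - F w) * cnj (F w) \<partial>\<mu>) \<le> \<delta> powr E" .
    qed
    finally have up: "(\<integral>w. (cmod (F w))\<^sup>2 \<partial>\<mu>) \<le> (C2 * C3 + 1) * \<delta> powr E" by (simp add: algebra_simps)
    let ?B = "ball a ((1 - cmod a) / 2)"
    have "?B \<subseteq> unit_disk"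
      by (rule ball_subset_unit_disk) (use a in auto)
    then have S: "?B \<in> sets \<mu>"
      unfolding sets by (subst sets_restrict_space_iff) auto
    \<comment> \<open>On the disk |w| is at least |a| - (1 - |a|)/2, hence at least 1/4, and |1 -
      \<open>cnj a * w\<close>| is at most 5/2 \<delta>.\<close>
    define c where "c = (1 / 4) ^ k * (5 / 2 * \<delta>) powr (- N)"
    have c: "c > 0" using \<delta> by (simp add: c_def)
    have low: "c \<le> cmod (F w)" if w: "w \<in> ?B" for w
    proof -
      have w1: "cmod w < 1" using w \<open>?B \<subseteq> unit_disk\<close> by auto
      have "cmod (a - w) < (1 - cmod a) / 2" using w by (simp add: dist_norm)
      then have "1 / 4 \<le> cmod w" using norm_triangle_ineq2[of a w] a by argo
      moreover have "(5 / 2 * \<delta>) powr (- N) \<le> cmod (G w)"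
        unfolding Gm using disk_kernel_upper[OF a(2) w] disk_kernel_lower[OF a(2) w1] N a
        by (intro powr_mono2') (auto simp: \<delta>_def)
      ultimately show ?thesis
        unfolding c_def F_def norm_mult norm_power by (intro mult_mono power_mono) auto
    qed
    have "c\<^sup>2 * measure \<mu> ?B = (\<integral>w. c\<^sup>2 * indicator ?B w \<partial>\<mu>)" by (simp add: S)
    also have "\<dots> \<le> (\<integral>w. (cmod (F w))\<^sup>2 \<partial>\<mu>)"
    proof (rule integral_mono[OF _ int3])
      show "integrable \<mu> (\<lambda>w. c\<^sup>2 * indicator ?B w)"
        using S by (intro integrable_mult_right integrable_real_indicator) (auto simp: less_top[symmetric])
      fix w
      show "c\<^sup>2 * indicator ?B w \<le> (cmod (F w))\<^sup>2"
        using low[of w] c by (cases "w \<in> ?B") (auto intro!: power_mono)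
    qed
    also note up
    finally have "measure \<mu> ?B \<le> (C2 * C3 + 1) * \<delta> powr E * inverse (c\<^sup>2)"
      using c by (simp add: field_simps)
    also have "inverse (c\<^sup>2) = 16 ^ k * (5 / 2) powr (2 * N) * \<delta> powr (2 * N)"
    proof -
      have "c = inverse (4 ^ k * (5 / 2 * \<delta>) powr N)"
        by (simp add: c_def powr_minus power_one_over field_simps)
      then have "inverse (c\<^sup>2) = (4 ^ k)\<^sup>2 * ((5 / 2 * \<delta>) powr N)\<^sup>2"
        by (simp add: power_mult_distrib power_inverse)
      also have "((4::real) ^ k)\<^sup>2 = 16 ^ k"
        by (metis power_mult power_mult_distrib mult.commute power2_eq_square numeral_times_numeral semiring_norm(11,13))
      also have "((5 / 2 * \<delta>) powr N)\<^sup>2 = (5 / 2 * \<delta>) powr (2 * N)"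
        by (simp add: power2_eq_square flip: powr_add)
      also have "\<dots> = (5 / 2) powr (2 * N) * \<delta> powr (2 * N)"
        by (rule powr_mult)
      finally show ?thesis by simp
    qed
    also have "(C2 * C3 + 1) * \<delta> powr E * (16 ^ k * (5 / 2) powr (2 * N) * \<delta> powr (2 * N))
        = K1 * (\<delta> powr E * \<delta> powr (2 * N))" by (simp add: K1_def)
    also have "\<delta> powr E * \<delta> powr (2 * N) = \<delta> powr \<sigma>"
      unfolding E[symmetric] by (rule powr_add[symmetric])
    finally show ?thesis by (simp only: \<delta>_def)
  qed
  define K where "K = K1 + measure \<mu> (space \<mu>) * 2 powr \<sigma>"
  have K: "K > 0" "K1 \<le> K" "measure \<mu> (space \<mu>) * 2 powr \<sigma> \<le> K"
    using K1 by (auto simp: K_def add_pos_nonneg)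
  have "emeasure \<mu> (ball a ((1 - cmod a) / 2)) \<le> ennreal (K * (1 - cmod a) powr \<sigma>)" if a: "cmod a < 1" for a
  proof -
    have "measure \<mu> (ball a ((1 - cmod a) / 2)) \<le> K * (1 - cmod a) powr \<sigma>"
    proof (cases "1 / 2 \<le> cmod a")
      case True
      show ?thesis
        by (rule order_trans[OF main[OF True a]]) (intro mult_right_mono K, simp)
    next
      case False
      \<comment> \<open>For these centres 2 (1 - |a|) exceeds 1 and \<sigma> is positive, so the
        total mass of \<mu> suffices.\<close>
      have "1 \<le> (2 * (1 - cmod a)) powr \<sigma>"
        using False \<sigma> by (intro ge_one_powr_ge_zero) auto
      then have "measure \<mu> (space \<mu>) * 1 \<le> measure \<mu> (space \<mu>) * (2 * (1 - cmod a)) powr \<sigma>"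
        by (intro mult_left_mono) auto
      also have "\<dots> = measure \<mu> (space \<mu>) * 2 powr \<sigma> * (1 - cmod a) powr \<sigma>"
        by (simp only: powr_mult mult.assoc)
      also have "\<dots> \<le> K * (1 - cmod a) powr \<sigma>" by (intro mult_right_mono K) simp
      finally show ?thesis using bounded_measure[of "ball a ((1 - cmod a) / 2)"] by simp
    qed
    then show ?thesis unfolding emeasure_eq_measure by (rule ennreal_leI)
  qed
  then show ?thesis using K(1) unfolding ball_condition_def \<sigma>_def \<gamma>_def by auto
qed

theorem theorem1p3:
  fixes \<mu> :: "complex measure" and p q q' \<alpha> \<beta> t :: real
  assumes "finite_measure \<mu>"
    and "sets \<mu> = sets (restrict_space borel unit_disk)"
    and "0 < p" and "p \<le> 1" and "1 < q"
    and "-1 < \<beta>" and "\<beta> \<le> \<alpha>"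
    and "t = (\<beta> + 2) / (\<alpha> + 2)"
    and "1 / q + 1 / q' = 1"
  shows "toeplitz_bounded \<mu> p \<alpha> q \<beta> \<longleftrightarrow> carleson_measure (1 / p + t / q') 1 \<alpha> \<mu>"
proof -
  define s where "s = 1 / p + t / q'"
  have \<alpha>: "-1 < \<alpha>" using assms by simp
  have "1 / q' = 1 - 1 / q" using assms(9) by simp
  also have "\<dots> > 0" using assms(5) by simp
  finally have "q' > 0" by simp
  moreover have "t > 0" using assms \<alpha> by simp
  moreover have "1 / p \<ge> 1" using assms by simp
  \<comment> \<open>The Carleson embedding splits |f|^s into |f| and |f|^(s-1), and the second
    exponent must not be negative.\<close>
  ultimately have s: "s \<ge> 1" unfolding s_def by (simp add: add_increasing2)
  have \<sigma>: "s * (2 + \<alpha>) = (2 + \<alpha>) / p + (2 + \<beta>) / q'"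
  proof -
    have "t * (2 + \<alpha>) = 2 + \<beta>" using assms(8) \<alpha> by (simp add: field_simps)
    moreover have "s * (2 + \<alpha>) = (2 + \<alpha>) / p + t * (2 + \<alpha>) / q'"
      by (simp add: s_def distrib_right)
    ultimately show ?thesis by simp
  qed
  have "toeplitz_bounded \<mu> p \<alpha> q \<beta> \<longleftrightarrow> ball_condition \<mu> (s * (2 + \<alpha>))"
    unfolding \<sigma>
    using toeplitz_bounded_imp_ball_condition[OF assms(1,2,3,5,9) \<alpha> assms(6)]
      ball_condition_imp_toeplitz_bounded[OF assms(1,2,3,4,5,9) \<alpha> assms(6)] by blast
  also have "\<dots> \<longleftrightarrow> carleson_measure s 1 \<alpha> \<mu>"
    using carleson_imp_ball_condition[OF assms(2) \<alpha>, of s] ball_condition_imp_carleson[OF assms(1,2) \<alpha> s] s by auto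
  finally show ?thesis unfolding s_def .
qed

end
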